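(* Let $N\ge 3$ be an integer and let $p\ge q>0$ with $pq>1$. Consider the system $$(\mathrm{S})\qquad -\Delta u_1=|\nabla u_2|^p,\qquad -\Delta u_2=|\nabla u_1|^q,\qquad u_1,u_2\ge 0 .$$ (1) Local solutions near $0$. There exist radial solutions of (S) in $B_{r_0}\setminus\{0\}$ such that $$-\Delta u_1=|\nabla u_2|^p+C_1\delta_0,\qquad -\Delta u_2=|\nabla u_1|^q+C_2\delta_0,$$ with $C_1,C_2>0$ when $p<\frac{N}{N-1}$; with $C_1=0$, $C_2>0$ when $q<q_1$; with $C_1>0$, $C_2=0$ when $q<q_2$. (2) Global solutions. Up to additive constants: (a) For $q_2<q<q_3$, there exists an $\infty$-singular solution $(u_1^*,u_2^* )=(A_1^* r^{\frac{p(q-1)-2}{pq-1}},A_2^* r^{\frac{q(p-1)-2}{pq-1}})$, $r=|x|$, with $A_1^*,A_2^*>0$, and also solutions such that $(u_1,u_2)\sim(u_1^*,u_2^* )$ as $r\to0$ and $$\lim_{r\to\infty}r^{N-2}u_1=c_1>0,\qquad \lim_{r\to\infty}r^{(N-1)q-2}u_2=c(c_1)>0,\qquad\text{if } q<\tfrac N{N-1},$$ $$\lim_{r\to\infty}r^{N-2}u_1=c_1>0,\qquad \lim_{r\to\infty}r^{N-2}u_2=c_2>0,\qquad\text{if } q>\tfrac N{N-1}.$$ (b) For $q>q_4$, there exist cusp-solutions $(u_1,u_2)$ such that $$(u_1,u_2)\sim\bigl(|A_1^*|\, r^{\frac{p(q-1)-2}{pq-1}},\ |A_2^*|\, r^{\frac{q(p-1)-2}{pq-1}}\bigr)\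 \text{ as } r\to0,\qquad \lim_{r\to\infty}u_1=c_1>0,\quad \lim_{r\to\infty}u_2=c_2>0,$$ and there is no other global solution.
   Context: $q_1=\frac{N}{(N-1)p-1}$, $q_2=\frac{N+p}{(N-1)p}$, $q_3=\frac2{p-1}$, $q_4=\frac{p+2}{p}$ (note that $p>1$). $B_{r_0}$ is the open ball of $\mathbb{R}^N$ with center $0$ and radius $r_0>0$; $\delta_0$ is the Dirac mass at $0$, and the equations containing $\delta_0$ are understood in the sense of distributions in $B_{r_0}$. A global solution is a nonconstant radial solution of (S) in $\mathbb{R}^N\setminus\{0\}$. If $(u_1,u_2)$ satisfies the equations, so does $(u_1+k_1,u_2+k_2)$ for constants $k_1,k_2$; "up to additive constants" refers to this. A component $u_i$ is called $\infty$-singular if $\lim_{r\to0}|u_i|=\infty$, and a cusp-solution if $\lim_{r\to0}u_i=c\in\mathbb{R}$ and $\lim_{r\to0}|u_i'|=\infty$; a pair is called so when both components are. $f\sim g$ means $f/g\to1$, componentwise for pairs; $c(c_1)$ denotes a constant depending on $c_1$. Set $\beta_1=\frac{N+p-(N-1)pq}{pq-1}$, $\beta_2=\frac{N+q-(N-1)pq}{pq-1}$, $a_1=(|\beta_1||\beta_2|^p)^{\frac1{pq-1}}$, $a_2=(|\beta_2||\beta_1|^q)^{\frac1{pq-1}}$; then $|A_1^*|=\left|\frac{a_1(pq-1)}{p(q-1)-2}\right|$ and $|A_2^*|=\left|\frac{a_2(pq-1)}{q(p-1)-2}\right|$.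
   Formalization: The case C_1=0, C_2>0 also assumes p<N/(N-1), without which |∇u_2|^p is not locally integrable; in (b), since u_i is nonincreasing, the equivalence is stated for k_i-u_i ~ |A_i^*| r^{...} with k_i the limit at 0, as u_i+k_i ~ +|A_i^*| r^{...} is impossible. *)

theory Defs
  imports "HOL-Analysis.Analysis" "HOL-Library.Landau_Symbols"
begin

definition grad :: "('a::euclidean_space \<Rightarrow> real) \<Rightarrow> 'a \<Rightarrow> 'a" where
  "grad u x = (THE D. GDERIV u x :> D)"

definition laplacian :: "('a::euclidean_space \<Rightarrow> real) \<Rightarrow> 'a \<Rightarrow> real" where
  "laplacian u x =
     (\<Sum>b\<in>Basis. frechet_derivative (\<lambda>y. frechet_derivative u (at y) b) (at x) b)"

text \<open>\<open>Ck_on k S u\<close>: \<open>u\<close> is of class \<open>C\<^sup>k\<close> on \<open>S\<close>; to be used for open \<open>S\<close> only.\<close>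

primrec Ck_on :: "nat \<Rightarrow> 'a::euclidean_space set \<Rightarrow> ('a \<Rightarrow> real) \<Rightarrow> bool" where
  "Ck_on 0 S u \<longleftrightarrow> continuous_on S u"
| "Ck_on (Suc k) S u \<longleftrightarrow>
     (\<forall>x\<in>S. u differentiable (at x)) \<and>
     (\<forall>h. Ck_on k S (\<lambda>x. frechet_derivative u (at x) h))"

definition test_function :: "'a::euclidean_space set \<Rightarrow> ('a \<Rightarrow> real) \<Rightarrow> bool" where
  "test_function \<Omega> \<phi> \<longleftrightarrow>
     (\<forall>k. Ck_on k UNIV \<phi>) \<and>
     compact (closure (support_on UNIV \<phi>)) \<and> closure (support_on UNIV \<phi>) \<subseteq> \<Omega>"

definition locally_integrable :: "'a::euclidean_space set \<Rightarrow> ('a \<Rightarrow> real) \<Rightarrow> bool" where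
  "locally_integrable \<Omega> f \<longleftrightarrow>
     (\<forall>K. compact K \<and> K \<subseteq> \<Omega> \<longrightarrow> set_integrable lebesgue K f)"

text \<open>\<open>-\<Delta>u = F + C \<delta>\<^sub>0\<close> in the sense of distributions in \<open>\<Omega>\<close>. The local integrability of \<open>u\<close>
  and \<open>F\<close>, needed for both to be distributions, is part of the notion.\<close>

definition neg_laplacian_dirac ::
  "'a::euclidean_space set \<Rightarrow> ('a \<Rightarrow> real) \<Rightarrow> ('a \<Rightarrow> real) \<Rightarrow> real \<Rightarrow> bool" where
  "neg_laplacian_dirac \<Omega> u F C \<longleftrightarrow>
     locally_integrable \<Omega> u \<and> locally_integrable \<Omega> F \<and>
     (\<forall>\<phi>. test_function \<Omega> \<phi> \<longrightarrow>
        (LINT x:\<Omega>|lebesgue. u x * (- laplacian \<phi> x)) =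
        (LINT x:\<Omega>|lebesgue. F x * \<phi> x) + C * \<phi> 0)"

definition solves_S ::
  "'a::euclidean_space set \<Rightarrow> real \<Rightarrow> real \<Rightarrow> ('a \<Rightarrow> real) \<Rightarrow> ('a \<Rightarrow> real) \<Rightarrow> bool" where
  "solves_S \<Omega> p q u1 u2 \<longleftrightarrow>
     Ck_on 2 \<Omega> u1 \<and> Ck_on 2 \<Omega> u2 \<and>
     (\<forall>x\<in>\<Omega>. - laplacian u1 x = norm (grad u2 x) powr p \<and>
             - laplacian u2 x = norm (grad u1 x) powr q \<and>
             u1 x \<ge> 0 \<and> u2 x \<ge> 0)"

text \<open>Radial functions \<open>u\<^sub>i\<close> are given by their profiles: \<open>u\<^sub>i(x) = f\<^sub>i(|x|)\<close>. Below, \<open>\<Omega>\<close> never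
  contains \<open>0\<close>, so only the values of \<open>f\<^sub>i\<close> on the positive axis matter.\<close>

definition radial_solution ::
  "'a::euclidean_space set \<Rightarrow> real \<Rightarrow> real \<Rightarrow> (real \<Rightarrow> real) \<Rightarrow> (real \<Rightarrow> real) \<Rightarrow> bool" where
  "radial_solution \<Omega> p q f1 f2 \<longleftrightarrow>
     solves_S \<Omega> p q (\<lambda>x. f1 (norm x)) (\<lambda>x. f2 (norm x))"

text \<open>A radial solution in \<open>B\<^bsub>r0\<^esub> \<setminus> {0}\<close> with the equations in \<open>B\<^bsub>r0\<^esub>\<close> containing the Dirac masses
  \<open>C1 \<delta>\<^sub>0\<close> and \<open>C2 \<delta>\<^sub>0\<close>. If \<open>C2 \<noteq> 0\<close> then \<open>r\<^bsup>N-1\<^esup> f2'(r)\<close> has a nonzero limit at \<open>0\<close>, so the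
  integrability of \<open>|\<nabla>u2|\<^sup>p\<close> contained in the first equation forces \<open>p < N/(N-1)\<close>.\<close>

definition local_dirac_solution ::
  "'a::euclidean_space itself \<Rightarrow> real \<Rightarrow> real \<Rightarrow> real \<Rightarrow> real \<Rightarrow> real \<Rightarrow>
   (real \<Rightarrow> real) \<Rightarrow> (real \<Rightarrow> real) \<Rightarrow> bool" where
  "local_dirac_solution T r0 p q C1 C2 f1 f2 \<longleftrightarrow>
     radial_solution (ball (0::'a) r0 - {0}) p q f1 f2 \<and>
     neg_laplacian_dirac (ball (0::'a) r0) (\<lambda>x. f1 (norm x))
       (\<lambda>x. norm (grad (\<lambda>y. f2 (norm y)) x) powr p) C1 \<and>
     neg_laplacian_dirac (ball (0::'a) r0) (\<lambda>x. f2 (norm x))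
       (\<lambda>x. norm (grad (\<lambda>y. f1 (norm y)) x) powr q) C2"

definition global_solution ::
  "'a::euclidean_space itself \<Rightarrow> real \<Rightarrow> real \<Rightarrow> (real \<Rightarrow> real) \<Rightarrow> (real \<Rightarrow> real) \<Rightarrow> bool" where
  "global_solution T p q f1 f2 \<longleftrightarrow>
     radial_solution (UNIV - {0::'a}) p q f1 f2 \<and>
     \<not> (\<exists>k1 k2. \<forall>r>0. f1 r = k1 \<and> f2 r = k2)"

definition infinity_singular :: "(real \<Rightarrow> real) \<Rightarrow> bool" where
  "infinity_singular f \<longleftrightarrow> filterlim (\<lambda>r. \<bar>f r\<bar>) at_top (at_right 0)"

definition cusp :: "(real \<Rightarrow> real) \<Rightarrow> bool" where
  "cusp f \<longleftrightarrow> (\<exists>c. (f \<longlongrightarrow> c) (at_right 0)) \<and>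
              filterlim (\<lambda>r. \<bar>deriv f r\<bar>) at_top (at_right 0)"

definition q1 :: "nat \<Rightarrow> real \<Rightarrow> real" where
  "q1 N p = real N / ((real N - 1) * p - 1)"

definition q2 :: "nat \<Rightarrow> real \<Rightarrow> real" where
  "q2 N p = (real N + p) / ((real N - 1) * p)"

definition q3 :: "real \<Rightarrow> real" where
  "q3 p = 2 / (p - 1)"

definition q4 :: "real \<Rightarrow> real" where
  "q4 p = (p + 2) / p"

definition beta1 :: "nat \<Rightarrow> real \<Rightarrow> real \<Rightarrow> real" where
  "beta1 N p q = (real N + p - (real N - 1) * p * q) / (p * q - 1)"

definition beta2 :: "nat \<Rightarrow> real \<Rightarrow> real \<Rightarrow> real" where
  "beta2 N p q = (real N + q - (real N - 1) * p * q) / (p * q - 1)"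

definition a1 :: "nat \<Rightarrow> real \<Rightarrow> real \<Rightarrow> real" where
  "a1 N p q = (\<bar>beta1 N p q\<bar> * \<bar>beta2 N p q\<bar> powr p) powr (1 / (p * q - 1))"

definition a2 :: "nat \<Rightarrow> real \<Rightarrow> real \<Rightarrow> real" where
  "a2 N p q = (\<bar>beta2 N p q\<bar> * \<bar>beta1 N p q\<bar> powr q) powr (1 / (p * q - 1))"

text \<open>The absolute values \<open>|A\<^sub>i\<^sup>*|\<close>; in the range \<open>q2 < q < q3\<close> one has \<open>A\<^sub>i\<^sup>* > 0\<close>, so there
  these are \<open>A\<^sub>i\<^sup>*\<close> themselves.\<close>

definition A1abs :: "nat \<Rightarrow> real \<Rightarrow> real \<Rightarrow> real" where
  "A1abs N p q = \<bar>a1 N p q * (p * q - 1) / (p * (q - 1) - 2)\<bar>"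

definition A2abs :: "nat \<Rightarrow> real \<Rightarrow> real \<Rightarrow> real" where
  "A2abs N p q = \<bar>a2 N p q * (p * q - 1) / (q * (p - 1) - 2)\<bar>"

definition v1 :: "nat \<Rightarrow> real \<Rightarrow> real \<Rightarrow> real \<Rightarrow> real" where
  "v1 N p q r = A1abs N p q * r powr ((p * (q - 1) - 2) / (p * q - 1))"

definition v2 :: "nat \<Rightarrow> real \<Rightarrow> real \<Rightarrow> real \<Rightarrow> real" where
  "v2 N p q r = A2abs N p q * r powr ((q * (p - 1) - 2) / (p * q - 1))"

text \<open>Nonnegative radial solutions in the whole punctured space are nonincreasing in \<open>r\<close>, so a
  cusp-solution lies below its limit \<open>k\<^sub>i\<close> at \<open>0\<close>. Moreover, for \<open>q > q4\<close> the powers in \<open>v1\<close>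
  and \<open>v2\<close> tend to \<open>0\<close> as \<open>r \<rightarrow> 0\<close>. The equivalence \<open>u\<^sub>i \<sim> |A\<^sub>i\<^sup>*| r\<^sup>\<dots>\<close>, understood up to an
  additive constant, therefore concerns the deviation \<open>k\<^sub>i - u\<^sub>i\<close>.\<close>

definition cusp_global_solution ::
  "'a::euclidean_space itself \<Rightarrow> real \<Rightarrow> real \<Rightarrow> (real \<Rightarrow> real) \<Rightarrow> (real \<Rightarrow> real) \<Rightarrow> bool" where
  "cusp_global_solution T p q f1 f2 \<longleftrightarrow>
     global_solution T p q f1 f2 \<and> cusp f1 \<and> cusp f2 \<and>
     (\<exists>k1 k2. (\<lambda>r. k1 - f1 r) \<sim>[at_right 0] v1 DIM('a) p q \<and>
              (\<lambda>r. k2 - f2 r) \<sim>[at_right 0] v2 DIM('a) p q) \<and>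
     (\<exists>c1>0. \<exists>c2>0. (f1 \<longlongrightarrow> c1) at_top \<and> (f2 \<longlongrightarrow> c2) at_top)"

end

theory Submission
  imports Defs
begin

text \<open>
  Everything is reduced to the \<^emph>\<open>fluxes\<close> \<open>w\<^sub>i(r) = - r\<^bsup>N-1\<^esup> u\<^sub>i'(r)\<close> of the radial profiles. For them the system becomes
  the planar first-order system
  \<open>w\<^sub>1' = r\<^bsup>(N-1)(1-p)\<^esup> w\<^sub>2\<^bsup>p\<^esup>\<close>, \<open>w\<^sub>2' = r\<^bsup>(N-1)(1-q)\<^esup> w\<^sub>1\<^bsup>q\<^esup>\<close>,
  which is cooperative: its right-hand sides increase with the unknowns. The fluxes of a nonnegative
  solution are nonnegative, since a negative flux near \<open>0\<close> would force \<open>u\<^sub>i \<rightarrow> -\<infinity>\<close>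
  (\<open>flux_nonneg\<close>; this uses \<open>N \<ge> 3\<close>).

  \<^emph>\<open>Existence\<close> is monotone iteration of the integral equations between an ordered pair of barriers
  (\<open>monotone_iteration\<close>); it also covers \<open>q < 1\<close>, where the right-hand side is not Lipschitz. Near \<open>0\<close>
  the barriers are \<open>0\<close> and powers \<open>H\<^sub>i r\<^bsup>e\<^sub>i\<^esup>\<close>, and since \<open>p q > 1\<close> small \<open>H\<^sub>i\<close> work on any given
  interval; the limits \<open>C\<^sub>i\<close> of \<open>w\<^sub>i\<close> at \<open>0\<close> are, up to the area of the unit sphere, the Dirac masses.
  That these masses appear in the distributional equations is shown with Green's identity for a
  truncated solution: the flux is multiplied by a cut-off vanishing near \<open>0\<close>, so that the potential becomes
  constant there and hence \<open>C\<^sup>2\<close>, and the mass is produced by the derivative of the cut-off, whose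
  contribution is invariant under scaling (\<open>radial_dirac_mass\<close>).

  For \<open>q > q\<^sub>2\<close> the system has the exact solution \<open>w\<^sub>1\<^sup>* = a\<^sub>1 r\<^bsup>al\<^esup>\<close>, \<open>w\<^sub>2\<^sup>* = a\<^sub>2 r\<^bsup>ga\<^esup>\<close> with
  \<open>al = - \<beta>\<^sub>1 > 0\<close> and \<open>ga = - \<beta>\<^sub>2 > 0\<close>. In the variables \<open>x = w\<^sub>1/w\<^sub>1\<^sup>*\<close>, \<open>y = w\<^sub>2/w\<^sub>2\<^sup>*\<close>, \<open>t = ln r\<close> the
  system is autonomous, \<open>x' = al (y\<^bsup>p\<^esup> - x)\<close> and \<open>y' = ga (x\<^bsup>q\<^esup> - y)\<close>; its equilibria are \<open>(0,0)\<close> and the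
  saddle \<open>(1,1)\<close>. The orbit leaving the saddle towards the origin is squeezed between
  \<open>exp (- m r\<^bsup>la\<^esup>)\<close> and \<open>(1 + r\<^bsup>la\<^esup>)\<^bsup>-m\<^esup>\<close>, where \<open>la\<close> is the unstable eigenvalue at the saddle and \<open>(m, m')\<close> an
  eigenvector. With \<open>m = al/la\<close> the upper barrier keeps \<open>w\<^sub>1\<close> bounded, and everything that is needed at
  infinity follows (\<open>heteroclinic_flux_exists\<close>). The profiles are then recovered by integration and
  compared with powers by l'Hospital's rule.

  For \<open>q > q\<^sub>4\<close> every global solution has \<open>(x, y) \<rightarrow> (1, 1)\<close> at \<open>- \<infinity>\<close>, which gives the cusp asymptotics
  (\<open>global_flux_asymptotics\<close>). Nonnegativity of \<open>u\<^sub>1\<close> forces \<open>x \<rightarrow> 0\<close> at \<open>+ \<infinity>\<close>; a superlinear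
  doubling inequality \<open>x(t + 2 ln 2) \<ge> k x(t)\<^bsup>pq\<^esup>\<close> then excludes large values, so the orbit is
  bounded; and cooperativity makes both coordinates monotone near \<open>- \<infinity>\<close>, so they converge to an
  equilibrium, which cannot be the origin because \<open>p q > 1\<close>. The connecting orbit above provides a global
  solution also in this range.
\<close>

section \<open>Radial functions and the flux system\<close>

lemma norm_radial_has_derivative:
  fixes x :: "'a::euclidean_space"
  assumes "x \<noteq> 0" "(f has_real_derivative g) (at (norm x))"
  shows "((\<lambda>x. f (norm x)) has_derivative (\<lambda>h. g * (x \<bullet> h) / norm x)) (at x)"
proof -
  have 1: "(norm has_derivative (\<lambda>h. (x \<bullet> h) / norm x)) (at x)"
    using has_derivative_norm[OF assms(1)] by (simp add: sgn_div_norm inner_commute divide_inverse mult.commute)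
  have 2: "(f has_derivative (\<lambda>h. g * h)) (at (norm x))"
    using assms(2) by (simp add: has_field_derivative_def)
  show ?thesis using has_derivative_compose[OF 1 2] by simp
qed

lemma frechet_derivative_eqI:
  "(u has_derivative D) (at x) \<Longrightarrow> frechet_derivative u (at x) = D"
  using frechet_derivative_at by metis

text \<open>
  The directional derivative \<open>g(|x|) (x \<bullet> e)/|x|\<close> of a radial function is differentiated once more, as the
  product of the radial factor \<open>g(r)/r\<close> and the linear factor \<open>x \<bullet> e\<close>.
\<close>
lemma radial_derivative_has_derivative:
  fixes x e :: "'a::euclidean_space"
  assumes "x \<noteq> 0" "(g has_real_derivative h) (at (norm x))"
  shows "((\<lambda>x. g (norm x) * (x \<bullet> e) / norm x) has_derivative
     (\<lambda>k. (h - g (norm x) / norm x) * (x \<bullet> e) * (x \<bullet> k) / (norm x)\<^sup>2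
        + g (norm x) / norm x * (k \<bullet> e))) (at x)"
proof -
  let ?r = "norm x"
  have r: "?r > 0" using assms(1) by simp
  have d: "((\<lambda>r. g r / r) has_real_derivative (h / ?r - g ?r / ?r\<^sup>2)) (at ?r)"
    using r by (auto intro!: derivative_eq_intros assms(2) simp: field_simps power2_eq_square)
  have "((\<lambda>x. (g (norm x) / norm x) * (x \<bullet> e)) has_derivative
     (\<lambda>k. (g (norm x) / norm x) * (k \<bullet> e) + (h / ?r - g ?r / ?r\<^sup>2) * (x \<bullet> k) / norm x * (x \<bullet> e))) (at x)"
    by (intro has_derivative_mult norm_radial_has_derivative[OF assms(1) d]) (auto intro!: derivative_eq_intros)
  also have "(\<lambda>k. (g (norm x) / norm x) * (k \<bullet> e) + (h / ?r - g ?r / ?r\<^sup>2) * (x \<bullet> k) / norm x * (x \<bullet> e))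
    = (\<lambda>k. (h - g (norm x) / norm x) * (x \<bullet> e) * (x \<bullet> k) / (norm x)\<^sup>2
        + g (norm x) / norm x * (k \<bullet> e))"
    using r by (auto simp: fun_eq_iff field_simps power2_eq_square)
  finally show ?thesis by simp
qed

lemma frechet_derivative_transform_open:
  assumes "open S" "x \<in> S" "\<And>y. y \<in> S \<Longrightarrow> u y = v y"
  shows "frechet_derivative u (at x) = frechet_derivative v (at x)"
proof -
  have "(u has_derivative D) (at x) \<longleftrightarrow> (v has_derivative D) (at x)" for D
    using assms by (metis has_derivative_transform_within_open)
  then show ?thesis unfolding frechet_derivative_def by simp
qed

lemma differentiable_transform_open:
  assumes "open S" "x \<in> S" "\<And>y. y \<in> S \<Longrightarrow> u y = v y" "v differentiable (at x)"
  shows "u differentiable (at x)"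
  using assms unfolding differentiable_def by (metis has_derivative_transform_within_open)

lemma Ck_on_cong:
  assumes "open S" "\<And>y. y \<in> S \<Longrightarrow> u y = v y" "Ck_on k S v"
  shows "Ck_on k S u"
  using assms(2,3)
proof (induction k arbitrary: u v)
  case 0
  then show ?case by (simp cong: continuous_on_cong)
next
  case (Suc k)
  have "Ck_on k S (\<lambda>x. frechet_derivative u (at x) h)" for h
    by (rule Suc.IH[of _ "\<lambda>x. frechet_derivative v (at x) h"])
       (use Suc.prems assms(1) in \<open>auto simp: frechet_derivative_transform_open[OF assms(1) _ Suc.prems(1)]\<close>)
  then show ?case using Suc.prems differentiable_transform_open[OF assms(1)]
    by (simp) blast
qed

text \<open>
  The trace of the second derivative collapses because \<open>\<Sum>(x \<bullet> b)\<^sup>2 = |x|\<^sup>2\<close> over the basis; this is the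
  formula \<open>\<Delta> f(|x|) = f'' + (N - 1) f'/r\<close>.
\<close>
lemma radial_derivatives:
  fixes \<Omega> :: "'a::euclidean_space set"
  assumes \<Omega>: "open \<Omega>" "0 \<notin> \<Omega>"
    and f: "\<And>x. x \<in> \<Omega> \<Longrightarrow> (f has_real_derivative g (norm x)) (at (norm x))"
    and g: "\<And>x. x \<in> \<Omega> \<Longrightarrow> (g has_real_derivative h (norm x)) (at (norm x))"
    and h: "continuous_on (norm ` \<Omega>) h"
  shows "Ck_on 2 \<Omega> (\<lambda>x. f (norm x))"
    and "\<And>x. x \<in> \<Omega> \<Longrightarrow> laplacian (\<lambda>x. f (norm x)) x = h (norm x) + (real DIM('a) - 1) / norm x * g (norm x)"
    and "\<And>x. x \<in> \<Omega> \<Longrightarrow> norm (grad (\<lambda>x. f (norm x)) x) = \<bar>g (norm x)\<bar>"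
proof -
  let ?u = "\<lambda>x::'a. f (norm x)"
  let ?D = "\<lambda>e (x::'a). g (norm x) * (x \<bullet> e) / norm x"
  let ?H = "\<lambda>e k (x::'a). (h (norm x) - g (norm x) / norm x) * (x \<bullet> e) * (x \<bullet> k) / (norm x)\<^sup>2
        + g (norm x) / norm x * (k \<bullet> e)"
  have nz: "x \<noteq> 0" if "x \<in> \<Omega>" for x using that \<Omega> by auto
  have du: "(?u has_derivative (\<lambda>e. ?D e x)) (at x)" if "x \<in> \<Omega>" for x
    by (rule norm_radial_has_derivative[OF nz[OF that] f[OF that]])
  have fu: "frechet_derivative ?u (at x) = (\<lambda>e. ?D e x)" if "x \<in> \<Omega>" for x
    using frechet_derivative_eqI[OF du[OF that]] .
  have dD: "(?D e has_derivative (\<lambda>k. ?H e k x)) (at x)" if "x \<in> \<Omega>" for x e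
    by (rule radial_derivative_has_derivative[OF nz[OF that] g[OF that]])
  have fD: "frechet_derivative (?D e) (at x) = (\<lambda>k. ?H e k x)" if "x \<in> \<Omega>" for x e
    using frechet_derivative_eqI[OF dD[OF that]] .
  have ffu: "frechet_derivative (\<lambda>y. frechet_derivative ?u (at y) e) (at x) = (\<lambda>k. ?H e k x)"
    if "x \<in> \<Omega>" for x e
    using frechet_derivative_transform_open[OF \<Omega>(1) that, of "\<lambda>y. frechet_derivative ?u (at y) e" "?D e"]
      fu fD[OF that] by metis
  have cg: "continuous_on (norm ` \<Omega>) g"
    by (rule continuous_at_imp_continuous_on) (auto intro: DERIV_isCont g)
  have cH: "continuous_on \<Omega> (?H e k)" for e k
    by (intro continuous_intros continuous_on_compose2[OF h] continuous_on_compose2[OF cg])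
       (use nz in auto)
  have C0: "Ck_on 0 \<Omega> (\<lambda>x. frechet_derivative (?D e) (at x) k)" for e k
    using cH[of e k] fD by (simp cong: continuous_on_cong)
  have "Ck_on (Suc 0) \<Omega> (?D e)" for e
    using C0[of e] dD unfolding Ck_on.simps differentiable_def by blast
  then have "Ck_on (Suc 0) \<Omega> (\<lambda>x. frechet_derivative ?u (at x) e)" for e
    using Ck_on_cong[OF \<Omega>(1), where u = "\<lambda>x. frechet_derivative ?u (at x) e" and v = "?D e" and k = "Suc 0"]
      fu by (auto simp del: Ck_on.simps)
  then have "Ck_on (Suc (Suc 0)) \<Omega> ?u"
    using du unfolding Ck_on.simps(2)[of "Suc 0"] differentiable_def by blast
  then show "Ck_on 2 \<Omega> ?u" by (simp add: numeral_2_eq_2)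
  show "laplacian ?u x = h (norm x) + (real DIM('a) - 1) / norm x * g (norm x)" if x: "x \<in> \<Omega>" for x
  proof -
    have r: "norm x > 0" using nz[OF x] by simp
    have "laplacian ?u x = (\<Sum>b\<in>Basis. ?H b b x)"
      unfolding laplacian_def using ffu[OF x] by simp
    also have "\<dots> = (\<Sum>b\<in>Basis. (h (norm x) - g (norm x) / norm x) / (norm x)\<^sup>2 * ((x \<bullet> b) * (x \<bullet> b)) + g (norm x) / norm x)"
      by (rule sum.cong) (auto simp: algebra_simps)
    also have "\<dots> = (h (norm x) - g (norm x) / norm x) / (norm x)\<^sup>2 * (x \<bullet> x) + real DIM('a) * (g (norm x) / norm x)"
      by (simp only: sum.distrib sum_distrib_left[symmetric] euclidean_inner[of x x, symmetric] sum_constant)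
    also have "\<dots> = h (norm x) + (real DIM('a) - 1) / norm x * g (norm x)"
      using r by (simp add: power2_norm_eq_inner[symmetric] field_simps power2_eq_square)
    finally show ?thesis .
  qed
  show "norm (grad ?u x) = \<bar>g (norm x)\<bar>" if x: "x \<in> \<Omega>" for x
  proof -
    let ?G = "(g (norm x) / norm x) *\<^sub>R x"
    have eq: "(\<lambda>h. ?G \<bullet> h) = (\<lambda>e. ?D e x)" by auto
    have G: "GDERIV ?u x :> ?G"
      unfolding gderiv_def using du[OF x] by (simp add: inner_commute)
    have "grad ?u x = ?G"
      unfolding grad_def
    proof (rule the_equality)
      show "GDERIV ?u x :> ?G" by (rule G)
      fix D assume "GDERIV ?u x :> D"
      then have "(\<lambda>h. h \<bullet> D) = (\<lambda>h. h \<bullet> ?G)"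
        using G unfolding gderiv_def by (rule has_derivative_unique)
      then show "D = ?G" by (metis inner_commute vector_eq_ldot)
    qed
    then show ?thesis using nz[OF x] by simp
  qed
qed

text \<open>
  The first-order system solved by the fluxes \<open>w\<^sub>i = - r\<^bsup>n-1\<^esup> u\<^sub>i'\<close>; the dimension enters as a real number
  \<open>n\<close> because it only occurs in exponents.
\<close>
definition flux_system ::
  "real set \<Rightarrow> real \<Rightarrow> real \<Rightarrow> real \<Rightarrow> (real \<Rightarrow> real) \<Rightarrow> (real \<Rightarrow> real) \<Rightarrow> bool" where
  "flux_system I n p q w1 w2 \<longleftrightarrow>
    (\<forall>r\<in>I. 0 \<le> w1 r \<and> 0 \<le> w2 r \<and>
      (w1 has_real_derivative r powr ((n - 1) * (1 - p)) * w2 r powr p) (at r) \<and>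
      (w2 has_real_derivative r powr ((n - 1) * (1 - q)) * w1 r powr q) (at r))"

definition flux_profile :: "real set \<Rightarrow> real \<Rightarrow> (real \<Rightarrow> real) \<Rightarrow> (real \<Rightarrow> real) \<Rightarrow> bool" where
  "flux_profile I n w f \<longleftrightarrow> (\<forall>r\<in>I. (f has_real_derivative - (r powr (1 - n) * w r)) (at r))"

lemma continuous_on_powr_nonneg:
  fixes f :: "real \<Rightarrow> real"
  assumes "continuous_on S f" "\<And>x. x \<in> S \<Longrightarrow> 0 \<le> f x" "p > 0"
  shows "continuous_on S (\<lambda>x. f x powr p)"
  using assms by (intro continuous_on_powr') auto

lemma flux_system_continuous:
  assumes "flux_system I n p q w1 w2"
  shows "continuous_on I w1" "continuous_on I w2"
  using assms unfolding flux_system_def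
  by (auto intro!: continuous_at_imp_continuous_on DERIV_isCont)

text \<open>
  Passing to the flux removes the first-order term: \<open>f'' + (n - 1) f'/r = r\<^bsup>1-n\<^esup> (r\<^bsup>n-1\<^esup> f')'\<close>.
\<close>
lemma flux_radial_derivatives:
  fixes \<Omega> :: "'a::euclidean_space set"
  assumes \<Omega>: "open \<Omega>" "0 \<notin> \<Omega>" and n: "n = real DIM('a)"
    and w: "\<And>r. r \<in> norm ` \<Omega> \<Longrightarrow> (w has_real_derivative w' r) (at r)"
    and w': "continuous_on (norm ` \<Omega>) w'"
    and f: "flux_profile (norm ` \<Omega>) n w f"
  shows "Ck_on 2 \<Omega> (\<lambda>x. f (norm x))"
    and "\<And>x. x \<in> \<Omega> \<Longrightarrow> laplacian (\<lambda>x. f (norm x)) x = - (norm x powr (1 - n) * w' (norm x))"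
    and "\<And>x. x \<in> \<Omega> \<Longrightarrow> norm (grad (\<lambda>x. f (norm x)) x) = norm x powr (1 - n) * \<bar>w (norm x)\<bar>"
proof -
  let ?g = "\<lambda>r. - (r powr (1 - n) * w r)"
  let ?h = "\<lambda>r. - ((1 - n) * r powr (- n) * w r + r powr (1 - n) * w' r)"
  have pos: "norm x > 0" if "x \<in> \<Omega>" for x using that \<Omega> by auto
  have f': "(f has_real_derivative ?g (norm x)) (at (norm x))" if "x \<in> \<Omega>" for x
    using f that unfolding flux_profile_def by auto
  have g': "(?g has_real_derivative ?h (norm x)) (at (norm x))" if "x \<in> \<Omega>" for x
    using pos[OF that] w[of "norm x"] that by (auto intro!: derivative_eq_intros simp: field_simps)
  have cw: "continuous_on (norm ` \<Omega>) w"
    by (rule continuous_at_imp_continuous_on) (auto intro: DERIV_isCont w)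
  have ch: "continuous_on (norm ` \<Omega>) ?h"
    by (intro continuous_intros cw w') (use pos in \<open>auto simp: less_imp_neq[OF pos]\<close>)
  note R = radial_derivatives[OF \<Omega>, of f ?g ?h, OF f' g' ch]
  show "Ck_on 2 \<Omega> (\<lambda>x. f (norm x))" by (rule R(1))
  show "norm (grad (\<lambda>x. f (norm x)) x) = norm x powr (1 - n) * \<bar>w (norm x)\<bar>" if "x \<in> \<Omega>" for x
    using R(3)[OF _ _ that] by (simp add: abs_mult)
  show "laplacian (\<lambda>x. f (norm x)) x = - (norm x powr (1 - n) * w' (norm x))" if "x \<in> \<Omega>" for x
  proof -
    have "norm x powr (1 - n) = norm x * norm x powr (- n)"
      using pos[OF that] by (simp add: powr_diff powr_minus field_simps)
    then have "(n - 1) / norm x * ?g (norm x) = - ((n - 1) * norm x powr (- n) * w (norm x))"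
      using pos[OF that] by simp
    moreover have "laplacian (\<lambda>x. f (norm x)) x = ?h (norm x) + (n - 1) / norm x * ?g (norm x)"
      using R(2)[OF _ _ that] by (simp add: n)
    ultimately show ?thesis by (simp add: algebra_simps)
  qed
qed

lemma flux_radial_component:
  fixes \<Omega> :: "'a::euclidean_space set"
  assumes \<Omega>: "open \<Omega>" "0 \<notin> \<Omega>" and n: "n = real DIM('a)" and p: "p > 0"
    and w: "\<And>r. r \<in> norm ` \<Omega> \<Longrightarrow> (w has_real_derivative r powr ((n - 1) * (1 - p)) * v r powr p) (at r)"
    and v: "continuous_on (norm ` \<Omega>) v" "\<And>r. r \<in> norm ` \<Omega> \<Longrightarrow> v r \<ge> 0"
    and f: "flux_profile (norm ` \<Omega>) n w f"
  shows "Ck_on 2 \<Omega> (\<lambda>x. f (norm x))"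
    and "\<And>x. x \<in> \<Omega> \<Longrightarrow> - laplacian (\<lambda>x. f (norm x)) x = (norm x powr (1 - n) * v (norm x)) powr p"
    and "\<And>x. x \<in> \<Omega> \<Longrightarrow> norm (grad (\<lambda>x. f (norm x)) x) = norm x powr (1 - n) * \<bar>w (norm x)\<bar>"
proof -
  have pos: "norm x > 0" if "x \<in> \<Omega>" for x using that \<Omega> by auto
  have c: "continuous_on (norm ` \<Omega>) (\<lambda>r. r powr ((n - 1) * (1 - p)) * v r powr p)"
    by (intro continuous_intros continuous_on_powr_nonneg v p) (use pos in \<open>auto simp: less_imp_neq[OF pos]\<close>)
  note R = flux_radial_derivatives[OF \<Omega> n w c f]
  show "Ck_on 2 \<Omega> (\<lambda>x. f (norm x))" by (rule R(1))
  show "norm (grad (\<lambda>x. f (norm x)) x) = norm x powr (1 - n) * \<bar>w (norm x)\<bar>" if "x \<in> \<Omega>" for x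
    using R(3)[OF _ that] by simp
  show "- laplacian (\<lambda>x. f (norm x)) x = (norm x powr (1 - n) * v (norm x)) powr p" if "x \<in> \<Omega>" for x
  proof -
    have "norm x powr (1 - n) * (norm x powr ((n - 1) * (1 - p)) * v (norm x) powr p)
        = (norm x powr (1 - n) * v (norm x)) powr p"
      using pos[OF that] v(2)[of "norm x"] that
      by (simp add: powr_mult powr_powr powr_add[symmetric] mult.assoc[symmetric]) (simp add: algebra_simps)
    then show ?thesis using R(2)[OF _ that] by simp
  qed
qed

lemma flux_imp_radial_solution:
  fixes \<Omega> :: "'a::euclidean_space set"
  assumes \<Omega>: "open \<Omega>" "0 \<notin> \<Omega>" and n: "n = real DIM('a)" and pq: "p > 0" "q > 0"
    and w: "flux_system (norm ` \<Omega>) n p q w1 w2"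
    and f: "flux_profile (norm ` \<Omega>) n w1 f1" "flux_profile (norm ` \<Omega>) n w2 f2"
    and f0: "\<And>r. r \<in> norm ` \<Omega> \<Longrightarrow> 0 \<le> f1 r" "\<And>r. r \<in> norm ` \<Omega> \<Longrightarrow> 0 \<le> f2 r"
  shows "radial_solution \<Omega> p q f1 f2"
proof -
  note c = flux_system_continuous[OF w]
  have w': "r \<in> norm ` \<Omega> \<Longrightarrow> 0 \<le> w1 r" "r \<in> norm ` \<Omega> \<Longrightarrow> 0 \<le> w2 r"
    "r \<in> norm ` \<Omega> \<Longrightarrow> (w1 has_real_derivative r powr ((n - 1) * (1 - p)) * w2 r powr p) (at r)"
    "r \<in> norm ` \<Omega> \<Longrightarrow> (w2 has_real_derivative r powr ((n - 1) * (1 - q)) * w1 r powr q) (at r)" for r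
    using w unfolding flux_system_def by auto
  note R1 = flux_radial_component[OF \<Omega> n pq(1) w'(3) c(2) w'(2) f(1)]
  note R2 = flux_radial_component[OF \<Omega> n pq(2) w'(4) c(1) w'(1) f(2)]
  show ?thesis unfolding radial_solution_def solves_S_def
    using R1 R2 w' f0 by simp
qed

section \<open>Fluxes of radial solutions\<close>

lemma norm_image_punctured: "norm ` (UNIV - {0::'a::euclidean_space}) = {0<..}"
proof (intro equalityI subsetI)
  obtain e :: 'a where e: "e \<in> Basis" using nonempty_Basis by blast
  fix r :: real assume "r \<in> {0<..}"
  then have "norm (r *\<^sub>R e) = r" "r *\<^sub>R e \<in> UNIV - {0}" using e by auto
  then show "r \<in> norm ` (UNIV - {0::'a})" by (metis imageI)
qed auto

text \<open>
  The profile is the restriction of the function to a ray, so its derivatives are directional derivatives along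
  the ray.
\<close>
lemma radial_C2_imp_derivatives:
  assumes C: "Ck_on 2 (UNIV - {0::'a::euclidean_space}) (\<lambda>x. f (norm x))"
  shows "\<exists>g h. (\<forall>r>0. (f has_real_derivative g r) (at r) \<and> (g has_real_derivative h r) (at r)) \<and> continuous_on {0<..} h"
proof -
  let ?u = "\<lambda>x::'a. f (norm x)"
  obtain e :: 'a where e: "e \<in> Basis" using nonempty_Basis by blast
  have ne: "norm e = 1" "e \<noteq> 0" using e by auto
  define v where "v x = frechet_derivative ?u (at x) e" for x
  define z where "z x = frechet_derivative v (at x) e" for x
  have d1: "?u differentiable (at x)" if "x \<noteq> 0" for x
    using C that by (simp add: numeral_2_eq_2)
  have d2: "v differentiable (at x)" if "x \<noteq> 0" for x
    using C that by (simp add: numeral_2_eq_2 v_def[abs_def])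
  have d3: "continuous_on (UNIV - {0}) z"
    using C by (simp add: numeral_2_eq_2 v_def[abs_def] z_def[abs_def])
  have ray: "((\<lambda>r. u (r *\<^sub>R e)) has_real_derivative frechet_derivative u (at (r *\<^sub>R e)) e) (at r)"
    if "u differentiable (at (r *\<^sub>R e))" for u :: "'a \<Rightarrow> real" and r :: real
  proof -
    have 1: "((\<lambda>r. r *\<^sub>R e) has_derivative (\<lambda>h. h *\<^sub>R e)) (at r)"
      by (auto intro!: derivative_eq_intros)
    have D: "(u has_derivative frechet_derivative u (at (r *\<^sub>R e))) (at (r *\<^sub>R e))"
      using that frechet_derivative_works by blast
    have c: "((\<lambda>r. u (r *\<^sub>R e)) has_derivative (\<lambda>h. frechet_derivative u (at (r *\<^sub>R e)) (h *\<^sub>R e))) (at r)"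
      using has_derivative_compose[OF 1 D] .
    have lin: "linear (frechet_derivative u (at (r *\<^sub>R e)))"
      using D has_derivative_linear by blast
    have "(\<lambda>h. frechet_derivative u (at (r *\<^sub>R e)) (h *\<^sub>R e)) = (*) (frechet_derivative u (at (r *\<^sub>R e)) e)"
      by (auto simp: linear_scale[OF lin])
    then show ?thesis using c
      by (simp add: has_field_derivative_def)
  qed
  have "(f has_real_derivative v (r *\<^sub>R e)) (at r)" if "r > 0" for r
  proof -
    have "((\<lambda>r. ?u (r *\<^sub>R e)) has_real_derivative v (r *\<^sub>R e)) (at r)"
      unfolding v_def using that ne by (intro ray d1) auto
    then show ?thesis
      by (rule DERIV_cong_ev[THEN iffD1, OF refl _ refl, rotated])
         (use that ne in \<open>auto intro!: eventually_mono[OF eventually_nhds_in_open[of "{0<..}"]]\<close>)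
  qed
  moreover have "((\<lambda>r. v (r *\<^sub>R e)) has_real_derivative z (r *\<^sub>R e)) (at r)" if "r > 0" for r
    unfolding z_def using that ne by (intro ray d2) auto
  moreover have "continuous_on {0<..} (\<lambda>r. z (r *\<^sub>R e))"
    by (intro continuous_on_compose2[OF d3] continuous_intros) (use ne in auto)
  ultimately show ?thesis
    by (intro exI[of _ "\<lambda>r. v (r *\<^sub>R e)"] exI[of _ "\<lambda>r. z (r *\<^sub>R e)"]) auto
qed

text \<open>
  The signs of the fluxes are not known yet, hence the absolute values.
\<close>
lemma radial_solution_flux:
  assumes S: "radial_solution (UNIV - {0::'a::euclidean_space}) p q f1 f2"
    and n: "n = real DIM('a)"
  obtains w1 w2 where "flux_profile {0<..} n w1 f1" "flux_profile {0<..} n w2 f2"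
    "\<And>r. r > 0 \<Longrightarrow> (w1 has_real_derivative r powr ((n - 1) * (1 - p)) * \<bar>w2 r\<bar> powr p) (at r)"
    "\<And>r. r > 0 \<Longrightarrow> (w2 has_real_derivative r powr ((n - 1) * (1 - q)) * \<bar>w1 r\<bar> powr q) (at r)"
proof -
  obtain e :: 'a where e: "e \<in> Basis" using nonempty_Basis by blast
  have ne: "norm e = 1" "e \<noteq> 0" using e by auto
  note nI = norm_image_punctured[where 'a = 'a]
  have S': "Ck_on 2 (UNIV - {0::'a}) (\<lambda>x. f1 (norm x))" "Ck_on 2 (UNIV - {0::'a}) (\<lambda>x. f2 (norm x))"
    using S unfolding radial_solution_def solves_S_def by auto
  obtain g1 h1 where 1: "\<And>r. r > 0 \<Longrightarrow> (f1 has_real_derivative g1 r) (at r)"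
    "\<And>r. r > 0 \<Longrightarrow> (g1 has_real_derivative h1 r) (at r)" "continuous_on {0<..} h1"
    using radial_C2_imp_derivatives[OF S'(1)] by blast
  obtain g2 h2 where 2: "\<And>r. r > 0 \<Longrightarrow> (f2 has_real_derivative g2 r) (at r)"
    "\<And>r. r > 0 \<Longrightarrow> (g2 has_real_derivative h2 r) (at r)" "continuous_on {0<..} h2"
    using radial_C2_imp_derivatives[OF S'(2)] by blast
  have op: "open (UNIV - {0::'a})" "0 \<notin> UNIV - {0::'a}" by auto
  have R1: "\<And>x::'a. x \<noteq> 0 \<Longrightarrow> laplacian (\<lambda>x. f1 (norm x)) x = h1 (norm x) + (n - 1) / norm x * g1 (norm x)"
    "\<And>x::'a. x \<noteq> 0 \<Longrightarrow> norm (grad (\<lambda>x. f1 (norm x)) x) = \<bar>g1 (norm x)\<bar>"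
    using radial_derivatives[OF op, of f1 g1 h1] 1 unfolding nI n by auto
  have R2: "\<And>x::'a. x \<noteq> 0 \<Longrightarrow> laplacian (\<lambda>x. f2 (norm x)) x = h2 (norm x) + (n - 1) / norm x * g2 (norm x)"
    "\<And>x::'a. x \<noteq> 0 \<Longrightarrow> norm (grad (\<lambda>x. f2 (norm x)) x) = \<bar>g2 (norm x)\<bar>"
    using radial_derivatives[OF op, of f2 g2 h2] 2 unfolding nI n by auto
  have eq: "- (h1 r + (n - 1) / r * g1 r) = \<bar>g2 r\<bar> powr p" "- (h2 r + (n - 1) / r * g2 r) = \<bar>g1 r\<bar> powr q"
    if "r > 0" for r
  proof -
    let ?x = "r *\<^sub>R e"
    have x: "?x \<noteq> 0" "norm ?x = r" using that ne by auto
    then have "- laplacian (\<lambda>x. f1 (norm x)) ?x = norm (grad (\<lambda>x. f2 (norm x)) ?x) powr p"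
      "- laplacian (\<lambda>x. f2 (norm x)) ?x = norm (grad (\<lambda>x. f1 (norm x)) ?x) powr q"
      using S unfolding radial_solution_def solves_S_def by blast+
    then show "- (h1 r + (n - 1) / r * g1 r) = \<bar>g2 r\<bar> powr p" "- (h2 r + (n - 1) / r * g2 r) = \<bar>g1 r\<bar> powr q"
      unfolding R1[OF x(1)] R2[OF x(1)] x(2) by auto
  qed
  define w1 where "w1 r = - (r powr (n - 1) * g1 r)" for r
  define w2 where "w2 r = - (r powr (n - 1) * g2 r)" for r
  have inv: "r powr (1 - n) * r powr (n - 1) = 1" if "r > 0" for r
    using that by (simp add: powr_add[symmetric])
  have prof: "flux_profile {0<..} n w1 f1" "flux_profile {0<..} n w2 f2"
    unfolding flux_profile_def w1_def w2_def using 1(1) 2(1) inv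
    by (auto simp: mult.assoc[symmetric])
  have key: "((\<lambda>r. - (r powr (n - 1) * g r)) has_real_derivative r powr ((n - 1) * (1 - p)) * \<bar>- (r powr (n - 1) * kr)\<bar> powr p) (at r)"
    if r: "r > 0" and g: "(g has_real_derivative h) (at r)" and e: "- (h + (n - 1) / r * g r) = \<bar>kr\<bar> powr p" for g kr h p r
  proof -
    have "(n - 1) * (1 - p) + (n - 1) * p = n - 1" by algebra
    then have "r powr ((n - 1) * (1 - p)) * \<bar>- (r powr (n - 1) * kr)\<bar> powr p = r powr (n - 1) * \<bar>kr\<bar> powr p"
      using r by (simp add: abs_mult powr_mult powr_powr mult.assoc[symmetric] powr_add[symmetric])
    also have "\<dots> = - (r powr (n - 1) * h + (n - 1) * r powr (n - 2) * g r)"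
      using r by (simp add: e[symmetric] powr_diff power2_eq_square field_simps)
    finally show ?thesis using r
      by (auto intro!: derivative_eq_intros g simp: algebra_simps)
  qed
  show ?thesis
  proof (rule that[OF prof])
    fix r :: real assume r: "r > 0"
    show "(w1 has_real_derivative r powr ((n - 1) * (1 - p)) * \<bar>w2 r\<bar> powr p) (at r)"
      unfolding w1_def w2_def by (rule key[OF r 1(2)[OF r] eq(1)[OF r]])
    show "(w2 has_real_derivative r powr ((n - 1) * (1 - q)) * \<bar>w1 r\<bar> powr q) (at r)"
      unfolding w1_def w2_def by (rule key[OF r 2(2)[OF r] eq(2)[OF r]])
  qed
qed

lemma powr_neg_at_right_0: "s < 0 \<Longrightarrow> filterlim (\<lambda>r::real. r powr s) at_top (at_right 0)"
proof -
  assume s: "s < 0"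
  have "filterlim (\<lambda>r::real. exp (s * ln r)) at_top (at_right 0)"
  proof -
    have "filterlim (\<lambda>r::real. - ln r) at_top (at_right 0)"
      using ln_at_0 by (simp add: filterlim_uminus_at_bot)
    then have "filterlim (\<lambda>r::real. (- s) * (- ln r)) at_top (at_right 0)"
      using s by (intro filterlim_tendsto_pos_mult_at_top[OF tendsto_const[of "- s"]]) auto
    then show ?thesis
      by (intro filterlim_compose[OF exp_at_top]) simp
  qed
  then show ?thesis
    by (rule filterlim_cong[THEN iffD1, OF refl refl, rotated])
       (auto simp: powr_def eventually_at_right_less intro!: eventually_mono[OF eventually_at_right_less[of 0]])
qed

lemma powr_tendsto_0_at_right_0:
  "s > 0 \<Longrightarrow> ((\<lambda>r::real. r powr s) \<longlongrightarrow> 0) (at_right 0)"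
proof -
  assume s: "s > 0"
  have "((\<lambda>r::real. r powr s) \<longlongrightarrow> 0 powr s) (at_right 0)"
    using s by (intro tendsto_powr' tendsto_intros) (auto intro: eventually_mono[OF eventually_at_right_less[of 0]])
  then show ?thesis by simp
qed

text \<open>
  If \<open>w r < 0\<close>, then \<open>w \<le> w r\<close> on \<open>(0, r]\<close> by monotonicity, so \<open>f' \<ge> |w r| s\<^bsup>1-n\<^esup>\<close> there, and integration
  drives \<open>f\<close> to \<open>-\<infinity>\<close> at \<open>0\<close> like \<open>- s\<^bsup>2-n\<^esup>\<close>.
\<close>
lemma flux_nonneg:
  assumes n: "n > 2" and f: "flux_profile {0<..} n w f" "\<And>r. r > 0 \<Longrightarrow> 0 \<le> f r"
    and w: "\<And>r s. 0 < r \<Longrightarrow> r \<le> s \<Longrightarrow> w r \<le> w s" and r: "r > 0"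
  shows "0 \<le> w r"
proof (rule ccontr)
  assume neg: "\<not> 0 \<le> w r"
  define c where "c = - w r / (n - 2)"
  have c: "c > 0" using neg n by (simp add: c_def divide_neg_pos)
  let ?F = "\<lambda>s. f s + c * s powr (2 - n)"
  have mono: "?F s \<le> ?F r" if s: "0 < s" "s \<le> r" for s
  proof (rule DERIV_nonneg_imp_nondecreasing[OF s(2)])
    fix t assume t: "s \<le> t" "t \<le> r"
    have "(?F has_real_derivative (- (t powr (1 - n) * w t) + c * ((2 - n) * t powr (1 - n)))) (at t)"
      using f(1) t s unfolding flux_profile_def by (auto intro!: derivative_eq_intros)
    moreover have "- (t powr (1 - n) * w t) + c * ((2 - n) * t powr (1 - n)) = t powr (1 - n) * (w r - w t)"
      using n by (simp add: c_def field_simps)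
    moreover have "w r - w t \<ge> 0 \<Longrightarrow> t powr (1 - n) * (w r - w t) \<ge> 0" by simp
    ultimately show "\<exists>y. (?F has_real_derivative y) (at t) \<and> 0 \<le> y"
      using w[of t r] t s by (metis diff_ge_0_iff_ge less_le_trans)
  qed
  have "filterlim (\<lambda>s. c * s powr (2 - n)) at_top (at_right 0)"
    using n by (intro filterlim_tendsto_pos_mult_at_top[OF tendsto_const c] powr_neg_at_right_0) simp
  then have "eventually (\<lambda>s. c * s powr (2 - n) > ?F r) (at_right 0)"
    by (simp add: filterlim_at_top_dense)
  moreover have "eventually (\<lambda>s. s \<in> {0<..<r}) (at_right 0)"
    using r by (rule eventually_at_right_real)
  ultimately have "eventually (\<lambda>s. False) (at_right (0::real))"
  proof eventually_elim
    case (elim s)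
    then show ?case using mono[of s] f(2)[of s] by auto
  qed
  then show False by simp
qed

section \<open>Green's second identity\<close>

lemma lborel_integral_translation:
  fixes G :: "'a::euclidean_space \<Rightarrow> real"
  assumes "G \<in> borel_measurable borel"
  shows "(LINT x|lborel. G (x + c)) = (LINT x|lborel. G x)"
proof -
  have "(LINT x|lborel. G x) = (LINT x|distr lborel borel ((+) c). G x)"
    by (simp add: lborel_distr_plus)
  also have "\<dots> = (LINT x|lborel. G (c + x))"
    by (rule integral_distr) (use assms in auto)
  finally show ?thesis by (simp add: add.commute)
qed

lemma lborel_integral_scaling:
  fixes G :: "'a::euclidean_space \<Rightarrow> real"
  assumes "G \<in> borel_measurable borel" "c > 0"
  shows "(LINT x|lborel. G x) = (LINT x|lborel. c ^ DIM('a) * G (c *\<^sub>R x))"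
proof -
  have "(LINT x|lborel. G x) = (LINT x|density (distr lborel borel (\<lambda>x. 0 + c *\<^sub>R x)) (\<lambda>x. ennreal (\<bar>c\<bar> ^ DIM('a))). G x)"
    using lborel_affine[of c "0::'a"] assms by simp
  also have "\<dots> = (LINT x|distr lborel borel (\<lambda>x. 0 + c *\<^sub>R x). (\<bar>c\<bar> ^ DIM('a)) *\<^sub>R G x)"
    by (rule integral_density) (use assms in auto)
  also have "\<dots> = (LINT x|lborel. (\<bar>c\<bar> ^ DIM('a)) *\<^sub>R G (0 + c *\<^sub>R x))"
    by (rule integral_distr) (use assms in auto)
  finally show ?thesis using assms by simp
qed

lemma integrable_continuous_compact_support:
  fixes G :: "'a::euclidean_space \<Rightarrow> real"
  assumes "continuous_on UNIV G" "compact K" "\<And>x. x \<notin> K \<Longrightarrow> G x = 0"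
  shows "integrable lborel G"
proof -
  have "(\<lambda>x. indicator K x *\<^sub>R G x) = G"
    using assms(3) by (auto simp: fun_eq_iff indicator_def)
  then show ?thesis using borel_integrable_compact[OF assms(2), of G] assms(1)
    by (metis continuous_on_subset subset_UNIV)
qed

text \<open>
  The difference quotients have integral \<open>0\<close> by translation invariance, and they converge boundedly on a
  common compact set. This replaces the divergence theorem and any iterated integration.
\<close>
lemma integral_directional_derivative_eq_0:
  fixes G D :: "'a::euclidean_space \<Rightarrow> real"
  assumes der: "\<And>x. ((\<lambda>t. G (x + t *\<^sub>R b)) has_real_derivative D x) (at 0)"
    and D: "continuous_on UNIV D" and G: "continuous_on UNIV G"
    and K: "compact K" "\<And>x. x \<notin> K \<Longrightarrow> G x = 0" "\<And>x. x \<notin> K \<Longrightarrow> D x = 0"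
  shows "(LINT x|lborel. D x) = 0"
proof -
  obtain M where M: "\<And>x. x \<in> K \<Longrightarrow> \<bar>D x\<bar> \<le> M"
    using compact_imp_bounded[OF compact_continuous_image[OF continuous_on_subset[OF D] K(1)]]
    unfolding bounded_iff by auto
  define M' where "M' = max M 0"
  have M': "\<bar>D x\<bar> \<le> M'" "M' \<ge> 0" for x
    using M[of x] K(3)[of x] unfolding M'_def by (cases "x \<in> K"; auto)+
  obtain R where R: "\<And>x. x \<in> K \<Longrightarrow> norm x \<le> R"
    using compact_imp_bounded[OF K(1)] unfolding bounded_iff by auto
  define h where "h n = 1 / real (Suc n)" for n
  have h: "0 < h n" "h n \<le> 1" for n by (auto simp: h_def field_simps)
  have h0: "h \<longlonglongrightarrow> 0" unfolding h_def using LIMSEQ_inverse_real_of_nat by (simp add: divide_inverse)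
  have der': "((\<lambda>t. G (x + t *\<^sub>R b)) has_real_derivative D (x + t *\<^sub>R b)) (at t)" for x t
  proof -
    have "((\<lambda>s. G (x + (s + t) *\<^sub>R b)) has_real_derivative D (x + t *\<^sub>R b)) (at 0)"
      using der[of "x + t *\<^sub>R b"] by (simp add: algebra_simps)
    then show ?thesis using DERIV_shift[of "\<lambda>t. G (x + t *\<^sub>R b)" _ 0 t] by simp
  qed
  have lip: "\<bar>G (x + t *\<^sub>R b) - G x\<bar> \<le> M' * t" if t: "t > 0" for x t
  proof -
    obtain z where "G (x + t *\<^sub>R b) - G (x + 0 *\<^sub>R b) = (t - 0) * D (x + z *\<^sub>R b)"
      using MVT2[OF t, where f = "\<lambda>t. G (x + t *\<^sub>R b)" and f' = "\<lambda>t. D (x + t *\<^sub>R b)"] der' by blast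
    then show ?thesis using M'(1)[of "x + z *\<^sub>R b"] t by (simp add: abs_mult mult.commute mult_left_mono)
  qed
  define s where "s n x = (G (x + h n *\<^sub>R b) - G x) / h n" for n x
  have Gm: "G \<in> borel_measurable borel" using G by (rule borel_measurable_continuous_onI)
  have Gi: "integrable lborel G" by (rule integrable_continuous_compact_support[OF G K(1,2)])
  have Gi': "integrable lborel (\<lambda>x. G (x + c))" for c
  proof (rule integrable_continuous_compact_support)
    show "continuous_on UNIV (\<lambda>x. G (x + c))" by (intro continuous_on_compose2[OF G] continuous_intros) auto
    show "compact ((\<lambda>x. x - c) ` K)" using K(1) by (intro compact_continuous_image continuous_intros) 
    fix x assume "x \<notin> (\<lambda>x. x - c) ` K"
    then show "G (x + c) = 0" using K(2)[of "x + c"] by (metis add_diff_cancel_right' imageI)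
  qed
  have s0: "(LINT x|lborel. s n x) = 0" for n
    unfolding s_def using Gi Gi' lborel_integral_translation[OF Gm] by simp
  have "(\<lambda>n. LINT x|lborel. s n x) \<longlonglongrightarrow> (LINT x|lborel. D x)"
  proof (rule integral_dominated_convergence)
    show "D \<in> borel_measurable lborel" using borel_measurable_continuous_onI[OF D] by simp
    show "s n \<in> borel_measurable lborel" for n
      unfolding s_def[abs_def] using Gi Gi' by (auto intro!: borel_measurable_divide borel_measurable_diff borel_measurable_integrable)
    show "integrable lborel (\<lambda>x. M' * indicator (cball 0 (R + norm b)) x)"
      by (intro integrable_mult_right integrable_real_indicator) (auto simp: emeasure_bounded_finite[unfolded infinity_ennreal_def])
    show "AE x in lborel. (\<lambda>n. s n x) \<longlonglongrightarrow> D x"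
    proof (intro AE_I2)
      fix x
      have "((\<lambda>t. (G (x + t *\<^sub>R b) - G x) / t) \<longlongrightarrow> D x) (at 0)"
        using der[of x] by (simp add: DERIV_def)
      moreover have "filterlim h (at 0) sequentially"
        using h0 h by (auto simp: filterlim_at less_imp_neq[symmetric] intro!: always_eventually)
      ultimately show "(\<lambda>n. s n x) \<longlonglongrightarrow> D x" unfolding s_def by (rule filterlim_compose)
    qed
    show "AE x in lborel. norm (s n x) \<le> M' * indicator (cball 0 (R + norm b)) x" for n
    proof (intro AE_I2)
      fix x
      show "norm (s n x) \<le> M' * indicator (cball 0 (R + norm b)) x"
      proof (cases "x \<in> cball 0 (R + norm b)")
        case True
        then show ?thesis using lip[OF h(1)[of n], of x] h(1)[of n] by (simp add: s_def field_simps)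
      next
        case False
        then have nx: "norm x > R + norm b" by simp
        have "norm (h n *\<^sub>R b) \<le> norm b" using h[of n] by (simp add: mult_left_le_one_le)
        then have "norm (x + h n *\<^sub>R b) > R" using nx norm_diff_ineq[of x "h n *\<^sub>R b"] by linarith
        moreover have "norm x > R" using nx norm_ge_zero[of b] by linarith
        ultimately have "G (x + h n *\<^sub>R b) = 0" "G x = 0" using R K(2) by (metis not_le)+
        then show ?thesis using False by (simp add: s_def)
      qed
    qed
  qed
  then show ?thesis using s0 by (simp add: LIMSEQ_const_iff)
qed

lemma continuous_extension_by_zero:
  fixes h :: "'a::euclidean_space \<Rightarrow> real"
  assumes "open \<Omega>" "closed K" "K \<subseteq> \<Omega>" "continuous_on \<Omega> h" "\<And>x. x \<in> \<Omega> \<Longrightarrow> x \<notin> K \<Longrightarrow> h x = 0"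
  shows "continuous_on UNIV (\<lambda>x. if x \<in> \<Omega> then h x else 0)"
proof -
  have "continuous_on (\<Omega> \<union> - K) (\<lambda>x. if x \<in> \<Omega> then h x else 0)"
  proof (rule continuous_on_open_Un)
    show "continuous_on \<Omega> (\<lambda>x. if x \<in> \<Omega> then h x else 0)" using assms(4) by (simp cong: continuous_on_cong)
    have "continuous_on (- K) (\<lambda>x. 0::real)" by simp
    then show "continuous_on (- K) (\<lambda>x. if x \<in> \<Omega> then h x else 0)"
      by (rule continuous_on_eq) (use assms(5) in auto)
  qed (use assms in auto)
  moreover have "\<Omega> \<union> - K = UNIV" using assms(3) by auto
  ultimately show ?thesis by simp
qed

lemma Ck_on_2D:
  assumes "Ck_on 2 \<Omega> u"
  shows "\<And>x. x \<in> \<Omega> \<Longrightarrow> u differentiable (at x)"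
    "\<And>x. x \<in> \<Omega> \<Longrightarrow> (\<lambda>y. frechet_derivative u (at y) b) differentiable (at x)"
    "continuous_on \<Omega> u"
    "continuous_on \<Omega> (\<lambda>x. frechet_derivative u (at x) b)"
    "continuous_on \<Omega> (\<lambda>x. frechet_derivative (\<lambda>y. frechet_derivative u (at y) b) (at x) c)"
proof -
  show 1: "\<And>x. x \<in> \<Omega> \<Longrightarrow> u differentiable (at x)"
    and 2: "\<And>x. x \<in> \<Omega> \<Longrightarrow> (\<lambda>y. frechet_derivative u (at y) b) differentiable (at x)"
    and "continuous_on \<Omega> (\<lambda>x. frechet_derivative (\<lambda>y. frechet_derivative u (at y) b) (at x) c)"
    using assms by (simp_all add: numeral_2_eq_2)
  show "continuous_on \<Omega> u" using 1
    by (intro continuous_at_imp_continuous_on) (auto intro: differentiable_imp_continuous_within)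
  show "continuous_on \<Omega> (\<lambda>x. frechet_derivative u (at x) b)" using 2
    by (intro continuous_at_imp_continuous_on) (auto intro: differentiable_imp_continuous_within)
qed

lemma line_derivative:
  fixes u :: "'a::euclidean_space \<Rightarrow> real"
  assumes "u differentiable (at x)"
  shows "((\<lambda>t. u (x + t *\<^sub>R b)) has_real_derivative frechet_derivative u (at x) b) (at 0)"
proof -
  have D: "(u has_derivative frechet_derivative u (at x)) (at (x + 0 *\<^sub>R b))"
    using assms unfolding frechet_derivative_works by simp
  have 1: "((\<lambda>t. x + t *\<^sub>R b) has_derivative (\<lambda>h. h *\<^sub>R b)) (at 0)"
    by (auto intro!: derivative_eq_intros)
  have lin: "linear (frechet_derivative u (at x))"
    using D has_derivative_linear by blast
  have "(\<lambda>h. frechet_derivative u (at x) (h *\<^sub>R b)) = (*) (frechet_derivative u (at x) b)"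
    by (auto simp: linear_scale[OF lin])
  then show ?thesis using has_derivative_compose[OF 1 D] by (simp add: has_field_derivative_def)
qed

lemma frechet_derivative_eq_0_open:
  fixes u :: "'a::euclidean_space \<Rightarrow> real"
  assumes "open S" "x \<in> S" "\<And>y. y \<in> S \<Longrightarrow> u y = c"
  shows "frechet_derivative u (at x) b = 0"
proof -
  have "((\<lambda>y. c) has_derivative (\<lambda>h. 0)) (at x)" by simp
  then have "(u has_derivative (\<lambda>h. 0)) (at x)"
    using assms by (metis has_derivative_transform_within_open)
  then show ?thesis by (metis frechet_derivative_at)
qed

lemma laplacian_eq_0_open:
  fixes u :: "'a::euclidean_space \<Rightarrow> real"
  assumes "open S" "x \<in> S" "\<And>y. y \<in> S \<Longrightarrow> u y = c"
  shows "laplacian u x = 0"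
proof -
  have "frechet_derivative (\<lambda>y. frechet_derivative u (at y) b) (at x) b = 0" for b
    by (rule frechet_derivative_eq_0_open[OF assms(1,2)])
       (rule frechet_derivative_eq_0_open[OF assms(1) _ assms(3)])
  then show ?thesis unfolding laplacian_def by simp
qed

lemma test_functionD:
  fixes \<phi> :: "'a::euclidean_space \<Rightarrow> real"
  assumes "test_function \<Omega> \<phi>"
  obtains K where "compact K" "K \<subseteq> \<Omega>" "\<And>x. x \<notin> K \<Longrightarrow> \<phi> x = 0" "Ck_on 2 UNIV \<phi>"
proof -
  have "\<phi> x = 0" if "x \<notin> closure (support_on UNIV \<phi>)" for x
    using that closure_subset[of "support_on UNIV \<phi>"] by (auto simp: support_on_def)
  then show ?thesis using that assms unfolding test_function_def by blast
qed

text \<open>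
  For each basis vector the field \<open>\<psi> \<partial>\<^sub>b\<phi> - \<phi> \<partial>\<^sub>b\<psi>\<close>, extended by \<open>0\<close> outside the support of \<open>\<phi>\<close>, has the
  \<open>b\<close>-derivative \<open>\<psi> \<partial>\<^sub>b\<^sub>b\<phi> - \<phi> \<partial>\<^sub>b\<^sub>b\<psi>\<close>, because the mixed products cancel.
\<close>
lemma greens_second_identity:
  fixes \<psi> \<phi> :: "'a::euclidean_space \<Rightarrow> real"
  assumes \<Omega>: "open \<Omega>" and \<psi>: "Ck_on 2 \<Omega> \<psi>" and \<phi>: "test_function \<Omega> \<phi>"
  shows "set_integrable lborel \<Omega> (\<lambda>x. \<psi> x * laplacian \<phi> x)" (is ?A)
    and "set_integrable lborel \<Omega> (\<lambda>x. laplacian \<psi> x * \<phi> x)" (is ?B)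
    and "(LINT x:\<Omega>|lborel. \<psi> x * laplacian \<phi> x) = (LINT x:\<Omega>|lborel. laplacian \<psi> x * \<phi> x)"
proof -
  obtain K where K: "compact K" "K \<subseteq> \<Omega>" "\<And>x. x \<notin> K \<Longrightarrow> \<phi> x = 0" and \<phi>2: "Ck_on 2 UNIV \<phi>"
    by (rule test_functionD[OF \<phi>]) blast
  have Kc: "closed K" using K(1) by (rule compact_imp_closed)
  let ?d = "\<lambda>u b x. frechet_derivative u (at x) b"
  let ?dd = "\<lambda>u b x. frechet_derivative (\<lambda>y. frechet_derivative u (at y) b) (at x) b"
  have d0: "?d \<phi> b x = 0" if "x \<notin> K" for x b
    by (rule frechet_derivative_eq_0_open[of "- K"]) (use that Kc K(3) in auto)
  have dd0: "?dd \<phi> b x = 0" if "x \<notin> K" for x b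
    by (rule frechet_derivative_eq_0_open[of "- K"]) (use that Kc d0 in auto)
  note c\<psi> = Ck_on_2D[OF \<psi>] and c\<phi>' = Ck_on_2D[OF \<phi>2]
  have c\<phi>: "continuous_on \<Omega> \<phi>" "continuous_on \<Omega> (?d \<phi> b)" "continuous_on \<Omega> (?dd \<phi> b)" for b
    using c\<phi>'(3-5) by (auto intro: continuous_on_subset)
  let ?D = "\<lambda>b x. if x \<in> \<Omega> then \<psi> x * ?dd \<phi> b x - ?dd \<psi> b x * \<phi> x else 0"
  let ?G = "\<lambda>b x. if x \<in> \<Omega> then \<psi> x * ?d \<phi> b x - ?d \<psi> b x * \<phi> x else 0"
  have 0: "(LINT x|lborel. ?D b x) = 0" for b
  proof (rule integral_directional_derivative_eq_0[where G = "?G b" and K = K])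
    show cD: "continuous_on UNIV (?D b)"
      by (rule continuous_extension_by_zero[OF \<Omega> Kc K(2)])
         (use dd0 K in \<open>auto intro!: continuous_intros c\<psi> c\<phi>\<close>)
    show "continuous_on UNIV (?G b)"
      by (rule continuous_extension_by_zero[OF \<Omega> Kc K(2)])
         (use d0 K in \<open>auto intro!: continuous_intros c\<psi> c\<phi>\<close>)
    show "compact K" by fact
    show "?G b x = 0" "?D b x = 0" if "x \<notin> K" for x using that K d0 dd0 by auto
    fix x
    show "((\<lambda>t. ?G b (x + t *\<^sub>R b)) has_real_derivative ?D b x) (at 0)"
    proof (cases "x \<in> \<Omega>")
      case True
      have ct: "((\<lambda>t. x + t *\<^sub>R b) \<longlongrightarrow> x + 0 *\<^sub>R b) (nhds 0)"
        by (intro tendsto_intros filterlim_ident)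
      have ev: "eventually (\<lambda>t. x + t *\<^sub>R b \<in> \<Omega>) (nhds 0)"
        using topological_tendstoD[OF ct \<Omega>] True by simp
      have "((\<lambda>t. \<psi> (x + t *\<^sub>R b) * ?d \<phi> b (x + t *\<^sub>R b) - ?d \<psi> b (x + t *\<^sub>R b) * \<phi> (x + t *\<^sub>R b))
         has_real_derivative (?d \<psi> b x * ?d \<phi> b (x + 0 *\<^sub>R b) + ?dd \<phi> b x * \<psi> (x + 0 *\<^sub>R b)) -
           (?dd \<psi> b x * \<phi> (x + 0 *\<^sub>R b) + ?d \<phi> b x * ?d \<psi> b (x + 0 *\<^sub>R b))) (at 0)"
        by (intro DERIV_diff DERIV_mult line_derivative c\<psi> c\<phi>' True) auto
      moreover have "(?d \<psi> b x * ?d \<phi> b (x + 0 *\<^sub>R b) + ?dd \<phi> b x * \<psi> (x + 0 *\<^sub>R b)) -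
           (?dd \<psi> b x * \<phi> (x + 0 *\<^sub>R b) + ?d \<phi> b x * ?d \<psi> b (x + 0 *\<^sub>R b)) = ?D b x"
        using True by simp
      ultimately show ?thesis
        by (subst DERIV_cong_ev[OF refl _ refl]) (use ev in \<open>auto elim!: eventually_mono\<close>)
    next
      case False
      then have xK: "x \<in> - K" using K(2) by auto
      have ct: "((\<lambda>t. x + t *\<^sub>R b) \<longlongrightarrow> x + 0 *\<^sub>R b) (nhds 0)"
        by (intro tendsto_intros filterlim_ident)
      have ev: "eventually (\<lambda>t. x + t *\<^sub>R b \<in> - K) (nhds 0)"
        using topological_tendstoD[OF ct, of "- K"] xK Kc by auto
      have "((\<lambda>t. 0) has_real_derivative 0) (at 0)" by simp
      then show ?thesis using False
        by (subst DERIV_cong_ev[OF refl _ refl, of _ "\<lambda>t. 0"])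
          (use ev d0 K in \<open>auto elim!: eventually_mono\<close>)
    qed
  qed
  have iD: "integrable lborel (?D b)" for b
    by (rule integrable_continuous_compact_support[OF continuous_extension_by_zero[OF \<Omega> Kc K(2)] K(1)])
       (use dd0 K in \<open>auto intro!: continuous_intros c\<psi> c\<phi>\<close>)
  have cl: "continuous_on \<Omega> (laplacian \<psi>)" "continuous_on \<Omega> (laplacian \<phi>)"
    unfolding laplacian_def[abs_def] by (intro continuous_intros c\<psi> c\<phi>)+
  have l0: "laplacian \<phi> x = 0" if "x \<notin> K" for x
    unfolding laplacian_def using dd0[OF that] by simp
  have "integrable lborel (\<lambda>x. if x \<in> \<Omega> then \<psi> x * laplacian \<phi> x else 0)"
    by (rule integrable_continuous_compact_support[OF continuous_extension_by_zero[OF \<Omega> Kc K(2)] K(1)])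
       (use l0 K in \<open>auto intro!: continuous_intros c\<psi> cl\<close>)
  also have "(\<lambda>x. if x \<in> \<Omega> then \<psi> x * laplacian \<phi> x else 0) = (\<lambda>x. indicator \<Omega> x *\<^sub>R (\<psi> x * laplacian \<phi> x))"
    by (auto simp: indicator_def)
  finally show A: ?A unfolding set_integrable_def .
  have "integrable lborel (\<lambda>x. if x \<in> \<Omega> then laplacian \<psi> x * \<phi> x else 0)"
    by (rule integrable_continuous_compact_support[OF continuous_extension_by_zero[OF \<Omega> Kc K(2)] K(1)])
       (use l0 K in \<open>auto intro!: continuous_intros c\<phi> cl\<close>)
  also have "(\<lambda>x. if x \<in> \<Omega> then laplacian \<psi> x * \<phi> x else 0) = (\<lambda>x. indicator \<Omega> x *\<^sub>R (laplacian \<psi> x * \<phi> x))"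
    by (auto simp: indicator_def)
  finally show B: ?B unfolding set_integrable_def .
  have "0 = (LINT x|lborel. (\<Sum>b\<in>Basis. ?D b x))"
    using 0 iD by (subst Bochner_Integration.integral_sum) auto
  also have "\<dots> = (LINT x:\<Omega>|lborel. \<psi> x * laplacian \<phi> x - laplacian \<psi> x * \<phi> x)"
    unfolding set_lebesgue_integral_def
  proof (rule Bochner_Integration.integral_cong)
    fix x
    show "(\<Sum>b\<in>Basis. ?D b x) = indicat_real \<Omega> x *\<^sub>R (\<psi> x * laplacian \<phi> x - laplacian \<psi> x * \<phi> x)"
      by (cases "x \<in> \<Omega>") (simp_all add: laplacian_def sum_subtractf sum_distrib_left sum_distrib_right)
  qed simp
  also have "\<dots> = (LINT x:\<Omega>|lborel. \<psi> x * laplacian \<phi> x) - (LINT x:\<Omega>|lborel. laplacian \<psi> x * \<phi> x)"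
    by (rule set_integral_diff[OF A B])
  finally show "(LINT x:\<Omega>|lborel. \<psi> x * laplacian \<phi> x) = (LINT x:\<Omega>|lborel. laplacian \<psi> x * \<phi> x)"
    by simp
qed

section \<open>Integrability of powers of the norm\<close>

lemma summable_dyadic_powr:
  fixes s R :: real and N :: nat
  assumes "s > - real N" "R > 0"
  shows "summable (\<lambda>k. (R / 2 ^ Suc k) powr s * (R / 2 ^ k) ^ N)"
proof -
  define \<rho> where "\<rho> = 2 powr (- s) / 2 ^ N"
  have "\<rho> = 2 powr (- s - real N)"
    unfolding \<rho>_def by (simp add: powr_diff powr_realpow)
  also have "\<dots> < 1" using assms by (simp add: powr_less_one)
  finally have \<rho>: "\<bar>\<rho>\<bar> < 1" "\<rho> \<ge> 0" unfolding \<rho>_def by auto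
  have "(R / 2 ^ Suc k) powr s * (R / 2 ^ k) ^ N = (R powr s * R ^ N * 2 powr (- s)) * \<rho> ^ k" for k
  proof -
    have "(2 ^ Suc k :: real) powr s = (2 powr s) ^ Suc k"
      by (simp add: powr_realpow[symmetric] powr_powr powr_add[symmetric] algebra_simps del: power_Suc)
    then have "(R / 2 ^ Suc k) powr s = R powr s * (2 powr (- s)) ^ Suc k"
      using assms(2) by (simp add: powr_divide powr_minus field_simps power_divide)
    then show ?thesis
      by (simp add: \<rho>_def power_divide power_mult[symmetric] field_simps)
  qed
  then show ?thesis using \<rho> by (simp add: summable_mult summable_geometric)
qed

text \<open>
  For negative exponents the integrand is dominated by its value at the inner radius of dyadic shells, and the
  volumes of the balls \<open>R/2\<^bsup>k\<^esup>\<close> make the resulting series geometric with ratio \<open>2\<^bsup>-s-N\<^esup> < 1\<close>.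
\<close>
lemma norm_powr_integrable_ball:
  fixes s R :: real
  assumes s: "s > - real DIM('a::euclidean_space)" and R: "R > 0"
  shows "set_integrable lborel (ball 0 R) (\<lambda>x::'a. norm x powr s)"
proof (cases "s \<ge> 0")
  case True
  have 1: "integrable lborel (\<lambda>x::'a. R powr s * indicator (ball 0 R) x)"
    by (intro integrable_mult_right integrable_real_indicator)
       (auto simp: emeasure_bounded_finite[unfolded infinity_ennreal_def])
  show ?thesis unfolding set_integrable_def
  proof (rule Bochner_Integration.integrable_bound[OF 1])
    show "AE x::'a in lborel. norm (indicator (ball 0 R) x *\<^sub>R (norm x powr s)) \<le> norm (R powr s * indicator (ball 0 R) x)"
      using True by (intro AE_I2) (auto simp: indicator_def intro!: powr_mono2)
    show "(\<lambda>x::'a. indicator (ball 0 R) x *\<^sub>R (norm x powr s)) \<in> borel_measurable lborel"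
      by (intro borel_measurable_scaleR borel_measurable_indicator powr_real_measurable) auto
  qed
next
  case False
  then have s0: "s < 0" by simp
  let ?N = "DIM('a)"
  let ?f = "\<lambda>x::'a. indicator (ball 0 R) x *\<^sub>R (norm x powr s)"
  let ?c = "\<lambda>k. (R / 2 ^ Suc k) powr s"
  let ?t = "\<lambda>k (x::'a). ennreal (?c k) * indicator (ball 0 (R / 2 ^ k)) x"
  have le_suminf: "g k \<le> (\<Sum>k. g k)" for g :: "nat \<Rightarrow> ennreal" and k
    using sum_le_suminf[OF summableI, of "{k}" g] by simp
  have pt: "ennreal (norm (?f x)) \<le> (\<Sum>k. ?t k x)" for x
  proof (cases "x = 0 \<or> x \<notin> ball 0 R")
    case True
    then show ?thesis by (auto simp: indicator_def)
  next
    case False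
    then have x: "0 < norm x" "norm x < R" by auto
    obtain m where "R / norm x < 2 ^ m" using real_arch_pow[of 2 "R / norm x"] by auto
    then have "R < norm x * 2 ^ m" using x by (simp add: field_simps)
    also have "norm x * 2 ^ m \<le> norm x * 2 ^ Suc m" by (intro mult_left_mono) auto
    finally have ex: "R / 2 ^ Suc m \<le> norm x" by (simp add: divide_le_eq)
    \<comment> \<open>the dyadic shell containing \<open>x\<close>\<close>
    define k where "k = (LEAST k. R / 2 ^ Suc k \<le> norm x)"
    have k1: "R / 2 ^ Suc k \<le> norm x" unfolding k_def by (rule LeastI[of "\<lambda>k. R / 2 ^ Suc k \<le> norm x", OF ex])
    have k2: "norm x < R / 2 ^ k"
    proof (cases k)
      case 0
      then show ?thesis using x by simp
    next
      case (Suc j)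
      then have "\<not> R / 2 ^ Suc j \<le> norm x" using not_less_Least[of j "\<lambda>k. R / 2 ^ Suc k \<le> norm x"] k_def by auto
      then show ?thesis using Suc by simp
    qed
    have "norm x powr s \<le> ?c k"
      using powr_mono2'[of s "R / 2 ^ Suc k" "norm x"] s0 R k1 by simp
    then have "ennreal (norm (?f x)) \<le> ?t k x" using k2 x by (simp add: indicator_def ennreal_leI)
    also have "\<dots> \<le> (\<Sum>k. ?t k x)"
      by (rule le_suminf)
    finally show ?thesis .
  qed
  have int: "(\<integral>\<^sup>+x. ?t k x \<partial>lborel) = ennreal (unit_ball_vol (real ?N) * (?c k * (R / 2 ^ k) ^ ?N))" for k
  proof -
    have "(\<integral>\<^sup>+x. ?t k x \<partial>lborel) = ennreal (?c k) * ennreal (unit_ball_vol (real ?N) * (R / 2 ^ k) ^ ?N)"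
      using R by (subst nn_integral_cmult_indicator) (auto simp: emeasure_ball)
    then show ?thesis by (simp add: ennreal_mult'[symmetric] algebra_simps)
  qed
  have mt: "?t k \<in> borel_measurable lborel" for k
    by (intro borel_measurable_times_ennreal borel_measurable_indicator borel_measurable_const) auto
  have "(\<integral>\<^sup>+x. ennreal (norm (?f x)) \<partial>lborel) \<le> (\<integral>\<^sup>+x. (\<Sum>k. ?t k x) \<partial>lborel)"
    by (intro nn_integral_mono pt)
  also have "\<dots> = (\<Sum>k. ennreal (unit_ball_vol (real ?N) * (?c k * (R / 2 ^ k) ^ ?N)))"
    unfolding nn_integral_suminf[OF mt] int ..
  also have "\<dots> < \<infinity>"
  proof -
    have "(\<Sum>k. ennreal (unit_ball_vol (real ?N) * (?c k * (R / 2 ^ k) ^ ?N))) \<noteq> top"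
      by (intro ennreal_suminf_neq_top summable_mult summable_dyadic_powr[OF s R]) (use R in simp)
    then show ?thesis by (simp only: less_top infinity_ennreal_def)
  qed
  finally have fin: "(\<integral>\<^sup>+x. ennreal (norm (?f x)) \<partial>lborel) < \<infinity>" .
  show ?thesis unfolding set_integrable_def
  proof (rule integrableI_bounded[OF _ fin])
    show "?f \<in> borel_measurable lborel"
      by (intro borel_measurable_scaleR borel_measurable_indicator powr_real_measurable) auto
  qed
qed

section \<open>Dirac masses of radial functions\<close>

text \<open>
  A normalised primitive of the bump \<open>max 0 ((s - 1)(2 - s))\<close>; class \<open>C\<^sup>1\<close> suffices, since only one derivative of the
  cut-off enters below.
\<close>
lemma smooth_step_exists:
  obtains \<eta> \<eta>' :: "real \<Rightarrow> real" where
    "\<And>s. (\<eta> has_real_derivative \<eta>' s) (at s)" "continuous_on UNIV \<eta>'" "\<And>s. \<eta>' s \<ge> 0"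
    "\<And>s. s \<le> 1 \<Longrightarrow> \<eta> s = 0" "\<And>s. s \<ge> 2 \<Longrightarrow> \<eta> s = 1"
    "\<And>s. s \<le> 1 \<or> s \<ge> 2 \<Longrightarrow> \<eta>' s = 0" "\<eta>' (3/2) > 0" "\<And>s. 0 \<le> \<eta> s \<and> \<eta> s \<le> 1"
proof -
  define b where "b s = max 0 ((s - 1) * (2 - s))" for s :: real
  have bc: "continuous_on UNIV b" unfolding b_def by (intro continuous_intros)
  have b0: "b s \<ge> 0" for s unfolding b_def by simp
  have bz: "b s = 0" if "s \<le> 1 \<or> s \<ge> 2" for s
  proof -
    have "(s - 1) * (2 - s) \<le> 0"
      using that by (auto intro: mult_nonpos_nonneg mult_nonneg_nonpos)
    then show ?thesis unfolding b_def by simp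
  qed
  have bp: "b s > 0" if "1 < s" "s < 2" for s
    using that unfolding b_def by (simp add: max_def mult_less_0_iff not_le)
  obtain F where F: "\<And>s. (F has_real_derivative b s) (at s)"
    using einterval_antiderivative[of "-\<infinity>" \<infinity> b] bc
    by (auto simp: continuous_on_eq_continuous_at has_real_derivative_iff_has_vector_derivative)
  have mono: "F x \<le> F y" if "x \<le> y" for x y
    by (rule DERIV_nonneg_imp_nondecreasing[OF that]) (use F b0 in blast)
  have c: "F 2 > F 1"
    by (rule DERIV_pos_imp_increasing_open[of 1 2])
       (use F bp in \<open>auto intro!: continuous_at_imp_continuous_on DERIV_isCont[OF F]\<close>)
  have Fc: "continuous_on S F" for S
    by (intro continuous_at_imp_continuous_on ballI DERIV_isCont[OF F])
  have F0: "(F has_real_derivative 0) (at s)" if "s \<le> 1 \<or> s \<ge> 2" for s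
    using F[of s] bz[OF that] by simp
  have F1: "F s = F 1" if "s \<le> 1" for s
  proof (cases "s < 1")
    case True
    show ?thesis
      by (rule DERIV_isconst2[of s 1, OF True Fc, symmetric]) (use F0 True in auto)
  qed (use that in simp)
  have F2: "F s = F 2" if "s \<ge> 2" for s
  proof (cases "s > 2")
    case True
    show ?thesis
      by (rule DERIV_isconst2[of 2 s, OF True Fc]) (use F0 True in auto)
  qed (use that in simp)
  define a where "a = F 2 - F 1"
  have a: "a > 0" using c by (simp add: a_def)
  show ?thesis
  proof (rule that[of "\<lambda>s. (F s - F 1) / a" "\<lambda>s. b s / a"])
    show "((\<lambda>s. (F s - F 1) / a) has_real_derivative b s / a) (at s)" for s
      using F[of s] a by (auto intro!: derivative_eq_intros)
    show "continuous_on UNIV (\<lambda>s. b s / a)" using a by (intro continuous_intros bc) auto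
    show "0 \<le> (F s - F 1) / a \<and> (F s - F 1) / a \<le> 1" for s
    proof -
      have "F 1 \<le> F s" using mono[of 1 s] F1[of s] by (cases "s \<le> 1") auto
      moreover have "F s \<le> F 2" using mono[of s 2] F2[of s] by (cases "s \<ge> 2") auto
      ultimately show ?thesis using a by (simp add: a_def field_simps)
    qed
    show "b s / a \<ge> 0" for s using a b0 by simp
    show "(F s - F 1) / a = 0" if "s \<le> 1" for s using F1[OF that] by simp
    show "(F s - F 1) / a = 1" if "s \<ge> 2" for s using F2[OF that] a unfolding a_def by simp
    show "b s / a = 0" if "s \<le> 1 \<or> s \<ge> 2" for s using bz[OF that] by simp
    show "b (3/2) / a > 0" using a bp by simp
  qed
qed

lemma Ck_on_const: "Ck_on k S (\<lambda>x. c)"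
proof (induction k arbitrary: c)
  case (Suc k)
  have "frechet_derivative (\<lambda>x::'a. c) (at x) h = 0" for x h
    by (rule frechet_derivative_eq_0_open[of UNIV]) auto
  then show ?case using Suc by simp
qed simp

lemma Ck_on_Un:
  assumes "open A" "open B" "Ck_on k A u" "Ck_on k B u"
  shows "Ck_on k (A \<union> B) u"
  using assms(3,4)
proof (induction k arbitrary: u)
  case 0
  then show ?case using assms(1,2) by (simp add: continuous_on_open_Un)
next
  case (Suc k)
  then show ?case by (simp only: Ck_on.simps) blast
qed

lemma flux_profile_subset: "flux_profile J n w f \<Longrightarrow> I \<subseteq> J \<Longrightarrow> flux_profile I n w f"
  unfolding flux_profile_def by blast

text \<open>
  The cut-off acts on the flux, not on the function itself. The function \<open>\<psi>\<close> with flux \<open>\<eta>(r/\<epsilon>) w\<close> is constant near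
  \<open>0\<close>, hence \<open>C\<^sup>2\<close> across the origin; it agrees with \<open>f\<close> beyond \<open>2 \<epsilon>\<close>; and \<open>f\<close> dominates it, because its flux is the
  smaller one. So only a first derivative of the cut-off occurs, and it multiplies \<open>w\<close> alone.
\<close>
lemma cutoff_profile:
  fixes w w' f \<eta> \<eta>' :: "real \<Rightarrow> real" and n R \<epsilon> :: real
  assumes n: "n = real DIM('a::euclidean_space)"
    and \<epsilon>: "0 < \<epsilon>" "2 * \<epsilon> < R"
    and \<eta>: "\<And>s. (\<eta> has_real_derivative \<eta>' s) (at s)" "continuous_on UNIV \<eta>'"
      "\<And>s. s \<le> 1 \<Longrightarrow> \<eta> s = 0" "\<And>s. s \<ge> 2 \<Longrightarrow> \<eta> s = 1" "\<And>s. s \<le> 1 \<or> s \<ge> 2 \<Longrightarrow> \<eta>' s = 0"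
      "\<And>s. 0 \<le> \<eta> s \<and> \<eta> s \<le> 1"
    and f: "flux_profile {0<..<R} n w f" "\<And>r. r \<in> {0<..<R} \<Longrightarrow> 0 \<le> f r"
    and w: "\<And>r. r \<in> {0<..<R} \<Longrightarrow> (w has_real_derivative w' r) (at r)" "\<And>r. r \<in> {0<..<R} \<Longrightarrow> 0 \<le> w r"
    and w': "continuous_on {0<..<R} w'"
  shows "\<exists>\<psi> :: 'a \<Rightarrow> real. Ck_on 2 (ball 0 R) \<psi> \<and>
    (\<forall>x\<in>ball 0 R. laplacian \<psi> x =
       - (norm x powr (1 - n) * (\<eta>' (norm x / \<epsilon>) / \<epsilon> * w (norm x) + \<eta> (norm x / \<epsilon>) * w' (norm x)))) \<and>
    (\<forall>x\<in>ball 0 R. 2 * \<epsilon> \<le> norm x \<longrightarrow> \<psi> x = f (norm x)) \<and>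
    (\<forall>x\<in>ball 0 R. x \<noteq> 0 \<longrightarrow> 0 \<le> \<psi> x \<and> \<psi> x \<le> f (norm x))"
proof -
  have c\<eta>: "continuous_on S \<eta>" for S
    by (intro continuous_at_imp_continuous_on ballI DERIV_isCont[OF \<eta>(1)])
  have cw: "continuous_on {0<..<R} w"
    by (rule continuous_at_imp_continuous_on) (auto intro!: DERIV_isCont w)
  let ?g' = "\<lambda>r. - (r powr (1 - n) * (\<eta> (r / \<epsilon>) * w r))"
  have "continuous_on {0<..<R} ?g'"
    by (intro continuous_intros cw continuous_on_compose2[OF c\<eta>[of UNIV]]) (use \<epsilon> in auto)
  then have "isCont ?g' r" if "0 < r" "r < R" for r
    using that by (simp add: continuous_on_eq_continuous_at)
  then obtain g0 where g0: "\<And>r. 0 < r \<Longrightarrow> r < R \<Longrightarrow> (g0 has_real_derivative ?g' r) (at r)"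
    using einterval_antiderivative[of 0 "ereal R" ?g'] \<epsilon>
    by (auto simp: has_real_derivative_iff_has_vector_derivative zero_ereal_def)
  define g1 where "g1 r = g0 r - g0 (2 * \<epsilon>) + f (2 * \<epsilon>)" for r
  have g1: "(g1 has_real_derivative ?g' r) (at r)" if "0 < r" "r < R" for r
    unfolding g1_def using g0[OF that] by (auto intro!: derivative_eq_intros)
  have g1c: "g1 r = g1 \<epsilon>" if "0 < r" "r < \<epsilon>" for r
  proof -
    have "g1 \<epsilon> = g1 r"
    proof (rule DERIV_isconst2[of r \<epsilon>])
      show "continuous_on {r..\<epsilon>} g1"
        by (intro continuous_at_imp_continuous_on ballI DERIV_isCont[OF g1]) (use that \<epsilon> in auto)
      fix x assume "r < x" "x < \<epsilon>"
      then show "(g1 has_real_derivative 0) (at x)"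
        using g1[of x] \<eta>(3)[of "x / \<epsilon>"] that \<epsilon> by simp
    qed (use that in auto)
    then show ?thesis by simp
  qed
  \<comment> \<open>equal to \<open>g1\<close> on the positive axis; the case distinction fixes the value at the origin\<close>
  define g where "g r = (if r < \<epsilon> then g1 \<epsilon> else g1 r)" for r
  have gg1: "g r = g1 r" if "0 < r" for r unfolding g_def using g1c that by auto
  have prof: "flux_profile {0<..<R} n (\<lambda>r. \<eta> (r / \<epsilon>) * w r) g"
    unfolding flux_profile_def
  proof
    fix r assume r: "r \<in> {0<..<R}"
    show "(g has_real_derivative ?g' r) (at r)"
      by (rule has_field_derivative_transform_within_open[OF g1, of _ "{0<..<R}"])
         (use r gg1 in auto)
  qed
  let ?w' = "\<lambda>r. \<eta>' (r / \<epsilon>) / \<epsilon> * w r + \<eta> (r / \<epsilon>) * w' r"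
  have dw: "((\<lambda>r. \<eta> (r / \<epsilon>) * w r) has_real_derivative ?w' r) (at r)" if "r \<in> {0<..<R}" for r
  proof -
    have "((\<lambda>r. \<eta> (r / \<epsilon>)) has_real_derivative \<eta>' (r / \<epsilon>) * (1 / \<epsilon>)) (at r)"
      by (rule DERIV_chain2[OF \<eta>(1)]) (use \<epsilon> in \<open>auto intro!: derivative_eq_intros\<close>)
    from DERIV_mult[OF this w(1)[OF that]] show ?thesis by (simp add: algebra_simps)
  qed
  have cw': "continuous_on {0<..<R} ?w'"
    by (intro continuous_intros cw w' continuous_on_compose2[OF c\<eta>[of UNIV]] continuous_on_compose2[OF \<eta>(2)])
       (use \<epsilon> in auto)
  have ni: "norm ` (ball 0 R - {0::'a}) \<subseteq> {0<..<R}" by auto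
  have op: "open (ball 0 R - {0::'a})" "0 \<notin> ball 0 R - {0::'a}" by auto
  note D = flux_radial_derivatives[OF op n dw continuous_on_subset[OF cw' ni] flux_profile_subset[OF prof ni]]
  let ?\<psi> = "\<lambda>x::'a. g (norm x)"
  have const: "?\<psi> y = g1 \<epsilon>" if "y \<in> ball 0 \<epsilon>" for y using that by (simp add: g_def)
  have "Ck_on 2 ((ball 0 R - {0}) \<union> ball 0 \<epsilon>) ?\<psi>"
  proof (rule Ck_on_Un)
    show "Ck_on 2 (ball 0 R - {0}) ?\<psi>" by (rule D(1)) (use ni in auto)
    show "Ck_on 2 (ball 0 \<epsilon>) ?\<psi>"
      by (rule Ck_on_cong[OF _ const Ck_on_const]) auto
  qed auto
  moreover have "(ball 0 R - {0}) \<union> ball 0 \<epsilon> = (ball 0 R :: 'a set)" using \<epsilon> by auto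
  ultimately have C: "Ck_on 2 (ball 0 R) ?\<psi>" by simp
  have lap: "laplacian ?\<psi> x = - (norm x powr (1 - n) * ?w' (norm x))" if "x \<in> ball 0 R" for x
  proof (cases "x = 0")
    case True
    have "laplacian ?\<psi> x = 0"
      by (rule laplacian_eq_0_open[OF open_ball[of 0 \<epsilon>] _ const]) (use True \<epsilon> in auto)
    then show ?thesis using True by simp
  next
    case False
    show ?thesis by (rule D(2)) (use False that ni in auto)
  qed
  have fg': "((\<lambda>r. f r - g1 r) has_real_derivative - (r powr (1 - n) * ((1 - \<eta> (r / \<epsilon>)) * w r))) (at r)"
    if "0 < r" "r < R" for r
  proof -
    have "(f has_real_derivative - (r powr (1 - n) * w r)) (at r)"
      using f(1) that unfolding flux_profile_def by auto
    from DERIV_diff[OF this g1[OF that]] show ?thesis by (simp add: algebra_simps)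
  qed
  have antif: "f s - g1 s \<le> f r - g1 r" if "0 < r" "r \<le> s" "s < R" for r s
  proof (rule DERIV_nonpos_imp_nonincreasing[OF that(2)])
    fix x assume x: "r \<le> x" "x \<le> s"
    have "- (x powr (1 - n) * ((1 - \<eta> (x / \<epsilon>)) * w x)) \<le> 0" using \<eta>(6)[of "x / \<epsilon>"] w(2)[of x] x that by auto
    moreover have "0 < x" "x < R" using x that by auto
    ultimately show "\<exists>y. ((\<lambda>r. f r - g1 r) has_real_derivative y) (at x) \<and> y \<le> 0" using fg' by blast
  qed
  have antig: "g1 s \<le> g1 r" if "0 < r" "r \<le> s" "s < R" for r s
  proof (rule DERIV_nonpos_imp_nonincreasing[OF that(2)])
    fix x assume x: "r \<le> x" "x \<le> s"
    have "?g' x \<le> 0" using \<eta>(6)[of "x / \<epsilon>"] w(2)[of x] x that by auto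
    moreover have "0 < x" "x < R" using x that by auto
    ultimately show "\<exists>y. (g1 has_real_derivative y) (at x) \<and> y \<le> 0" using g1 by blast
  qed
  have fg2: "f r = g1 r" if "2 * \<epsilon> \<le> r" "r < R" for r
  proof (cases "2 * \<epsilon> = r")
    case True
    then show ?thesis by (simp add: g1_def)
  next
    case False
    have "f r - g1 r = f (2 * \<epsilon>) - g1 (2 * \<epsilon>)"
    proof (rule DERIV_isconst2[of "2 * \<epsilon>" r])
      show "continuous_on {2 * \<epsilon>..r} (\<lambda>r. f r - g1 r)"
        by (intro continuous_at_imp_continuous_on ballI DERIV_isCont[OF fg']) (use that \<epsilon> in auto)
      fix x assume x: "2 * \<epsilon> < x" "x < r"
      then have "x / \<epsilon> \<ge> 2" using \<epsilon> by (simp add: field_simps)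
      then show "((\<lambda>r. f r - g1 r) has_real_derivative 0) (at x)"
        using fg'[of x] x \<eta>(4)[of "x / \<epsilon>"] that \<epsilon> by simp
    qed (use that False in auto)
    then show ?thesis by (simp add: g1_def)
  qed
  have far: "?\<psi> x = f (norm x)" if x: "x \<in> ball 0 R" and that: "2 * \<epsilon> \<le> norm x" for x :: 'a
  proof -
    have "norm x > 0" using that \<epsilon> by linarith
    then show ?thesis using fg2[OF that] gg1[of "norm x"] x by simp
  qed
  have bd: "0 \<le> ?\<psi> x \<and> ?\<psi> x \<le> f (norm x)" if x: "x \<in> ball 0 R" and x0: "x \<noteq> 0" for x :: 'a
  proof (cases "2 * \<epsilon> \<le> norm x")
    case True
    then show ?thesis using fg2[OF True] gg1[of "norm x"] x x0 f(2)[of "norm x"] by simp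
  next
    case False
    then show ?thesis
      using antif[of "norm x" "2 * \<epsilon>"] antig[of "norm x" "2 * \<epsilon>"] fg2[of "2 * \<epsilon>"] f(2)[of "2 * \<epsilon>"]
        gg1[of "norm x"] x0 \<epsilon> by auto
  qed
  show ?thesis using C lap far bd by (intro exI[of _ ?\<psi>]) blast
qed

lemma set_integrable_mult_bounded:
  fixes u b :: "'a \<Rightarrow> real"
  assumes "set_integrable M \<Omega> u" "b \<in> borel_measurable M" "\<And>x. \<bar>b x\<bar> \<le> B"
  shows "set_integrable M \<Omega> (\<lambda>x. u x * b x)"
  unfolding set_integrable_def
proof (rule Bochner_Integration.integrable_bound)
  show "integrable M (\<lambda>x. B * (indicator \<Omega> x *\<^sub>R u x))"
    using assms(1) unfolding set_integrable_def by (rule integrable_mult_right)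
  have "(\<lambda>x. (indicator \<Omega> x *\<^sub>R u x) * b x) \<in> borel_measurable M"
    using assms unfolding set_integrable_def by (intro borel_measurable_times) auto
  then show "(\<lambda>x. indicator \<Omega> x *\<^sub>R (u x * b x)) \<in> borel_measurable M"
    by (simp add: mult.assoc)
  show "AE x in M. norm (indicator \<Omega> x *\<^sub>R (u x * b x)) \<le> norm (B * (indicator \<Omega> x *\<^sub>R u x))"
  proof (intro AE_I2)
    fix x
    have "\<bar>b x\<bar> \<le> \<bar>B\<bar>" using assms(3)[of x] by linarith
    then show "norm (indicator \<Omega> x *\<^sub>R (u x * b x)) \<le> norm (B * (indicator \<Omega> x *\<^sub>R u x))"
      using mult_left_mono[of "\<bar>b x\<bar>" "\<bar>B\<bar>" "\<bar>u x\<bar>"] by (auto simp: indicator_def abs_mult mult.commute)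
  qed
qed

lemma continuous_compact_support_bounded:
  fixes b :: "'a::euclidean_space \<Rightarrow> real"
  assumes "continuous_on UNIV b" "compact K" "\<And>x. x \<notin> K \<Longrightarrow> b x = 0"
  obtains B where "\<And>x. \<bar>b x\<bar> \<le> B"
proof -
  obtain M where M: "\<And>x. x \<in> K \<Longrightarrow> \<bar>b x\<bar> \<le> M"
    using compact_imp_bounded[OF compact_continuous_image[OF continuous_on_subset[OF assms(1)] assms(2)]]
    unfolding bounded_iff by auto
  show ?thesis
  proof (rule that)
    fix x show "\<bar>b x\<bar> \<le> max M 0" using M[of x] assms(3)[of x] by (cases "x \<in> K") auto
  qed
qed

lemma test_function_bounds:
  fixes \<phi> :: "'a::euclidean_space \<Rightarrow> real"
  assumes "test_function \<Omega> \<phi>"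
  obtains B where "continuous_on UNIV \<phi>" "continuous_on UNIV (laplacian \<phi>)"
    "\<And>x. \<bar>\<phi> x\<bar> \<le> B" "\<And>x. \<bar>laplacian \<phi> x\<bar> \<le> B"
proof -
  obtain K where K: "compact K" "K \<subseteq> \<Omega>" "\<And>x. x \<notin> K \<Longrightarrow> \<phi> x = 0" and C: "Ck_on 2 UNIV \<phi>"
    by (rule test_functionD[OF assms]) blast
  note c = Ck_on_2D[OF C]
  have cl: "continuous_on UNIV (laplacian \<phi>)"
    unfolding laplacian_def[abs_def] by (intro continuous_intros c)
  have l0: "laplacian \<phi> x = 0" if "x \<notin> K" for x
    by (rule laplacian_eq_0_open[of "- K"]) (use that K compact_imp_closed in auto)
  obtain B1 where 1: "\<And>x. \<bar>\<phi> x\<bar> \<le> B1"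
    using continuous_compact_support_bounded[OF c(3) K(1,3)] by blast
  obtain B2 where 2: "\<And>x. \<bar>laplacian \<phi> x\<bar> \<le> B2"
    using continuous_compact_support_bounded[OF cl K(1) l0] by blast
  show ?thesis by (rule that[of "max B1 B2"]) (use c(3) cl 1 2 in \<open>auto intro: max.coboundedI1 max.coboundedI2\<close>)
qed

text \<open>
  For \<open>e = 1 - N\<close> and \<open>\<eta>'\<close> of integral \<open>1\<close> this is the area of the unit sphere; only its positivity matters, so it is
  never computed.
\<close>
lemma annulus_weight:
  fixes \<eta>' :: "real \<Rightarrow> real" and e :: real
  assumes "continuous_on UNIV \<eta>'" "\<And>s. \<eta>' s \<ge> 0" "\<And>s. s \<le> 1 \<or> s \<ge> 2 \<Longrightarrow> \<eta>' s = 0" "\<eta>' (3/2) > 0"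
  defines "h \<equiv> \<lambda>y::'a::euclidean_space. norm y powr e * \<eta>' (norm y)"
  shows "continuous_on UNIV h" "integrable lborel h" "(LINT y|lborel. h y) > 0"
proof -
  let ?K = "cball 0 2 - ball 0 1 :: 'a set"
  have K: "compact ?K" by (intro compact_diff) auto
  have "continuous_on UNIV (\<lambda>x. if x \<in> - {0::'a} then norm x powr e * \<eta>' (norm x) else 0)"
    by (rule continuous_extension_by_zero[where K = ?K])
       (use K compact_imp_closed assms(3) in \<open>auto intro!: continuous_intros continuous_on_compose2[OF assms(1)]\<close>)
  also have "(\<lambda>x. if x \<in> - {0::'a} then norm x powr e * \<eta>' (norm x) else 0) = h"
    by (auto simp: h_def)
  finally show c: "continuous_on UNIV h" .
  have h0: "h x = 0" if "x \<notin> ?K" for x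
    using that assms(3)[of "norm x"] by (auto simp: h_def)
  show i: "integrable lborel h" by (rule integrable_continuous_compact_support[OF c K h0])
  obtain b :: 'a where b: "b \<in> Basis" using nonempty_Basis by blast
  define y where "y = (3/2) *\<^sub>R b"
  have ny: "norm y = 3/2" using b by (simp add: y_def)
  have hy: "h y > 0" unfolding h_def ny using assms(4) by simp
  have "open {x. h x > h y / 2}" using c by (intro open_Collect_less) auto
  moreover have "y \<in> {x. h x > h y / 2}" using hy by simp
  ultimately obtain d where d: "d > 0" "ball y d \<subseteq> {x. h x > h y / 2}"
    by (meson open_contains_ball)
  have pos: "h x \<ge> 0" for x using assms(2) by (simp add: h_def)
  have fin: "emeasure lborel (ball y d) < top"
    by (simp add: emeasure_bounded_finite[unfolded infinity_ennreal_def])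
  have "0 < h y / 2 * measure lborel (ball y d)" using hy d(1) content_ball_pos[of d y] by simp
  also have "\<dots> = (LINT x|lborel. h y / 2 * indicator (ball y d) x)" using fin by simp
  also have "\<dots> \<le> (LINT x|lborel. h x)"
  proof (rule integral_mono)
    show "integrable lborel (\<lambda>x. h y / 2 * indicator (ball y d) x)"
      using fin by (intro integrable_mult_right integrable_real_indicator) auto
    show "h y / 2 * indicator (ball y d) x \<le> h x" for x
      using d(2) pos[of x] by (auto simp: indicator_def)
  qed (rule i)
  finally show "(LINT y|lborel. h y) > 0" .
qed

text \<open>
  Green's identity for the truncated function leaves two terms. The first contains the derivative of the cut-off
  and lives on the shell \<open>\<epsilon> < |x| < 2\<epsilon>\<close>; after the substitution \<open>x = \<epsilon> y\<close> all powers of \<open>\<epsilon>\<close> cancel, and it tends to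
  \<open>\<kappa> C \<phi>(0)\<close>. The second one tends to the integral of \<open>F \<phi>\<close>.
\<close>
lemma radial_dirac_mass_cutoff:
  fixes \<eta> \<eta>' w w' f :: "real \<Rightarrow> real" and F :: "'a::euclidean_space \<Rightarrow> real" and R C n :: real
  assumes n: "n = real DIM('a)"
    and \<eta>: "\<And>s. (\<eta> has_real_derivative \<eta>' s) (at s)" "continuous_on UNIV \<eta>'" "\<And>s. \<eta>' s \<ge> 0"
      "\<And>s. s \<le> 1 \<Longrightarrow> \<eta> s = 0" "\<And>s. s \<ge> 2 \<Longrightarrow> \<eta> s = 1" "\<And>s. s \<le> 1 \<or> s \<ge> 2 \<Longrightarrow> \<eta>' s = 0"
      "\<eta>' (3/2) > 0" "\<And>s. 0 \<le> \<eta> s \<and> \<eta> s \<le> 1"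
    and R: "R > 0"
    and f: "flux_profile {0<..<R} n w f" "\<And>r. r \<in> {0<..<R} \<Longrightarrow> 0 \<le> f r"
    and w: "\<And>r. r \<in> {0<..<R} \<Longrightarrow> (w has_real_derivative w' r) (at r)" "\<And>r. r \<in> {0<..<R} \<Longrightarrow> 0 \<le> w r"
    and w': "continuous_on {0<..<R} w'" and C: "(w \<longlongrightarrow> C) (at_right 0)"
    and F: "\<And>x. x \<in> ball 0 R - {0} \<Longrightarrow> F x = norm x powr (1 - n) * w' (norm x)"
    and fi: "set_integrable lborel (ball 0 R) (\<lambda>x::'a. f (norm x))"
    and iF: "set_integrable lborel (ball 0 R) F"
    and \<phi>: "test_function (ball 0 R) \<phi>"
  defines "\<kappa> \<equiv> (LINT y|lborel. norm (y::'a) powr (1 - n) * \<eta>' (norm y))"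
  shows "(LINT x:ball 0 R|lborel. f (norm x) * (- laplacian \<phi> x)) =
    (LINT x:ball 0 R|lborel. F x * \<phi> x) + \<kappa> * C * \<phi> 0"
proof -
  let ?\<Omega> = "ball 0 R :: 'a set"
  obtain B where c\<phi>: "continuous_on UNIV \<phi>" "continuous_on UNIV (laplacian \<phi>)"
    and B: "\<And>x. \<bar>\<phi> x\<bar> \<le> B" "\<And>x. \<bar>laplacian \<phi> x\<bar> \<le> B"
    by (rule test_function_bounds[OF \<phi>]) blast
  have B0: "B \<ge> 0" using B(1)[of 0] by linarith
  have m\<phi>: "\<phi> \<in> borel_measurable borel" "laplacian \<phi> \<in> borel_measurable borel"
    using c\<phi> by (auto intro: borel_measurable_continuous_onI)
  have c\<eta>: "continuous_on UNIV \<eta>"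
    by (intro continuous_at_imp_continuous_on ballI DERIV_isCont[OF \<eta>(1)])
  have m\<eta>: "\<eta> \<in> borel_measurable borel" "\<eta>' \<in> borel_measurable borel"
    using c\<eta> \<eta>(2) by (auto intro: borel_measurable_continuous_onI)
  note weight = annulus_weight[OF \<eta>(2,3,6,7), where ?'a = 'a and e = "1 - n"]
  have "eventually (\<lambda>r. w r < C + 1) (at_right 0)"
    using C by (rule order_tendstoD) simp
  then obtain \<delta> where \<delta>: "\<delta> > 0" "\<And>r. 0 < r \<Longrightarrow> r < \<delta> \<Longrightarrow> w r < C + 1"
    unfolding eventually_at_right_field by auto
  \<comment> \<open>the shell \<open>|x| \<le> 2 \<epsilon>\<close> stays inside the ball and inside the region where \<open>w < C + 1\<close>\<close>
  define \<epsilon> where "\<epsilon> k = min R \<delta> / (4 * real (Suc k))" for k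
  have \<epsilon>: "0 < \<epsilon> k" "2 * \<epsilon> k < R" "2 * \<epsilon> k < \<delta>" for k
  proof -
    have "0 < min R \<delta>" using R \<delta>(1) by simp
    then show "0 < \<epsilon> k" by (simp add: \<epsilon>_def)
    have "2 * \<epsilon> k = min R \<delta> / (2 * real (Suc k))" by (simp add: \<epsilon>_def field_simps)
    also have "\<dots> \<le> min R \<delta> / 2" using \<open>0 < min R \<delta>\<close> by (intro divide_left_mono) auto
    also have "\<dots> < min R \<delta>" using \<open>0 < min R \<delta>\<close> by linarith
    finally show "2 * \<epsilon> k < R" "2 * \<epsilon> k < \<delta>" by auto
  qed
  have \<epsilon>0: "\<epsilon> \<longlonglongrightarrow> 0"
  proof -
    have "(\<lambda>k. min R \<delta> / 4 * inverse (real (Suc k))) \<longlonglongrightarrow> min R \<delta> / 4 * 0"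
      by (intro tendsto_intros LIMSEQ_inverse_real_of_nat)
    then show ?thesis by (simp add: \<epsilon>_def[abs_def] field_simps)
  qed
  have far: "eventually (\<lambda>k. 2 * \<epsilon> k < norm x) sequentially" if "x \<noteq> 0" for x :: 'a
  proof -
    have "(\<lambda>k. 2 * \<epsilon> k) \<longlonglongrightarrow> 2 * 0" by (intro tendsto_intros \<epsilon>0)
    then show ?thesis by (rule order_tendstoD) (use that in auto)
  qed
  have "\<exists>\<psi> :: 'a \<Rightarrow> real. Ck_on 2 ?\<Omega> \<psi> \<and>
    (\<forall>x\<in>?\<Omega>. laplacian \<psi> x =
       - (norm x powr (1 - n) * (\<eta>' (norm x / \<epsilon> k) / \<epsilon> k * w (norm x) + \<eta> (norm x / \<epsilon> k) * w' (norm x)))) \<and>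
    (\<forall>x\<in>?\<Omega>. 2 * \<epsilon> k \<le> norm x \<longrightarrow> \<psi> x = f (norm x)) \<and>
    (\<forall>x\<in>?\<Omega>. x \<noteq> 0 \<longrightarrow> 0 \<le> \<psi> x \<and> \<psi> x \<le> f (norm x))" for k
    by (rule cutoff_profile[OF n \<epsilon>(1,2)[of k] \<eta>(1,2,4,5,6,8) f w w'])
  then obtain \<psi> where \<psi>: "\<And>k. Ck_on 2 ?\<Omega> (\<psi> k)"
    "\<And>k x. x \<in> ?\<Omega> \<Longrightarrow> laplacian (\<psi> k) x =
       - (norm x powr (1 - n) * (\<eta>' (norm x / \<epsilon> k) / \<epsilon> k * w (norm x) + \<eta> (norm x / \<epsilon> k) * w' (norm x)))"
    "\<And>k x. x \<in> ?\<Omega> \<Longrightarrow> 2 * \<epsilon> k \<le> norm x \<Longrightarrow> \<psi> k x = f (norm x)"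
    "\<And>k x. x \<in> ?\<Omega> \<Longrightarrow> x \<noteq> 0 \<Longrightarrow> 0 \<le> \<psi> k x \<and> \<psi> k x \<le> f (norm x)"
    by metis
  note green = greens_second_identity[OF open_ball \<psi>(1) \<phi>]
  let ?T1 = "\<lambda>k x. norm x powr (1 - n) * (\<eta>' (norm x / \<epsilon> k) / \<epsilon> k) * w (norm x) * \<phi> x"
  let ?T2 = "\<lambda>k x. F x * (\<eta> (norm x / \<epsilon> k) * \<phi> x)"
  have split: "laplacian (\<psi> k) x * \<phi> x = - (?T1 k x + ?T2 k x)" if "x \<in> ?\<Omega>" for k x
  proof (cases "x = 0")
    case True
    then show ?thesis using \<psi>(2)[OF that] \<eta>(4)[of 0] by simp
  next
    case False
    have Fx: "F x = norm x powr (1 - n) * w' (norm x)" by (rule F) (use False that in auto)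
    show ?thesis unfolding \<psi>(2)[OF that] Fx by (simp add: algebra_simps)
  qed
  have i\<phi>: "set_integrable lborel ?\<Omega> (\<lambda>x. f (norm x) * laplacian \<phi> x)"
    by (rule set_integrable_mult_bounded[OF fi _ B(2)]) (use m\<phi> in simp)
  have iF\<phi>: "set_integrable lborel ?\<Omega> (\<lambda>x. F x * \<phi> x)"
    by (rule set_integrable_mult_bounded[OF iF _ B(1)]) (use m\<phi> in simp)
  have bT2: "\<bar>\<eta> s * \<phi> x\<bar> \<le> B" for s x
  proof -
    have "\<bar>\<eta> s\<bar> * \<bar>\<phi> x\<bar> \<le> 1 * B" using \<eta>(8)[of s] B(1)[of x] by (intro mult_mono) auto
    then show ?thesis by (simp add: abs_mult)
  qed
  have iT2: "set_integrable lborel ?\<Omega> (?T2 k)" for k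
  proof (rule set_integrable_mult_bounded[OF iF _ bT2])
    show "(\<lambda>x. \<eta> (norm x / \<epsilon> k) * \<phi> x) \<in> borel_measurable lborel"
      using m\<eta> m\<phi> by (intro borel_measurable_times measurable_compose[OF _ m\<eta>(1)]) auto
  qed
  have iT: "set_integrable lborel ?\<Omega> (\<lambda>x. - (?T1 k x + ?T2 k x))" for k
    by (rule set_integrable_cong[THEN iffD1, OF refl refl _ green(2)[of k]]) (rule split)
  have iT1: "set_integrable lborel ?\<Omega> (?T1 k)" for k
  proof -
    have "set_integrable lborel ?\<Omega> (\<lambda>x. (-1) * (- (?T1 k x + ?T2 k x)) - ?T2 k x)"
      by (intro set_integral_diff(1) set_integrable_mult_right iT iT2)
    then show ?thesis by simp
  qed
  have id: "(LINT x:?\<Omega>|lborel. \<psi> k x * laplacian \<phi> x) =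
      - ((LINT x:?\<Omega>|lborel. ?T1 k x) + (LINT x:?\<Omega>|lborel. ?T2 k x))" for k
  proof -
    have "(LINT x:?\<Omega>|lborel. \<psi> k x * laplacian \<phi> x) = (LINT x:?\<Omega>|lborel. laplacian (\<psi> k) x * \<phi> x)"
      by (rule green(3))
    also have "\<dots> = (LINT x:?\<Omega>|lborel. - (?T1 k x + ?T2 k x))"
      by (rule set_lebesgue_integral_cong) (use split in auto)
    also have "\<dots> = - (LINT x:?\<Omega>|lborel. ?T1 k x + ?T2 k x)"
      by (rule set_integral_uminus[OF set_integral_add(1)[OF iT1 iT2]])
    also have "(LINT x:?\<Omega>|lborel. ?T1 k x + ?T2 k x) = (LINT x:?\<Omega>|lborel. ?T1 k x) + (LINT x:?\<Omega>|lborel. ?T2 k x)"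
      by (rule set_integral_add(2)[OF iT1 iT2])
    finally show ?thesis .
  qed
  have L1: "(\<lambda>k. LINT x:?\<Omega>|lborel. \<psi> k x * laplacian \<phi> x) \<longlonglongrightarrow> (LINT x:?\<Omega>|lborel. f (norm x) * laplacian \<phi> x)"
    unfolding set_lebesgue_integral_def
  proof (rule integral_dominated_convergence)
    show "(\<lambda>x. indicat_real ?\<Omega> x *\<^sub>R (f (norm x) * laplacian \<phi> x)) \<in> borel_measurable lborel"
      using i\<phi> unfolding set_integrable_def by auto
    show "(\<lambda>x. indicat_real ?\<Omega> x *\<^sub>R (\<psi> k x * laplacian \<phi> x)) \<in> borel_measurable lborel" for k
      using green(1)[of k] unfolding set_integrable_def by auto
    show "integrable lborel (\<lambda>x. B * (indicat_real ?\<Omega> x *\<^sub>R f (norm x)))"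
      using fi unfolding set_integrable_def by (rule integrable_mult_right)
    show "AE x in lborel. (\<lambda>k. indicat_real ?\<Omega> x *\<^sub>R (\<psi> k x * laplacian \<phi> x)) \<longlonglongrightarrow> indicat_real ?\<Omega> x *\<^sub>R (f (norm x) * laplacian \<phi> x)"
    proof (rule eventually_mono[OF AE_lborel_singleton[of 0]])
      fix x :: 'a assume x: "x \<noteq> 0"
      show "(\<lambda>k. indicat_real ?\<Omega> x *\<^sub>R (\<psi> k x * laplacian \<phi> x)) \<longlonglongrightarrow> indicat_real ?\<Omega> x *\<^sub>R (f (norm x) * laplacian \<phi> x)"
        by (rule tendsto_eventually, rule eventually_mono[OF far[OF x]]) (use \<psi>(3)[of x] in \<open>auto simp: indicator_def\<close>)
    qed
    show "AE x in lborel. norm (indicat_real ?\<Omega> x *\<^sub>R (\<psi> k x * laplacian \<phi> x)) \<le> B * (indicat_real ?\<Omega> x *\<^sub>R f (norm x))" for k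
    proof (rule eventually_mono[OF AE_lborel_singleton[of 0]])
      fix x :: 'a assume x: "x \<noteq> 0"
      show "norm (indicat_real ?\<Omega> x *\<^sub>R (\<psi> k x * laplacian \<phi> x)) \<le> B * (indicat_real ?\<Omega> x *\<^sub>R f (norm x))"
      proof (cases "x \<in> ?\<Omega>")
        case True
        have "\<bar>\<psi> k x\<bar> * \<bar>laplacian \<phi> x\<bar> \<le> f (norm x) * B"
          using \<psi>(4)[OF True x, of k] B(2)[of x] by (intro mult_mono) auto
        then show ?thesis using True by (simp add: abs_mult mult.commute)
      qed simp
    qed
  qed
  have L2: "(\<lambda>k. LINT x:?\<Omega>|lborel. ?T2 k x) \<longlonglongrightarrow> (LINT x:?\<Omega>|lborel. F x * \<phi> x)"
    unfolding set_lebesgue_integral_def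
  proof (rule integral_dominated_convergence)
    show "(\<lambda>x. indicat_real ?\<Omega> x *\<^sub>R (F x * \<phi> x)) \<in> borel_measurable lborel"
      using iF\<phi> unfolding set_integrable_def by auto
    show "(\<lambda>x. indicat_real ?\<Omega> x *\<^sub>R ?T2 k x) \<in> borel_measurable lborel" for k
      using iT2[of k] unfolding set_integrable_def by auto
    show "integrable lborel (\<lambda>x. B * \<bar>indicat_real ?\<Omega> x *\<^sub>R F x\<bar>)"
      using iF unfolding set_integrable_def by (intro integrable_mult_right integrable_abs)
    show "AE x in lborel. (\<lambda>k. indicat_real ?\<Omega> x *\<^sub>R ?T2 k x) \<longlonglongrightarrow> indicat_real ?\<Omega> x *\<^sub>R (F x * \<phi> x)"
    proof (rule eventually_mono[OF AE_lborel_singleton[of 0]])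
      fix x :: 'a assume x: "x \<noteq> 0"
      show "(\<lambda>k. indicat_real ?\<Omega> x *\<^sub>R ?T2 k x) \<longlonglongrightarrow> indicat_real ?\<Omega> x *\<^sub>R (F x * \<phi> x)"
      proof (rule tendsto_eventually, rule eventually_mono[OF far[OF x]])
        fix k assume "2 * \<epsilon> k < norm x"
        then have "norm x / \<epsilon> k \<ge> 2" using \<epsilon>(1)[of k] by (simp add: field_simps)
        then show "indicat_real ?\<Omega> x *\<^sub>R ?T2 k x = indicat_real ?\<Omega> x *\<^sub>R (F x * \<phi> x)" using \<eta>(5) by simp
      qed
    qed
    show "AE x in lborel. norm (indicat_real ?\<Omega> x *\<^sub>R ?T2 k x) \<le> B * \<bar>indicat_real ?\<Omega> x *\<^sub>R F x\<bar>" for k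
    proof (intro AE_I2)
      fix x :: 'a
      have "\<bar>F x\<bar> * \<bar>\<eta> (norm x / \<epsilon> k) * \<phi> x\<bar> \<le> \<bar>F x\<bar> * B"
        using bT2 by (intro mult_left_mono) auto
      then show "norm (indicat_real ?\<Omega> x *\<^sub>R ?T2 k x) \<le> B * \<bar>indicat_real ?\<Omega> x *\<^sub>R F x\<bar>"
        by (auto simp: indicator_def abs_mult mult.commute)
    qed
  qed
  \<comment> \<open>\<open>w\<close> is controlled on \<open>(0, R)\<close> only; its extension by \<open>0\<close> is measurable on the whole line\<close>
  define W where "W r = indicator {0<..<R} r *\<^sub>R w r" for r
  have mW: "W \<in> borel_measurable borel"
    unfolding W_def[abs_def]
    by (rule borel_measurable_continuous_on_indicator)
       (auto intro!: continuous_at_imp_continuous_on DERIV_isCont w)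
  have "(\<lambda>k. LINT y|lborel. (norm y powr (1 - n) * \<eta>' (norm y)) * (W (\<epsilon> k * norm y) * \<phi> (\<epsilon> k *\<^sub>R y)))
     \<longlonglongrightarrow> (LINT y|lborel. (norm (y::'a) powr (1 - n) * \<eta>' (norm y)) * (C * \<phi> 0))"
  proof (rule integral_dominated_convergence)
    have mh: "(\<lambda>y::'a. norm y powr (1 - n) * \<eta>' (norm y)) \<in> borel_measurable lborel"
      using weight(2) by auto
    show "(\<lambda>y::'a. (norm y powr (1 - n) * \<eta>' (norm y)) * (C * \<phi> 0)) \<in> borel_measurable lborel"
      using mh by auto
    show "(\<lambda>y::'a. (norm y powr (1 - n) * \<eta>' (norm y)) * (W (\<epsilon> k * norm y) * \<phi> (\<epsilon> k *\<^sub>R y))) \<in> borel_measurable lborel" for k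
      by (intro borel_measurable_times[OF mh] borel_measurable_times measurable_compose[OF _ mW] measurable_compose[OF _ m\<phi>(1)]) auto
    show "integrable lborel (\<lambda>y::'a. (norm y powr (1 - n) * \<eta>' (norm y)) * (\<bar>C + 1\<bar> * B))"
      using weight(2) by auto
    show "AE y in lborel. (\<lambda>k. (norm y powr (1 - n) * \<eta>' (norm y)) * (W (\<epsilon> k * norm y) * \<phi> (\<epsilon> k *\<^sub>R y)))
       \<longlonglongrightarrow> (norm (y::'a) powr (1 - n) * \<eta>' (norm y)) * (C * \<phi> 0)"
    proof (rule eventually_mono[OF AE_lborel_singleton[of 0]])
      fix y :: 'a assume y: "y \<noteq> 0"
      have e0: "(\<lambda>k. \<epsilon> k * norm y) \<longlonglongrightarrow> 0" using tendsto_mult_right[OF \<epsilon>0, of "norm y"] by simp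
      have er: "filterlim (\<lambda>k. \<epsilon> k * norm y) (at_right 0) sequentially"
        using e0 \<epsilon>(1) y by (auto simp: filterlim_at less_imp_neq[OF \<epsilon>(1), symmetric] intro!: always_eventually)
      have "eventually (\<lambda>r. r \<in> {0<..<R}) (at_right 0)" by (rule eventually_at_right_real[OF R])
      then have "eventually (\<lambda>r. w r = W r) (at_right 0)" by eventually_elim (simp add: W_def)
      then have "(W \<longlongrightarrow> C) (at_right 0)" using C by (rule Lim_transform_eventually[rotated])
      then have 1: "(\<lambda>k. W (\<epsilon> k * norm y)) \<longlonglongrightarrow> C" using er by (rule filterlim_compose)
      have "(\<lambda>k. \<epsilon> k *\<^sub>R y) \<longlonglongrightarrow> 0 *\<^sub>R y" by (intro tendsto_intros \<epsilon>0)
      moreover have "isCont \<phi> 0" using c\<phi>(1) by (simp add: continuous_on_eq_continuous_at)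
      ultimately have 2: "(\<lambda>k. \<phi> (\<epsilon> k *\<^sub>R y)) \<longlonglongrightarrow> \<phi> 0" using isCont_tendsto_compose by fastforce
      show "(\<lambda>k. (norm y powr (1 - n) * \<eta>' (norm y)) * (W (\<epsilon> k * norm y) * \<phi> (\<epsilon> k *\<^sub>R y)))
       \<longlonglongrightarrow> (norm y powr (1 - n) * \<eta>' (norm y)) * (C * \<phi> 0)"
        by (intro tendsto_intros 1 2)
    qed
    show "AE y in lborel. norm ((norm (y::'a) powr (1 - n) * \<eta>' (norm y)) * (W (\<epsilon> k * norm y) * \<phi> (\<epsilon> k *\<^sub>R y)))
       \<le> (norm y powr (1 - n) * \<eta>' (norm y)) * (\<bar>C + 1\<bar> * B)" for k
    proof (intro AE_I2)
      fix y :: 'a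
      let ?h = "norm y powr (1 - n) * \<eta>' (norm y)"
      have h: "?h \<ge> 0" using \<eta>(3) by simp
      show "norm (?h * (W (\<epsilon> k * norm y) * \<phi> (\<epsilon> k *\<^sub>R y))) \<le> ?h * (\<bar>C + 1\<bar> * B)"
      proof (cases "norm y \<ge> 2")
        case True
        then show ?thesis using \<eta>(6)[of "norm y"] by simp
      next
        case False
        then have "\<epsilon> k * norm y \<le> \<epsilon> k * 2" using \<epsilon>(1)[of k] by (intro mult_left_mono) auto
        then have "\<epsilon> k * norm y < \<delta>" using \<epsilon>(3)[of k] by simp
        then have "\<bar>W (\<epsilon> k * norm y)\<bar> \<le> \<bar>C + 1\<bar>"
          using \<delta>(2)[of "\<epsilon> k * norm y"] w(2)[of "\<epsilon> k * norm y"] by (auto simp: W_def indicator_def)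
        then have "\<bar>W (\<epsilon> k * norm y)\<bar> * \<bar>\<phi> (\<epsilon> k *\<^sub>R y)\<bar> \<le> \<bar>C + 1\<bar> * B"
          using B(1) by (intro mult_mono) auto
        then have "?h * \<bar>W (\<epsilon> k * norm y) * \<phi> (\<epsilon> k *\<^sub>R y)\<bar> \<le> ?h * (\<bar>C + 1\<bar> * B)"
          using h by (intro mult_left_mono) (auto simp: abs_mult)
        then show ?thesis using h \<eta>(3) by (simp add: abs_mult)
      qed
    qed
  qed
  also have "(\<lambda>k. LINT y|lborel. (norm y powr (1 - n) * \<eta>' (norm y)) * (W (\<epsilon> k * norm y) * \<phi> (\<epsilon> k *\<^sub>R y)))
    = (\<lambda>k. LINT x:?\<Omega>|lborel. ?T1 k x)"
  proof
    fix k
    let ?H = "\<lambda>x. norm x powr (1 - n) * (\<eta>' (norm x / \<epsilon> k) / \<epsilon> k) * W (norm x) * \<phi> x"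
    have mH: "?H \<in> borel_measurable borel"
      by (intro borel_measurable_times measurable_compose[OF _ mW] m\<phi>(1) borel_measurable_divide
          measurable_compose[OF _ m\<eta>(2)] powr_real_measurable) auto
    have "(LINT x:?\<Omega>|lborel. ?T1 k x) = (LINT x|lborel. ?H x)"
      unfolding set_lebesgue_integral_def
      by (rule Bochner_Integration.integral_cong) (auto simp: W_def indicator_def)
    also have "\<dots> = (LINT x|lborel. \<epsilon> k ^ DIM('a) * ?H (\<epsilon> k *\<^sub>R x))"
      by (rule lborel_integral_scaling[OF mH \<epsilon>(1)])
    also have "\<dots> = (LINT y|lborel. (norm y powr (1 - n) * \<eta>' (norm y)) * (W (\<epsilon> k * norm y) * \<phi> (\<epsilon> k *\<^sub>R y)))"
    proof (rule Bochner_Integration.integral_cong)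
      fix y :: 'a
      have e: "\<epsilon> k > 0" by (rule \<epsilon>(1))
      have "\<epsilon> k ^ DIM('a) * \<epsilon> k powr (1 - n) = \<epsilon> k"
        using e by (simp add: n powr_realpow[symmetric] powr_add[symmetric])
      then have E: "\<epsilon> k ^ DIM('a) * ((\<epsilon> k * norm y) powr (1 - n) * (\<eta>' (norm y) / \<epsilon> k)) = norm y powr (1 - n) * \<eta>' (norm y)"
        using e by (simp add: powr_mult field_simps)
      have "\<epsilon> k ^ DIM('a) * ?H (\<epsilon> k *\<^sub>R y) = (\<epsilon> k ^ DIM('a) * ((\<epsilon> k * norm y) powr (1 - n) * (\<eta>' (norm y) / \<epsilon> k)))
          * (W (\<epsilon> k * norm y) * \<phi> (\<epsilon> k *\<^sub>R y))"
        using e by simp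
      then show "\<epsilon> k ^ DIM('a) * ?H (\<epsilon> k *\<^sub>R y) = (norm y powr (1 - n) * \<eta>' (norm y)) * (W (\<epsilon> k * norm y) * \<phi> (\<epsilon> k *\<^sub>R y))"
        unfolding E .
    qed simp
    finally show "(LINT y|lborel. (norm y powr (1 - n) * \<eta>' (norm y)) * (W (\<epsilon> k * norm y) * \<phi> (\<epsilon> k *\<^sub>R y)))
      = (LINT x:?\<Omega>|lborel. ?T1 k x)" by simp
  qed
  also have "(LINT y|lborel. (norm (y::'a) powr (1 - n) * \<eta>' (norm y)) * (C * \<phi> 0)) = \<kappa> * C * \<phi> 0"
    using weight(2) by (simp add: \<kappa>_def)
  finally have L3: "(\<lambda>k. LINT x:?\<Omega>|lborel. ?T1 k x) \<longlonglongrightarrow> \<kappa> * C * \<phi> 0" .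
  have "(\<lambda>k. LINT x:?\<Omega>|lborel. \<psi> k x * laplacian \<phi> x) \<longlonglongrightarrow> - (\<kappa> * C * \<phi> 0 + (LINT x:?\<Omega>|lborel. F x * \<phi> x))"
    unfolding id by (intro tendsto_intros L2 L3)
  from LIMSEQ_unique[OF L1 this]
  have "(LINT x:?\<Omega>|lborel. f (norm x) * laplacian \<phi> x) = - (\<kappa> * C * \<phi> 0 + (LINT x:?\<Omega>|lborel. F x * \<phi> x))" .
  moreover have "(LINT x:?\<Omega>|lborel. f (norm x) * (- laplacian \<phi> x)) = - (LINT x:?\<Omega>|lborel. f (norm x) * laplacian \<phi> x)"
    using set_integral_uminus[OF i\<phi>] by simp
  ultimately show ?thesis by simp
qed

lemma set_integrable_lebesgueI:
  fixes f :: "'a::euclidean_space \<Rightarrow> real"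
  assumes "set_integrable lborel \<Omega> f"
  shows "set_integrable lebesgue \<Omega> f"
  using assms unfolding set_integrable_def
  by (subst integrable_completion) auto

lemma set_integral_lebesgue_eq_lborel:
  fixes f :: "'a::euclidean_space \<Rightarrow> real"
  assumes "set_integrable lborel \<Omega> f"
  shows "(LINT x:\<Omega>|lebesgue. f x) = (LINT x:\<Omega>|lborel. f x)"
  using assms unfolding set_integrable_def set_lebesgue_integral_def
  by (subst integral_completion) auto

lemma locally_integrable_of_set_integrable:
  fixes f :: "'a::euclidean_space \<Rightarrow> real"
  assumes "set_integrable lborel \<Omega> f"
  shows "locally_integrable \<Omega> f"
  unfolding locally_integrable_def
proof (intro allI impI)
  fix K assume K: "compact K \<and> K \<subseteq> \<Omega>"
  show "set_integrable lebesgue K f"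
    by (rule set_integrable_subset[OF set_integrable_lebesgueI[OF assms]]) (use K lmeasurable_compact fmeasurableD in auto)
qed

text \<open>
  The constant is chosen before the profile and the radius, so one \<open>\<kappa>\<close> serves both equations of the system.
\<close>
lemma radial_dirac_mass:
  obtains \<kappa> :: real where "\<kappa> > 0"
    "\<And>R w w' f C (F :: 'a::euclidean_space \<Rightarrow> real).
      R > 0 \<Longrightarrow> flux_profile {0<..<R} (real DIM('a)) w f \<Longrightarrow> (\<And>r. r \<in> {0<..<R} \<Longrightarrow> 0 \<le> f r) \<Longrightarrow>
      (\<And>r. r \<in> {0<..<R} \<Longrightarrow> (w has_real_derivative w' r) (at r)) \<Longrightarrow> (\<And>r. r \<in> {0<..<R} \<Longrightarrow> 0 \<le> w r) \<Longrightarrow>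
      continuous_on {0<..<R} w' \<Longrightarrow> (w \<longlongrightarrow> C) (at_right 0) \<Longrightarrow>
      (\<And>x. x \<in> ball 0 R - {0} \<Longrightarrow> F x = norm x powr (1 - real DIM('a)) * w' (norm x)) \<Longrightarrow>
      set_integrable lborel (ball 0 R) (\<lambda>x::'a. f (norm x)) \<Longrightarrow>
      set_integrable lborel (ball 0 R) F \<Longrightarrow>
      neg_laplacian_dirac (ball 0 R) (\<lambda>x. f (norm x)) F (\<kappa> * C)"
proof -
  obtain \<eta> \<eta>' :: "real \<Rightarrow> real" where
    \<eta>: "\<And>s. (\<eta> has_real_derivative \<eta>' s) (at s)" "continuous_on UNIV \<eta>'" "\<And>s. \<eta>' s \<ge> 0"
    "\<And>s. s \<le> 1 \<Longrightarrow> \<eta> s = 0" "\<And>s. s \<ge> 2 \<Longrightarrow> \<eta> s = 1"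
    "\<And>s. s \<le> 1 \<or> s \<ge> 2 \<Longrightarrow> \<eta>' s = 0" "\<eta>' (3/2) > 0" "\<And>s. 0 \<le> \<eta> s \<and> \<eta> s \<le> 1"
    by (rule smooth_step_exists) blast
  let ?\<kappa> = "LINT y|lborel. norm (y::'a) powr (1 - real DIM('a)) * \<eta>' (norm y)"
  show ?thesis
  proof (rule that[of ?\<kappa>])
    show "?\<kappa> > 0"
      by (rule annulus_weight(3)[OF \<eta>(2,3,6,7)])
    fix R w w' f C and F :: "'a \<Rightarrow> real"
    assume R: "R > 0" and f: "flux_profile {0<..<R} (real DIM('a)) w f" "\<And>r. r \<in> {0<..<R} \<Longrightarrow> 0 \<le> f r"
      and w: "\<And>r. r \<in> {0<..<R} \<Longrightarrow> (w has_real_derivative w' r) (at r)" "\<And>r. r \<in> {0<..<R} \<Longrightarrow> 0 \<le> w r"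
      and w': "continuous_on {0<..<R} w'" "(w \<longlongrightarrow> C) (at_right 0)"
      and F: "\<And>x. x \<in> ball 0 R - {0} \<Longrightarrow> F x = norm x powr (1 - real DIM('a)) * w' (norm x)"
      and i: "set_integrable lborel (ball 0 R) (\<lambda>x::'a. f (norm x))" "set_integrable lborel (ball 0 R) F"
    show "neg_laplacian_dirac (ball 0 R) (\<lambda>x. f (norm x)) F (?\<kappa> * C)"
      unfolding neg_laplacian_dirac_def
    proof (intro conjI allI impI locally_integrable_of_set_integrable i)
      fix \<phi> :: "'a \<Rightarrow> real" assume \<phi>: "test_function (ball 0 R) \<phi>"
      obtain B where c\<phi>: "continuous_on UNIV \<phi>" "continuous_on UNIV (laplacian \<phi>)"
        and B: "\<And>x. \<bar>\<phi> x\<bar> \<le> B" "\<And>x. \<bar>laplacian \<phi> x\<bar> \<le> B"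
        by (rule test_function_bounds[OF \<phi>]) blast
      have i1: "set_integrable lborel (ball 0 R) (\<lambda>x. f (norm x) * - laplacian \<phi> x)"
        by (rule set_integrable_mult_bounded[OF i(1), of _ B])
           (use B c\<phi> in \<open>auto intro!: borel_measurable_continuous_onI continuous_intros\<close>)
      have i2: "set_integrable lborel (ball 0 R) (\<lambda>x. F x * \<phi> x)"
        by (rule set_integrable_mult_bounded[OF i(2), of _ B])
           (use B c\<phi> in \<open>auto intro!: borel_measurable_continuous_onI\<close>)
      show "(LINT x:ball 0 R|lebesgue. f (norm x) * - laplacian \<phi> x) =
         (LINT x:ball 0 R|lebesgue. F x * \<phi> x) + ?\<kappa> * C * \<phi> 0"
        unfolding set_integral_lebesgue_eq_lborel[OF i1] set_integral_lebesgue_eq_lborel[OF i2]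
        by (rule radial_dirac_mass_cutoff[OF refl \<eta> R f w w' F i \<phi>])
    qed
  qed
qed

section \<open>Monotone iteration\<close>

text \<open>
  The weights are singular at \<open>0\<close>; integrals over half-open intervals avoid all conditions on the values at
  \<open>0\<close>.
\<close>
lemma integrable_on_half_open_iff:
  fixes f :: "real \<Rightarrow> real"
  shows "f integrable_on {0<..r} \<longleftrightarrow> f integrable_on {0..r}"
    and "integral {0<..r} f = integral {0..r} f"
proof -
  have n: "negligible (({0<..r} - {0..r}) \<union> ({0..r} - {0<..r}))"
    by (rule negligible_subset[of "{0}"]) auto
  show "f integrable_on {0<..r} \<longleftrightarrow> f integrable_on {0..r}"
    by (intro integrable_spike_set_eq) (use n in \<open>simp add: sup_commute\<close>)
  show "integral {0<..r} f = integral {0..r} f"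
    by (rule integral_spike_set; rule negligible_subset[of "{0}"]) auto
qed

lemma integrable_on_dominated:
  fixes f g :: "real \<Rightarrow> real"
  assumes "continuous_on {0<..r} f" "g integrable_on {0<..r}" "\<And>s. s \<in> {0<..r} \<Longrightarrow> \<bar>f s\<bar> \<le> g s"
  shows "f integrable_on {0<..r}"
proof (rule measurable_bounded_by_integrable_imp_integrable[OF _ assms(2)])
  show "f \<in> borel_measurable (lebesgue_on {0<..r})"
    by (rule continuous_imp_measurable_on_sets_lebesgue[OF assms(1)]) simp
  show "norm (f s) \<le> g s" if "s \<in> {0<..r}" for s using assms(3)[OF that] by simp
qed simp

lemma primitive_continuous:
  fixes \<phi> :: "real \<Rightarrow> real"
  assumes I: "open I" "\<And>r. r \<in> I \<Longrightarrow> 0 < r" "\<And>r. r \<in> I \<Longrightarrow> \<phi> integrable_on {0<..r}"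
  shows "continuous_on I (\<lambda>r. integral {0<..r} \<phi>)"
proof (rule continuous_at_imp_continuous_on, rule ballI)
  fix r assume r: "r \<in> I"
  obtain d where d: "d > 0" "ball r d \<subseteq> I" using I(1) r by (meson open_contains_ball)
  have b: "r + d/2 \<in> I" "r < r + d/2" using d by (auto simp: dist_real_def)
  have "continuous_on {0..r + d/2} (\<lambda>x. integral {0..x} \<phi>)"
    by (rule indefinite_integral_continuous_1) (use I(3)[OF b(1)] integrable_on_half_open_iff(1) in blast)
  then have "continuous_on {0<..<r + d/2} (\<lambda>x. integral {0..x} \<phi>)"
    by (rule continuous_on_subset) auto
  then have "isCont (\<lambda>x. integral {0..x} \<phi>) r"
    using I(2)[OF r] b by (simp add: continuous_on_eq_continuous_at)
  then show "isCont (\<lambda>r. integral {0<..r} \<phi>) r" by (simp add: integrable_on_half_open_iff(2))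
qed

lemma primitive_has_derivative:
  fixes \<phi> :: "real \<Rightarrow> real"
  assumes I: "open I" "\<And>r. r \<in> I \<Longrightarrow> 0 < r" "\<And>r s. r \<in> I \<Longrightarrow> 0 < s \<Longrightarrow> s \<le> r \<Longrightarrow> s \<in> I"
    and i: "\<And>r. r \<in> I \<Longrightarrow> \<phi> integrable_on {0<..r}"
    and c: "continuous_on I \<phi>" and r: "r \<in> I"
  shows "((\<lambda>r. integral {0<..r} \<phi>) has_real_derivative \<phi> r) (at r)"
proof -
  obtain d where d: "d > 0" "ball r d \<subseteq> I" using I(1) r by (meson open_contains_ball)
  define b where "b = r + d/2"
  have b: "b \<in> I" "r < b" using d by (auto simp: dist_real_def b_def)
  have r0: "0 < r" using I(2)[OF r] .
  have sub: "{r/2..b} \<subseteq> I" using I(3)[OF b(1)] r0 by auto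
  have ib: "\<phi> integrable_on {0..b}" using i[OF b(1)] integrable_on_half_open_iff(1) by blast
  have split: "integral {0<..x} \<phi> = integral {0..r/2} \<phi> + integral {r/2..x} \<phi>" if "x \<in> {r/2..b}" for x
  proof -
    have "\<phi> integrable_on {0..x}" by (rule integrable_on_subinterval[OF ib]) (use that r0 in auto)
    then show ?thesis using that r0 unfolding integrable_on_half_open_iff(2)
      by (intro Henstock_Kurzweil_Integration.integral_combine[symmetric]) auto
  qed
  have "((\<lambda>x. integral {r/2..x} \<phi>) has_real_derivative \<phi> r) (at r within {r/2..b})"
    by (rule integral_has_real_derivative[OF continuous_on_subset[OF c sub]]) (use r0 b in auto)
  then have "((\<lambda>x. integral {r/2..x} \<phi>) has_real_derivative \<phi> r) (at r)"
    using at_within_Icc_at[of "r/2" r b] r0 b by simp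
  then have "((\<lambda>x. integral {0..r/2} \<phi> + integral {r/2..x} \<phi>) has_real_derivative \<phi> r) (at r)"
    by (auto intro!: derivative_eq_intros)
  then show ?thesis
    by (rule has_field_derivative_transform_within_open[where S = "{r/2<..<b}"])
       (use r0 b split in auto)
qed

text \<open>
  Because the integral operator is increasing, its iterates starting from the lower barrier increase and stay below
  the upper barrier; monotone convergence passes to the limit in the integrals. No Lipschitz condition is involved.
  The last four inequalities of the conclusion give the behaviour of the solution at \<open>0\<close>.
\<close>
lemma monotone_iteration:
  fixes I :: "real set" and k1 k2 l1 l2 h1 h2 :: "real \<Rightarrow> real" and p q C1 C2 :: real
  assumes I: "open I" "\<And>r. r \<in> I \<Longrightarrow> 0 < r" "\<And>r s. r \<in> I \<Longrightarrow> 0 < s \<Longrightarrow> s \<le> r \<Longrightarrow> s \<in> I"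
    and k: "continuous_on I k1" "continuous_on I k2" "\<And>r. r \<in> I \<Longrightarrow> 0 \<le> k1 r" "\<And>r. r \<in> I \<Longrightarrow> 0 \<le> k2 r"
    and pq: "p > 0" "q > 0"
    and l: "continuous_on I l1" "continuous_on I l2" "\<And>r. r \<in> I \<Longrightarrow> 0 \<le> l1 r" "\<And>r. r \<in> I \<Longrightarrow> 0 \<le> l2 r"
    and lh: "\<And>r. r \<in> I \<Longrightarrow> l1 r \<le> h1 r" "\<And>r. r \<in> I \<Longrightarrow> l2 r \<le> h2 r"
    and sub: "\<And>r. r \<in> I \<Longrightarrow> l1 r \<le> C1 + integral {0<..r} (\<lambda>s. k1 s * l2 s powr p)"
      "\<And>r. r \<in> I \<Longrightarrow> l2 r \<le> C2 + integral {0<..r} (\<lambda>s. k2 s * l1 s powr q)"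
    and int: "\<And>r. r \<in> I \<Longrightarrow> (\<lambda>s. k1 s * h2 s powr p) integrable_on {0<..r}"
      "\<And>r. r \<in> I \<Longrightarrow> (\<lambda>s. k2 s * h1 s powr q) integrable_on {0<..r}"
    and super: "\<And>r. r \<in> I \<Longrightarrow> C1 + integral {0<..r} (\<lambda>s. k1 s * h2 s powr p) \<le> h1 r"
      "\<And>r. r \<in> I \<Longrightarrow> C2 + integral {0<..r} (\<lambda>s. k2 s * h1 s powr q) \<le> h2 r"
  shows "\<exists>w1 w2. \<forall>r\<in>I. l1 r \<le> w1 r \<and> w1 r \<le> h1 r \<and> l2 r \<le> w2 r \<and> w2 r \<le> h2 r \<and>
     (w1 has_real_derivative k1 r * w2 r powr p) (at r) \<and> (w2 has_real_derivative k2 r * w1 r powr q) (at r) \<and>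
     C1 \<le> w1 r \<and> C2 \<le> w2 r \<and>
     w1 r \<le> C1 + integral {0<..r} (\<lambda>s. k1 s * h2 s powr p) \<and>
     w2 r \<le> C2 + integral {0<..r} (\<lambda>s. k2 s * h1 s powr q)"
proof -
  have Isub: "{0<..r} \<subseteq> I" if "r \<in> I" for r using I(3)[OF that] by auto
  let ?J = "\<lambda>k p v r. integral {0<..r} (\<lambda>s. k s * v s powr p :: real)"
  have Jint: "(\<lambda>s. k s * v s powr p) integrable_on {0<..r}"
    if "continuous_on I k" "\<And>r. r \<in> I \<Longrightarrow> 0 \<le> k r" "p > 0"
      "continuous_on I v" "\<And>r. r \<in> I \<Longrightarrow> 0 \<le> v r" "\<And>r. r \<in> I \<Longrightarrow> v r \<le> h r" 
      "(\<lambda>s. k s * h s powr p) integrable_on {0<..r}" "r \<in> I" for k v h :: "real \<Rightarrow> real" and p r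
  proof (rule integrable_on_dominated[OF _ that(7)])
    have "continuous_on I (\<lambda>s. k s * v s powr p)"
      by (intro continuous_intros that continuous_on_powr_nonneg)
    then show "continuous_on {0<..r} (\<lambda>s. k s * v s powr p)" using Isub[OF that(8)] by (rule continuous_on_subset)
    fix s assume "s \<in> {0<..r}"
    then have s: "s \<in> I" using Isub[OF that(8)] by auto
    have "v s powr p \<le> h s powr p" using that(3,5,6) s by (intro powr_mono2) auto
    then show "\<bar>k s * v s powr p\<bar> \<le> k s * h s powr p"
      using that(2)[OF s] by (simp add: abs_mult mult_left_mono)
  qed
  have Jmono: "?J k p v r \<le> ?J k p v' r"
    if "\<And>r. r \<in> I \<Longrightarrow> 0 \<le> k r" "p > 0" "\<And>r. r \<in> I \<Longrightarrow> 0 \<le> v r" "\<And>r. r \<in> I \<Longrightarrow> v r \<le> v' r"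
      "(\<lambda>s. k s * v s powr p) integrable_on {0<..r}" "(\<lambda>s. k s * v' s powr p) integrable_on {0<..r}" "r \<in> I"
    for k v v' :: "real \<Rightarrow> real" and p r
  proof (rule integral_le[OF that(5,6)])
    fix s assume "s \<in> {0<..r}"
    then have s: "s \<in> I" using Isub[OF that(7)] by auto
    show "k s * v s powr p \<le> k s * v' s powr p"
      using that(1-4) s by (intro mult_left_mono powr_mono2) auto
  qed
  \<comment> \<open>Picard iterates, both components at once\<close>
  define W where "W = rec_nat (l1, l2) (\<lambda>_ w. (\<lambda>r. C1 + ?J k1 p (snd w) r, \<lambda>r. C2 + ?J k2 q (fst w) r))"
  define A where "A n = fst (W n)" for n
  define B where "B n = snd (W n)" for n
  have A0: "A 0 = l1" "B 0 = l2" by (auto simp: A_def B_def W_def)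
  have AS: "A (Suc n) = (\<lambda>r. C1 + ?J k1 p (B n) r)" "B (Suc n) = (\<lambda>r. C2 + ?J k2 q (A n) r)" for n
    by (auto simp: A_def B_def W_def)
  have inv: "continuous_on I (A n) \<and> continuous_on I (B n) \<and>
     (\<forall>r\<in>I. l1 r \<le> A n r \<and> A n r \<le> h1 r \<and> l2 r \<le> B n r \<and> B n r \<le> h2 r \<and> A n r \<le> A (Suc n) r \<and> B n r \<le> B (Suc n) r)" for n
  proof (induction n)
    case 0
    then show ?case using l lh sub by (auto simp: A0 AS)
  next
    case (Suc n)
    then have c: "continuous_on I (A n)" "continuous_on I (B n)"
      and o: "\<And>r. r \<in> I \<Longrightarrow> l1 r \<le> A n r" "\<And>r. r \<in> I \<Longrightarrow> A n r \<le> h1 r" "\<And>r. r \<in> I \<Longrightarrow> l2 r \<le> B n r"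
        "\<And>r. r \<in> I \<Longrightarrow> B n r \<le> h2 r" "\<And>r. r \<in> I \<Longrightarrow> A n r \<le> A (Suc n) r" "\<And>r. r \<in> I \<Longrightarrow> B n r \<le> B (Suc n) r"
      by blast+
    have o0: "\<And>r. r \<in> I \<Longrightarrow> 0 \<le> A n r" "\<And>r. r \<in> I \<Longrightarrow> 0 \<le> B n r"
      using o(1,3) l(3,4) by (meson order_trans)+
    have iB: "(\<lambda>s. k1 s * B n s powr p) integrable_on {0<..r}" if "r \<in> I" for r
      by (rule Jint[OF k(1,3) pq(1) c(2) o0(2) o(4) int(1)[OF that] that])
    have iA: "(\<lambda>s. k2 s * A n s powr q) integrable_on {0<..r}" if "r \<in> I" for r
      by (rule Jint[OF k(2,4) pq(2) c(1) o0(1) o(2) int(2)[OF that] that])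
    have c': "continuous_on I (A (Suc n))" "continuous_on I (B (Suc n))"
      unfolding AS
      by (rule continuous_on_add[OF continuous_on_const primitive_continuous[OF I(1,2) iB]]; assumption)
        (rule continuous_on_add[OF continuous_on_const primitive_continuous[OF I(1,2) iA]]; assumption)
    have oS: "A (Suc n) r \<le> h1 r" "B (Suc n) r \<le> h2 r" if "r \<in> I" for r
    proof -
      have "?J k1 p (B n) r \<le> ?J k1 p h2 r" by (rule Jmono[OF k(3) pq(1) o0(2) o(4) iB[OF that] int(1)[OF that] that])
      then show "A (Suc n) r \<le> h1 r" using super(1)[OF that] by (simp add: AS)
      have "?J k2 q (A n) r \<le> ?J k2 q h1 r" by (rule Jmono[OF k(4) pq(2) o0(1) o(2) iA[OF that] int(2)[OF that] that])
      then show "B (Suc n) r \<le> h2 r" using super(2)[OF that] by (simp add: AS)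
    qed
    have o0': "\<And>r. r \<in> I \<Longrightarrow> 0 \<le> A (Suc n) r" "\<And>r. r \<in> I \<Longrightarrow> 0 \<le> B (Suc n) r"
      using o(5,6) o0 by (meson order_trans)+
    have iB': "(\<lambda>s. k1 s * B (Suc n) s powr p) integrable_on {0<..r}" if "r \<in> I" for r
      by (rule Jint[OF k(1,3) pq(1) c'(2) o0'(2) oS(2) int(1)[OF that] that])
    have iA': "(\<lambda>s. k2 s * A (Suc n) s powr q) integrable_on {0<..r}" if "r \<in> I" for r
      by (rule Jint[OF k(2,4) pq(2) c'(1) o0'(1) oS(1) int(2)[OF that] that])
    have "A (Suc n) r \<le> A (Suc (Suc n)) r" "B (Suc n) r \<le> B (Suc (Suc n)) r" if "r \<in> I" for r
    proof -
      have "?J k1 p (B n) r \<le> ?J k1 p (B (Suc n)) r"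
        by (rule Jmono[OF k(3) pq(1) o0(2) o(6) iB[OF that] iB'[OF that] that])
      then show "A (Suc n) r \<le> A (Suc (Suc n)) r" by (subst (1 2) AS(1)) simp
      have "?J k2 q (A n) r \<le> ?J k2 q (A (Suc n)) r"
        by (rule Jmono[OF k(4) pq(2) o0(1) o(5) iA[OF that] iA'[OF that] that])
      then show "B (Suc n) r \<le> B (Suc (Suc n)) r" by (subst (1 2) AS(2)) simp
    qed
    moreover have "l1 r \<le> A (Suc n) r" "l2 r \<le> B (Suc n) r" if "r \<in> I" for r
      using o(1,3,5,6)[OF that] by linarith+
    ultimately show ?case using c' oS by simp
  qed
  have cAB: "continuous_on I (A n)" "continuous_on I (B n)" for n using inv by auto
  have bd: "l1 r \<le> A n r" "A n r \<le> h1 r" "l2 r \<le> B n r" "B n r \<le> h2 r" "A n r \<le> A (Suc n) r" "B n r \<le> B (Suc n) r"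
    if "r \<in> I" for n r using inv[of n] that by auto
  have p0: "0 \<le> A n r" "0 \<le> B n r" if "r \<in> I" for n r
    using bd(1,3)[OF that, of n] l(3,4)[OF that] by linarith+
  define w1 where "w1 r = lim (\<lambda>n. A n r)" for r
  define w2 where "w2 r = lim (\<lambda>n. B n r)" for r
  have lim: "(\<lambda>n. A n r) \<longlonglongrightarrow> w1 r" "(\<lambda>n. B n r) \<longlonglongrightarrow> w2 r" if "r \<in> I" for r
  proof -
    have "incseq (\<lambda>n. A n r)" using bd(5)[OF that] by (rule incseq_SucI)
    from incseq_convergent[OF this, of "h1 r"] bd(2)[OF that]
    show "(\<lambda>n. A n r) \<longlonglongrightarrow> w1 r" unfolding w1_def by (metis limI)
    have "incseq (\<lambda>n. B n r)" using bd(6)[OF that] by (rule incseq_SucI)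
    from incseq_convergent[OF this, of "h2 r"] bd(4)[OF that]
    show "(\<lambda>n. B n r) \<longlonglongrightarrow> w2 r" unfolding w2_def by (metis limI)
  qed
  have wb: "l1 r \<le> w1 r" "w1 r \<le> h1 r" "l2 r \<le> w2 r" "w2 r \<le> h2 r" if "r \<in> I" for r
    using LIMSEQ_le_const[OF lim(1)[OF that]] LIMSEQ_le_const2[OF lim(1)[OF that]]
      LIMSEQ_le_const[OF lim(2)[OF that]] LIMSEQ_le_const2[OF lim(2)[OF that]] bd[OF that] by blast+
  have mct: "(\<lambda>s. k s * v s powr p) integrable_on {0<..r} \<and> (\<lambda>n. ?J k p (V n) r) \<longlonglongrightarrow> ?J k p v r"
    if "continuous_on I k" "\<And>r. r \<in> I \<Longrightarrow> 0 \<le> k r" "p > 0" "\<And>n. continuous_on I (V n)"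
      "\<And>n r. r \<in> I \<Longrightarrow> 0 \<le> V n r" "\<And>n r. r \<in> I \<Longrightarrow> V n r \<le> h r" "\<And>n r. r \<in> I \<Longrightarrow> V n r \<le> V (Suc n) r"
      "\<And>r. r \<in> I \<Longrightarrow> (\<lambda>n. V n r) \<longlonglongrightarrow> v r" "(\<lambda>s. k s * h s powr p) integrable_on {0<..r}" "r \<in> I"
    for k v h :: "real \<Rightarrow> real" and V :: "nat \<Rightarrow> real \<Rightarrow> real" and p r
  proof (rule monotone_convergence_increasing)
    have i: "(\<lambda>s. k s * V n s powr p) integrable_on {0<..r}" for n
      by (rule Jint[OF that(1,2,3) that(4)[of n] that(5)[of _ n] that(6)[of _ n] that(9,10)])
    show "(\<lambda>s. k s * V n s powr p) integrable_on {0<..r}" for n by (rule i)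
    have in_I: "s \<in> I" if "s \<in> {0<..r}" for s using Isub[OF \<open>r \<in> I\<close>] that by auto
    show "k s * V n s powr p \<le> k s * V (Suc n) s powr p" if "s \<in> {0<..r}" for n s
      using \<open>\<And>r. r \<in> I \<Longrightarrow> 0 \<le> k r\<close>[OF in_I[OF that]] \<open>p > 0\<close>
        \<open>\<And>n r. r \<in> I \<Longrightarrow> 0 \<le> V n r\<close>[OF in_I[OF that]] \<open>\<And>n r. r \<in> I \<Longrightarrow> V n r \<le> V (Suc n) r\<close>[OF in_I[OF that]]
      by (intro mult_left_mono powr_mono2) auto
    show "(\<lambda>n. k s * V n s powr p) \<longlonglongrightarrow> k s * v s powr p" if "s \<in> {0<..r}" for s
      using \<open>p > 0\<close> \<open>\<And>n r. r \<in> I \<Longrightarrow> 0 \<le> V n r\<close>[OF in_I[OF that]] \<open>\<And>r. r \<in> I \<Longrightarrow> (\<lambda>n. V n r) \<longlonglongrightarrow> v r\<close>[OF in_I[OF that]]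
      by (intro tendsto_mult tendsto_const tendsto_powr') auto
    have b: "?J k p (V n) r \<le> ?J k p h r" "0 \<le> ?J k p (V n) r" for n
    proof -
      show "?J k p (V n) r \<le> ?J k p h r" by (rule Jmono[OF that(2,3) that(5)[of _ n] that(6)[of _ n] i that(9,10)])
      show "0 \<le> ?J k p (V n) r" by (rule integral_nonneg[OF i]) (use that(2) in_I in auto)
    qed
    show "bounded (range (\<lambda>n. ?J k p (V n) r))"
      unfolding bounded_iff using b by (intro exI[of _ "?J k p h r"]) auto
  qed
  have m1: "(\<lambda>s. k1 s * w2 s powr p) integrable_on {0<..r}" "(\<lambda>n. ?J k1 p (B n) r) \<longlonglongrightarrow> ?J k1 p w2 r" if "r \<in> I" for r
    using mct[OF k(1,3) pq(1) cAB(2) p0(2) bd(4) bd(6) lim(2) int(1)[OF that] that] by auto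
  have m2: "(\<lambda>s. k2 s * w1 s powr q) integrable_on {0<..r}" "(\<lambda>n. ?J k2 q (A n) r) \<longlonglongrightarrow> ?J k2 q w1 r" if "r \<in> I" for r
    using mct[OF k(2,4) pq(2) cAB(1) p0(1) bd(2) bd(5) lim(1) int(2)[OF that] that] by auto
  have fix1: "w1 r = C1 + ?J k1 p w2 r" if "r \<in> I" for r
  proof -
    have "(\<lambda>n. A (Suc n) r) \<longlonglongrightarrow> C1 + ?J k1 p w2 r" unfolding AS by (intro tendsto_intros m1(2) that)
    then show ?thesis using LIMSEQ_Suc[OF lim(1)[OF that]] LIMSEQ_unique by blast
  qed
  have fix2: "w2 r = C2 + ?J k2 q w1 r" if "r \<in> I" for r
  proof -
    have "(\<lambda>n. B (Suc n) r) \<longlonglongrightarrow> C2 + ?J k2 q w1 r" unfolding AS by (intro tendsto_intros m2(2) that)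
    then show ?thesis using LIMSEQ_Suc[OF lim(2)[OF that]] LIMSEQ_unique by blast
  qed
  have cw: "continuous_on I w1" "continuous_on I w2"
  proof -
    have "continuous_on I (\<lambda>r. C1 + ?J k1 p w2 r)"
      by (rule continuous_on_add[OF continuous_on_const primitive_continuous[OF I(1,2) m1(1)]])
    then show "continuous_on I w1" by (rule continuous_on_eq) (simp add: fix1)
    have "continuous_on I (\<lambda>r. C2 + ?J k2 q w1 r)"
      by (rule continuous_on_add[OF continuous_on_const primitive_continuous[OF I(1,2) m2(1)]])
    then show "continuous_on I w2" by (rule continuous_on_eq) (simp add: fix2)
  qed
  have w0: "0 \<le> w1 r" "0 \<le> w2 r" if "r \<in> I" for r using wb(1,3)[OF that] l(3,4)[OF that] by linarith+
  have d1: "(w1 has_real_derivative k1 r * w2 r powr p) (at r)" if "r \<in> I" for r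
  proof -
    have "((\<lambda>r. ?J k1 p w2 r) has_real_derivative k1 r * w2 r powr p) (at r)"
      by (rule primitive_has_derivative[OF I m1(1) _ that])
         (auto intro!: continuous_intros k cw continuous_on_powr_nonneg w0 pq)
    then have "((\<lambda>r. C1 + ?J k1 p w2 r) has_real_derivative k1 r * w2 r powr p) (at r)"
      by (auto intro!: derivative_eq_intros)
    then show ?thesis
      by (rule has_field_derivative_transform_within_open[OF _ I(1) that]) (simp add: fix1)
  qed
  have d2: "(w2 has_real_derivative k2 r * w1 r powr q) (at r)" if "r \<in> I" for r
  proof -
    have "((\<lambda>r. ?J k2 q w1 r) has_real_derivative k2 r * w1 r powr q) (at r)"
      by (rule primitive_has_derivative[OF I m2(1) _ that])
         (auto intro!: continuous_intros k cw continuous_on_powr_nonneg w0 pq)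
    then have "((\<lambda>r. C2 + ?J k2 q w1 r) has_real_derivative k2 r * w1 r powr q) (at r)"
      by (auto intro!: derivative_eq_intros)
    then show ?thesis
      by (rule has_field_derivative_transform_within_open[OF _ I(1) that]) (simp add: fix2)
  qed
  have Jw: "0 \<le> ?J k1 p w2 r" "?J k1 p w2 r \<le> ?J k1 p h2 r" "0 \<le> ?J k2 q w1 r" "?J k2 q w1 r \<le> ?J k2 q h1 r"
    if "r \<in> I" for r
    using Jmono[OF k(3) pq(1) w0(2) wb(4) m1(1)[OF that] int(1)[OF that] that]
      Jmono[OF k(4) pq(2) w0(1) wb(2) m2(1)[OF that] int(2)[OF that] that]
      integral_nonneg[OF m1(1)[OF that]] integral_nonneg[OF m2(1)[OF that]] k(3,4) Isub[OF that]
    by (auto simp: subset_iff)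
  show ?thesis
    by (intro exI[of _ w1] exI[of _ w2] ballI conjI wb d1 d2; assumption?) (use Jw fix1 fix2 in auto)
qed

section \<open>Local solutions with Dirac masses\<close>

lemma powr_primitive:
  assumes "c > (-1::real)" "r > 0"
  shows "(\<lambda>s. K * s powr c) integrable_on {0<..r}"
    and "integral {0<..r} (\<lambda>s. K * s powr c) = K * (r powr (c + 1) / (c + 1))"
proof -
  have "((\<lambda>s. K * s powr c) has_integral K * (r powr (c + 1) / (c + 1))) {0..r}"
    using has_integral_powr_from_0[OF assms(1), of r] assms(2) by (intro has_integral_mult_right) auto
  then show "(\<lambda>s. K * s powr c) integrable_on {0<..r}"
    "integral {0<..r} (\<lambda>s. K * s powr c) = K * (r powr (c + 1) / (c + 1))"
    unfolding integrable_on_half_open_iff by (blast intro: integral_unique)+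
qed

text \<open>
  Inserting \<open>H\<^sub>1 = 2 K H\<^sub>2\<^bsup>p\<^esup>\<close> into the second condition leaves \<open>H\<^sub>2\<^bsup>pq\<^esup> \<le> H\<^sub>2 / a\<close>; since \<open>p q > 1\<close> this can be
  solved with equality, however large \<open>K\<close> is.
\<close>
lemma power_supersolution_constants:
  fixes p q K :: real
  assumes "p > 0" "q > 0" "p * q > 1" "K > 0"
  obtains H1 H2 :: real where "H1 > 0" "H2 > 0" "H2 powr p * K \<le> H1 / 2" "H1 powr q * K \<le> H2 / 2"
proof -
  define a where "a = (2 * K) powr q * (2 * K)"
  define H2 where "H2 = (1 / a) powr (1 / (p * q - 1))"
  have a: "a > 0" using assms by (simp add: a_def)
  have H2: "H2 > 0" using a by (simp add: H2_def)
  have "H2 powr (p * q - 1) = 1 / a" using assms a by (simp add: H2_def powr_powr)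
  then have e: "H2 powr (p * q) * a = H2" using H2 a by (simp add: powr_diff field_simps)
  define H1 where "H1 = 2 * K * H2 powr p"
  have "H1 powr q * K = H2 powr (p * q) * a / 2"
    using assms H2 by (simp add: H1_def powr_mult powr_powr a_def)
  then have 2: "H1 powr q * K = H2 / 2" using e by simp
  show ?thesis
    by (rule that[of H1 H2]) (use H2 assms 2 in \<open>auto simp: H1_def\<close>)
qed

lemma tendsto_at_right_0_power_squeeze:
  fixes w :: "real \<Rightarrow> real"
  assumes "R > 0" "s > 0" "\<And>r. 0 < r \<Longrightarrow> r < R \<Longrightarrow> C \<le> w r \<and> w r \<le> C + K * r powr s"
  shows "(w \<longlongrightarrow> C) (at_right 0)"
proof (rule tendsto_sandwich[of "\<lambda>_. C" _ _ "\<lambda>r. C + K * r powr s"])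
  have ev: "eventually (\<lambda>r. r \<in> {0<..<R}) (at_right 0)" by (rule eventually_at_right_real[OF assms(1)])
  show "eventually (\<lambda>r. C \<le> w r) (at_right 0)" "eventually (\<lambda>r. w r \<le> C + K * r powr s) (at_right 0)"
    using ev by (eventually_elim, use assms(3) in auto)+
  have "((\<lambda>r. C + K * r powr s) \<longlongrightarrow> C + K * 0) (at_right 0)"
    using assms(2) by (intro tendsto_intros powr_tendsto_0_at_right_0)
  then show "((\<lambda>r. C + K * r powr s) \<longlongrightarrow> C) (at_right 0)" by simp
qed simp

text \<open>
  The exponents \<open>e\<^sub>i\<close> prescribe the size of the fluxes at \<open>0\<close>: \<open>e\<^sub>i = 0\<close> for a flux with a positive limit (a Dirac mass),
  and \<open>e\<^sub>i > 0\<close> for a flux that starts from \<open>0\<close> and is generated by the other one. The two inequalities on each exponent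
  say that the integral on the right-hand side converges and is no larger than the barrier near \<open>0\<close>.
\<close>
lemma local_flux_exists:
  fixes n p q R e1 e2 :: real
  assumes R: "R > 0" and pq: "p > 0" "q > 0" "p * q > 1" and e: "e1 \<ge> 0" "e2 \<ge> 0"
    and s1: "(n - 1) * (1 - p) + p * e2 + 1 > 0" "(n - 1) * (1 - p) + p * e2 + 1 \<ge> e1"
    and s2: "(n - 1) * (1 - q) + q * e1 + 1 > 0" "(n - 1) * (1 - q) + q * e1 + 1 \<ge> e2"
  obtains w1 w2 C1 C2 H1 H2 where "flux_system {0<..<R} n p q w1 w2"
    "(w1 \<longlongrightarrow> C1) (at_right 0)" "(w2 \<longlongrightarrow> C2) (at_right 0)"
    "\<And>r. 0 < r \<Longrightarrow> r < R \<Longrightarrow> w1 r \<le> H1 * r powr e1" "\<And>r. 0 < r \<Longrightarrow> r < R \<Longrightarrow> w2 r \<le> H2 * r powr e2"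
    "if e1 = 0 then C1 > 0 else C1 = 0" "if e2 = 0 then C2 > 0 else C2 = 0"
proof -
  let ?c1 = "(n - 1) * (1 - p) + p * e2" and ?c2 = "(n - 1) * (1 - q) + q * e1"
  \<comment> \<open>comparison constants between the integrals and the barriers \<open>r\<^bsup>e\<^sub>i\<^esup>\<close> on \<open>(0, R]\<close>\<close>
  define K where "K = max (R powr (?c1 + 1 - e1) / (?c1 + 1)) (R powr (?c2 + 1 - e2) / (?c2 + 1))"
  have K: "K > 0" "R powr (?c1 + 1 - e1) / (?c1 + 1) \<le> K" "R powr (?c2 + 1 - e2) / (?c2 + 1) \<le> K"
    using R s1 s2 by (auto simp: K_def less_max_iff_disj)
  obtain H1 H2 where H: "H1 > 0" "H2 > 0" "H2 powr p * K \<le> H1 / 2" "H1 powr q * K \<le> H2 / 2"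
    using power_supersolution_constants[OF pq K(1)] by blast
  define C1 where "C1 = (if e1 = 0 then H1 / 2 else 0)"
  define C2 where "C2 = (if e2 = 0 then H2 / 2 else 0)"
  let ?k1 = "\<lambda>s. s powr ((n - 1) * (1 - p))" and ?k2 = "\<lambda>s. s powr ((n - 1) * (1 - q))"
  let ?h1 = "\<lambda>r. H1 * r powr e1" and ?h2 = "\<lambda>r. H2 * r powr e2"
  have eq1: "?k1 s * ?h2 s powr p = H2 powr p * s powr ?c1" for s
    using H by (simp add: powr_mult powr_powr powr_add mult_ac)
  have eq2: "?k2 s * ?h1 s powr q = H1 powr q * s powr ?c2" for s
    using H by (simp add: powr_mult powr_powr powr_add mult_ac)
  have c: "?c1 > -1" "?c2 > -1" using s1 s2 by auto
  have i1: "(\<lambda>s. ?k1 s * ?h2 s powr p) integrable_on {0<..r}"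
    "integral {0<..r} (\<lambda>s. ?k1 s * ?h2 s powr p) = H2 powr p * (r powr (?c1 + 1) / (?c1 + 1))" if "r > 0" for r
    unfolding eq1 using powr_primitive[OF c(1) that] by auto
  have i2: "(\<lambda>s. ?k2 s * ?h1 s powr q) integrable_on {0<..r}"
    "integral {0<..r} (\<lambda>s. ?k2 s * ?h1 s powr q) = H1 powr q * (r powr (?c2 + 1) / (?c2 + 1))" if "r > 0" for r
    unfolding eq2 using powr_primitive[OF c(2) that] by auto
  have super: "C + X powr z * (r powr (cc + 1) / (cc + 1)) \<le> Y * r powr ee"
    if r: "0 < r" "r < R" and cc: "cc + 1 > 0" "cc + 1 \<ge> ee" and XY: "X > 0" "Y > 0" "X powr z * K \<le> Y / 2"
      and KK: "R powr (cc + 1 - ee) / (cc + 1) \<le> K" and C: "C = (if ee = 0 then Y / 2 else 0)" for r cc ee X Y C z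
  proof -
    have "r powr (cc + 1) = r powr (cc + 1 - ee) * r powr ee" by (simp add: powr_add[symmetric])
    also have "\<dots> \<le> R powr (cc + 1 - ee) * r powr ee"
      using r cc by (intro mult_right_mono powr_mono2) auto
    finally have "r powr (cc + 1) / (cc + 1) \<le> R powr (cc + 1 - ee) / (cc + 1) * r powr ee"
      using cc by (simp add: divide_right_mono)
    also have "\<dots> \<le> K * r powr ee" using KK by (intro mult_right_mono) auto
    finally have "X powr z * (r powr (cc + 1) / (cc + 1)) \<le> X powr z * (K * r powr ee)"
      by (intro mult_left_mono) auto
    also have "\<dots> = (X powr z * K) * r powr ee" by simp
    also have "\<dots> \<le> Y / 2 * r powr ee" using XY(3) by (intro mult_right_mono) auto
    finally have "X powr z * (r powr (cc + 1) / (cc + 1)) \<le> Y / 2 * r powr ee" .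
    moreover have "C \<le> Y / 2 * r powr ee" using C r XY(2) by simp
    ultimately show ?thesis by linarith
  qed
  have "\<exists>w1 w2. \<forall>r\<in>{0<..<R}. 0 \<le> w1 r \<and> w1 r \<le> ?h1 r \<and> 0 \<le> w2 r \<and> w2 r \<le> ?h2 r \<and>
     (w1 has_real_derivative ?k1 r * w2 r powr p) (at r) \<and> (w2 has_real_derivative ?k2 r * w1 r powr q) (at r) \<and>
     C1 \<le> w1 r \<and> C2 \<le> w2 r \<and>
     w1 r \<le> C1 + integral {0<..r} (\<lambda>s. ?k1 s * ?h2 s powr p) \<and>
     w2 r \<le> C2 + integral {0<..r} (\<lambda>s. ?k2 s * ?h1 s powr q)"
  proof (rule monotone_iteration[where I = "{0<..<R}"])
    show "C1 + integral {0<..r} (\<lambda>s. ?k1 s * ?h2 s powr p) \<le> ?h1 r" if "r \<in> {0<..<R}" for r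
      using super[of r ?c1 e1 H2 H1 p C1] that s1 H K C1_def i1(2)[of r] by simp
    show "C2 + integral {0<..r} (\<lambda>s. ?k2 s * ?h1 s powr q) \<le> ?h2 r" if "r \<in> {0<..<R}" for r
      using super[of r ?c2 e2 H1 H2 q C2] that s2 H K C2_def i2(2)[of r] by simp
    show "0 \<le> C1 + integral {0<..r} (\<lambda>s. ?k1 s * 0 powr p)" for r using H by (simp add: C1_def)
    show "0 \<le> C2 + integral {0<..r} (\<lambda>s. ?k2 s * 0 powr q)" for r using H by (simp add: C2_def)
    show "continuous_on {0<..<R} ?k1" "continuous_on {0<..<R} ?k2" by (auto intro!: continuous_intros)
  qed (use i1 i2 H pq in auto)
  then obtain w1 w2 where w: "\<And>r. r \<in> {0<..<R} \<Longrightarrow> 0 \<le> w1 r \<and> w1 r \<le> ?h1 r \<and> 0 \<le> w2 r \<and> w2 r \<le> ?h2 r"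
     "\<And>r. r \<in> {0<..<R} \<Longrightarrow> (w1 has_real_derivative ?k1 r * w2 r powr p) (at r)"
     "\<And>r. r \<in> {0<..<R} \<Longrightarrow> (w2 has_real_derivative ?k2 r * w1 r powr q) (at r)"
     "\<And>r. r \<in> {0<..<R} \<Longrightarrow> C1 \<le> w1 r \<and> w1 r \<le> C1 + integral {0<..r} (\<lambda>s. ?k1 s * ?h2 s powr p)"
     "\<And>r. r \<in> {0<..<R} \<Longrightarrow> C2 \<le> w2 r \<and> w2 r \<le> C2 + integral {0<..r} (\<lambda>s. ?k2 s * ?h1 s powr q)"
    by blast
  show ?thesis
  proof (rule that[of w1 w2 C1 C2 H1 H2])
    show "flux_system {0<..<R} n p q w1 w2" unfolding flux_system_def using w(1-3) by simp
    show "(w1 \<longlongrightarrow> C1) (at_right 0)"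
      by (rule tendsto_at_right_0_power_squeeze[OF R s1(1), where K = "H2 powr p / (?c1 + 1)"])
         (use w(4) i1(2) in simp)
    show "(w2 \<longlongrightarrow> C2) (at_right 0)"
      by (rule tendsto_at_right_0_power_squeeze[OF R s2(1), where K = "H1 powr q / (?c2 + 1)"])
         (use w(5) i2(2) in simp)
  qed (use w(1) H in \<open>auto simp: C1_def C2_def\<close>)
qed

text \<open>
  The right end is an extended real, so that bounded intervals and the half-line are treated together.
\<close>
lemma flux_profile_exists:
  fixes w :: "real \<Rightarrow> real"
  assumes "continuous_on {r. 0 < r \<and> ereal r < b} w" "0 < b"
  obtains F where "flux_profile {r. 0 < r \<and> ereal r < b} n w F"
proof -
  have "continuous_on {r. 0 < r \<and> ereal r < b} (\<lambda>r. - (r powr (1 - n) * w r))"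
    by (intro continuous_intros assms(1)) auto
  moreover have "open {r. 0 < r \<and> ereal r < b}"
    by (intro open_Collect_conj open_Collect_less continuous_intros)
  ultimately have "isCont (\<lambda>r. - (r powr (1 - n) * w r)) r" if "0 < ereal r" "ereal r < b" for r
    using that by (simp add: continuous_on_eq_continuous_at)
  then obtain F where F: "\<And>r. 0 < ereal r \<Longrightarrow> ereal r < b \<Longrightarrow> (F has_vector_derivative - (r powr (1 - n) * w r)) (at r)"
    using einterval_antiderivative[OF assms(2), of "\<lambda>r. - (r powr (1 - n) * w r)"] by blast
  show ?thesis
    by (rule that[of F]) (use F in \<open>simp add: flux_profile_def has_real_derivative_iff_has_vector_derivative\<close>)
qed

text \<open>
  At the origin \<open>F\<close> may take any value: gradients of singular functions are unspecified there.
\<close>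
lemma radial_set_integrable:
  fixes F :: "'a::euclidean_space \<Rightarrow> real"
  assumes R: "R > 0" and g: "continuous_on {0<..<R} g" "\<And>r. 0 < r \<Longrightarrow> r < R \<Longrightarrow> \<bar>g r\<bar> \<le> K * r powr s"
    and s: "s > - real DIM('a)" and F: "\<And>x. x \<in> ball 0 R - {0} \<Longrightarrow> F x = g (norm x)"
  shows "set_integrable lborel (ball 0 R) F"
proof -
  let ?B = "ball 0 R - {0::'a}"
  have K: "integrable lborel (\<lambda>x::'a. K * (indicator (ball 0 R) x *\<^sub>R (norm x powr s)))"
    using norm_powr_integrable_ball[OF s R] unfolding set_integrable_def by (rule integrable_mult_right)
  have c: "continuous_on ?B (\<lambda>x. g (norm x))"
    by (rule continuous_on_compose2[OF g(1)]) (auto intro!: continuous_intros)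
  have m: "(\<lambda>x. indicator ?B x *\<^sub>R g (norm x)) \<in> borel_measurable borel"
    by (rule borel_measurable_continuous_on_indicator[OF _ c]) auto
  have 1: "integrable lborel (\<lambda>x. indicator ?B x *\<^sub>R g (norm x))"
  proof (rule Bochner_Integration.integrable_bound[OF K])
    show "AE x in lborel. norm (indicator ?B x *\<^sub>R g (norm x)) \<le> norm (K * (indicator (ball 0 R) x *\<^sub>R (norm x powr s)))"
    proof (intro AE_I2)
      fix x :: 'a
      show "norm (indicator ?B x *\<^sub>R g (norm x)) \<le> norm (K * (indicator (ball 0 R) x *\<^sub>R (norm x powr s)))"
        using g(2)[of "norm x"] by (auto simp: indicator_def)
    qed
  qed (use m in simp)
  have 2: "integrable lborel (\<lambda>x. indicator {0::'a} x * F 0)"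
    by (intro integrable_mult_left integrable_real_indicator) auto
  have "(\<lambda>x. indicator (ball 0 R) x *\<^sub>R F x) = (\<lambda>x. indicator ?B x *\<^sub>R g (norm x) + indicator {0::'a} x * F 0)"
    using F R by (auto simp: fun_eq_iff indicator_def)
  then show ?thesis unfolding set_integrable_def using Bochner_Integration.integrable_add[OF 1 2] by simp
qed

lemma flux_profile_antimono:
  assumes "flux_profile I n w f" "{r..s} \<subseteq> I" "\<And>x. x \<in> I \<Longrightarrow> 0 \<le> w x" "r \<le> s"
  shows "f s \<le> f r"
proof (rule DERIV_nonpos_imp_nonincreasing[OF assms(4)])
  fix x assume "r \<le> x" "x \<le> s"
  then have x: "x \<in> I" using assms(2) by auto
  have "- (x powr (1 - n) * w x) \<le> 0" using assms(3)[OF x] by simp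
  then show "\<exists>y. (f has_real_derivative y) (at x) \<and> y \<le> 0"
    using assms(1) x unfolding flux_profile_def by blast
qed

text \<open>
  A profile grows no faster at \<open>0\<close> than the fundamental solution carrying a larger flux.
\<close>
lemma flux_profile_le_fundamental:
  assumes "flux_profile I n w f" "{r..s} \<subseteq> I" "\<And>x. x \<in> I \<Longrightarrow> 0 < x \<and> w x \<le> M" "r \<le> s" "n > 2"
  shows "f r - M / (n - 2) * r powr (2 - n) \<le> f s - M / (n - 2) * s powr (2 - n)"
proof (rule DERIV_nonneg_imp_nondecreasing[OF assms(4)])
  fix x assume "r \<le> x" "x \<le> s"
  then have x: "x \<in> I" "0 < x" using assms(2,3) by auto
  have "((\<lambda>r. f r - M / (n - 2) * r powr (2 - n)) has_real_derivative
      - (x powr (1 - n) * w x) - M / (n - 2) * ((2 - n) * x powr (1 - n))) (at x)"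
    using assms(1,5) x unfolding flux_profile_def by (auto intro!: derivative_eq_intros)
  moreover have "- (x powr (1 - n) * w x) - M / (n - 2) * ((2 - n) * x powr (1 - n)) = x powr (1 - n) * (M - w x)"
    using assms(5) by (simp add: field_simps)
  moreover have "0 \<le> x powr (1 - n) * (M - w x)" using assms(3)[OF x(1)] by simp
  ultimately show "\<exists>y. ((\<lambda>r. f r - M / (n - 2) * r powr (2 - n)) has_real_derivative y) (at x) \<and> 0 \<le> y"
    by metis
qed

text \<open>
  The flux system is solved on the larger interval \<open>(0, 2 r\<^sub>0)\<close>; normalising the profiles to vanish at \<open>r\<^sub>0\<close> makes them
  nonnegative on \<open>(0, r\<^sub>0)\<close> and bounded by a multiple of \<open>r\<^bsup>2-n\<^esup>\<close>. The condition that makes the flux integral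
  converge is the one that makes the right-hand sides integrable.
\<close>
lemma local_dirac_exists:
  fixes p q r0 e1 e2 n :: real
  assumes n: "n = real DIM('a::euclidean_space)" "n > 2" and r0: "r0 > 0"
    and pq: "p > 0" "q > 0" "p * q > 1" and e: "e1 \<ge> 0" "e2 \<ge> 0"
    and s1: "(n - 1) * (1 - p) + p * e2 + 1 > 0" "(n - 1) * (1 - p) + p * e2 + 1 \<ge> e1"
    and s2: "(n - 1) * (1 - q) + q * e1 + 1 > 0" "(n - 1) * (1 - q) + q * e1 + 1 \<ge> e2"
  obtains C1 C2 f1 f2 where "local_dirac_solution TYPE('a) r0 p q C1 C2 f1 f2"
    "if e1 = 0 then C1 > 0 else C1 = 0" "if e2 = 0 then C2 > 0 else C2 = 0"
proof -
  define R where "R = 2 * r0"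
  have R: "R > 0" "r0 < R" using r0 by (auto simp: R_def)
  obtain w1 w2 c1 c2 H1 H2 where W: "flux_system {0<..<R} n p q w1 w2"
    and lim: "(w1 \<longlongrightarrow> c1) (at_right 0)" "(w2 \<longlongrightarrow> c2) (at_right 0)"
    and wH: "\<And>r. 0 < r \<Longrightarrow> r < R \<Longrightarrow> w1 r \<le> H1 * r powr e1" "\<And>r. 0 < r \<Longrightarrow> r < R \<Longrightarrow> w2 r \<le> H2 * r powr e2"
    and c: "if e1 = 0 then c1 > 0 else c1 = 0" "if e2 = 0 then c2 > 0 else c2 = 0"
    by (rule local_flux_exists[OF R(1) pq e s1 s2]) blast
  have set: "{r. 0 < r \<and> ereal r < ereal R} = {0<..<R}" by auto
  note cw = flux_system_continuous[OF W]
  obtain F1 where F1: "flux_profile {0<..<R} n w1 F1"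
    using flux_profile_exists[of "ereal R" w1 n] cw(1) R set by auto
  obtain F2 where F2: "flux_profile {0<..<R} n w2 F2"
    using flux_profile_exists[of "ereal R" w2 n] cw(2) R set by auto
  define f1 where "f1 r = F1 r - F1 r0" for r
  define f2 where "f2 r = F2 r - F2 r0" for r
  have f: "flux_profile {0<..<R} n w1 f1" "flux_profile {0<..<R} n w2 f2"
    using F1 F2 unfolding flux_profile_def f1_def f2_def by (auto intro!: derivative_eq_intros)
  have fr0: "f1 r0 = 0" "f2 r0 = 0" by (auto simp: f1_def f2_def)
  have w: "\<And>r. r \<in> {0<..<R} \<Longrightarrow> 0 \<le> w1 r" "\<And>r. r \<in> {0<..<R} \<Longrightarrow> 0 \<le> w2 r"
    "\<And>r. r \<in> {0<..<R} \<Longrightarrow> (w1 has_real_derivative r powr ((n - 1) * (1 - p)) * w2 r powr p) (at r)"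
    "\<And>r. r \<in> {0<..<R} \<Longrightarrow> (w2 has_real_derivative r powr ((n - 1) * (1 - q)) * w1 r powr q) (at r)"
    using W unfolding flux_system_def by auto
  have H0: "0 \<le> H1" "0 \<le> H2"
  proof -
    have "0 \<le> H1 * r0 powr e1" "0 \<le> H2 * r0 powr e2"
      using wH[of r0] w(1,2)[of r0] R r0 by auto
    moreover have "r0 powr e1 > 0" "r0 powr e2 > 0" using r0 by auto
    ultimately show "0 \<le> H1" "0 \<le> H2" by (auto simp: zero_le_mult_iff)
  qed
  obtain \<kappa> where \<kappa>: "\<kappa> > 0"
    and dirac: "\<And>R w w' f C (F :: 'a \<Rightarrow> real).
      R > 0 \<Longrightarrow> flux_profile {0<..<R} (real DIM('a)) w f \<Longrightarrow> (\<And>r. r \<in> {0<..<R} \<Longrightarrow> 0 \<le> f r) \<Longrightarrow>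
      (\<And>r. r \<in> {0<..<R} \<Longrightarrow> (w has_real_derivative w' r) (at r)) \<Longrightarrow> (\<And>r. r \<in> {0<..<R} \<Longrightarrow> 0 \<le> w r) \<Longrightarrow>
      continuous_on {0<..<R} w' \<Longrightarrow> (w \<longlongrightarrow> C) (at_right 0) \<Longrightarrow>
      (\<And>x. x \<in> ball 0 R - {0} \<Longrightarrow> F x = norm x powr (1 - real DIM('a)) * w' (norm x)) \<Longrightarrow>
      set_integrable lborel (ball 0 R) (\<lambda>x::'a. f (norm x)) \<Longrightarrow>
      set_integrable lborel (ball 0 R) F \<Longrightarrow>
      neg_laplacian_dirac (ball 0 R) (\<lambda>x. f (norm x)) F (\<kappa> * C)"
    by (rule radial_dirac_mass[where 'a = 'a]) blast
  have sub: "{0<..<r0} \<subseteq> {0<..<R}" using R by auto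
  have f0: "0 \<le> f r" if "flux_profile {0<..<R} n w f" "f r0 = 0" "\<And>r. r \<in> {0<..<R} \<Longrightarrow> 0 \<le> w r" "r \<in> {0<..<r0}" for f w r
  proof -
    have "{r..r0} \<subseteq> {0<..<R}" using that(4) R by auto
    from flux_profile_antimono[OF that(1) this that(3)] show ?thesis using that(2,4) by simp
  qed
  let ?B = "ball 0 r0 - {0::'a}"
  have nB: "norm ` ?B \<subseteq> {0<..<r0}" "norm ` ?B \<subseteq> {0<..<R}" using R by auto
  have op: "open ?B" "0 \<notin> ?B" by auto
  have comp: "neg_laplacian_dirac (ball 0 r0) (\<lambda>x. f (norm x)) (\<lambda>x::'a. norm (grad (\<lambda>y. g (norm y)) x) powr p) (\<kappa> * C)"
    if p: "p > 0"
      and w: "\<And>r. r \<in> {0<..<R} \<Longrightarrow> (w has_real_derivative r powr ((n - 1) * (1 - p)) * v r powr p) (at r)"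
        "\<And>r. r \<in> {0<..<R} \<Longrightarrow> 0 \<le> w r" "\<And>r. 0 < r \<Longrightarrow> r < R \<Longrightarrow> w r \<le> H * r powr e" "e \<ge> 0" "H \<ge> 0"
      and v: "\<And>r. r \<in> {0<..<R} \<Longrightarrow> (v has_real_derivative v' r) (at r)" "continuous_on {0<..<R} v'"
        "\<And>r. r \<in> {0<..<R} \<Longrightarrow> 0 \<le> v r" "\<And>r. 0 < r \<Longrightarrow> r < R \<Longrightarrow> v r \<le> H' * r powr e'" "H' \<ge> 0"
      and f: "flux_profile {0<..<R} n w f" "f r0 = 0" and g: "flux_profile {0<..<R} n v g"
      and C: "(w \<longlongrightarrow> C) (at_right 0)" and s: "(n - 1) * (1 - p) + p * e' + 1 > 0"
    for f g w v v' :: "real \<Rightarrow> real" and p H e H' e' C :: real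
  proof -
    let ?w' = "\<lambda>r. r powr ((n - 1) * (1 - p)) * v r powr p"
    have cv: "continuous_on {0<..<R} v"
      by (rule continuous_at_imp_continuous_on) (auto intro!: DERIV_isCont v(1))
    have cw': "continuous_on {0<..<R} ?w'"
      by (intro continuous_intros continuous_on_powr_nonneg cv p v) auto
    have wM: "0 < r \<and> w r \<le> H * R powr e" if "r \<in> {0<..<R}" for r
    proof -
      have "w r \<le> H * r powr e" using w(3) that by simp
      also have "\<dots> \<le> H * R powr e" using that w(4,5) by (intro mult_left_mono powr_mono2) auto
      finally show ?thesis using that by simp
    qed
    define M where "M = H * R powr e"
    have M0: "M \<ge> 0" using w(5) by (simp add: M_def)
    have fb: "\<bar>f r\<bar> \<le> M / (n - 2) * r powr (2 - n)" if r: "0 < r" "r < r0" for r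
    proof -
      have "f r - M / (n - 2) * r powr (2 - n) \<le> f r0 - M / (n - 2) * r0 powr (2 - n)"
        by (rule flux_profile_le_fundamental[OF f(1) _ _ _ n(2)]) (use r R wM in \<open>auto simp: M_def\<close>)
      moreover have "M / (n - 2) * r0 powr (2 - n) \<ge> 0" using M0 n(2) by simp
      ultimately show ?thesis using f(2) f0[OF f w(2), of r] r by simp
    qed
    have cf: "continuous_on {0<..<r0} f"
      using f(1) sub unfolding flux_profile_def by (intro continuous_at_imp_continuous_on) (auto intro!: DERIV_isCont)
    have grad: "norm (grad (\<lambda>y. g (norm y)) x) = norm x powr (1 - n) * v (norm x)" if "x \<in> ?B" for x :: 'a
    proof -
      have "norm (grad (\<lambda>y. g (norm y)) x) = norm x powr (1 - n) * \<bar>v (norm x)\<bar>"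
        by (rule flux_radial_derivatives(3)[OF op n(1) _ continuous_on_subset[OF v(2) nB(2)]
              flux_profile_subset[OF g nB(2)] that]) (use v(1) nB(2) in auto)
      moreover have "norm x \<in> {0<..<R}" using that R by auto
      ultimately show ?thesis using v(3) by simp
    qed
    have FG: "norm (grad (\<lambda>y. g (norm y)) x) powr p = (norm x powr (1 - n) * v (norm x)) powr p" if "x \<in> ?B" for x
      using grad[OF that] by simp
    have Gw': "(r powr (1 - n) * v r) powr p = r powr (1 - n) * ?w' r" if "0 < r" "r < R" for r
      using that v(3)[of r] by (simp add: powr_mult powr_powr powr_add[symmetric] mult.assoc[symmetric]) (simp add: algebra_simps)
    show ?thesis
    proof (rule dirac[where w = w and w' = ?w'])
      show "flux_profile {0<..<r0} (real DIM('a)) w f" using flux_profile_subset[OF f(1) sub] n(1) by simp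
      show "0 \<le> f r" if "r \<in> {0<..<r0}" for r by (rule f0[OF f w(2) that])
      show "(w has_real_derivative ?w' r) (at r)" "0 \<le> w r" if "r \<in> {0<..<r0}" for r
        using w(1,2) sub that by auto
      show "continuous_on {0<..<r0} ?w'" using cw' sub by (rule continuous_on_subset)
      show "norm (grad (\<lambda>y. g (norm y)) x) powr p = norm x powr (1 - real DIM('a)) * ?w' (norm x)" if "x \<in> ?B" for x
        using FG[OF that] Gw'[of "norm x"] that R n(1) by simp
      show "set_integrable lborel (ball 0 r0) (\<lambda>x::'a. f (norm x))"
        by (rule radial_set_integrable[where s = "2 - n", OF r0 cf fb]) (use n(1) in auto)
      show "set_integrable lborel (ball 0 r0) (\<lambda>x::'a. norm (grad (\<lambda>y. g (norm y)) x) powr p)"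
      proof (rule radial_set_integrable[OF r0, where g = "\<lambda>r. (r powr (1 - n) * v r) powr p" and K = "H' powr p" and s = "p * (1 - n + e')"])
        show "continuous_on {0<..<r0} (\<lambda>r. (r powr (1 - n) * v r) powr p)"
          by (intro continuous_intros continuous_on_powr_nonneg p continuous_on_subset[OF cv sub])
             (use v(3) sub in auto)
        show "\<bar>(r powr (1 - n) * v r) powr p\<bar> \<le> H' powr p * r powr (p * (1 - n + e'))" if r: "0 < r" "r < r0" for r
        proof -
          have "r powr (1 - n) * v r \<le> r powr (1 - n) * (H' * r powr e')"
            using v(4)[of r] r R by (intro mult_left_mono) auto
          also have "\<dots> = H' * r powr (1 - n + e')" by (simp add: powr_add)
          finally have "(r powr (1 - n) * v r) powr p \<le> (H' * r powr (1 - n + e')) powr p"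
            using v(3)[of r] r R p by (intro powr_mono2) auto
          also have "\<dots> = H' powr p * r powr (p * (1 - n + e'))"
            using v(5) by (simp add: powr_mult powr_powr mult.commute)
          finally show ?thesis by simp
        qed
        show "- real DIM('a) < p * (1 - n + e')" using s n(1) by (simp add: algebra_simps)
      qed (rule FG)
    qed (use r0 C in auto)
  qed
  have cw1': "continuous_on {0<..<R} (\<lambda>r. r powr ((n - 1) * (1 - p)) * w2 r powr p)"
    by (intro continuous_intros continuous_on_powr_nonneg cw pq w) auto
  have cw2': "continuous_on {0<..<R} (\<lambda>r. r powr ((n - 1) * (1 - q)) * w1 r powr q)"
    by (intro continuous_intros continuous_on_powr_nonneg cw pq w) auto
  have d1: "neg_laplacian_dirac (ball 0 r0) (\<lambda>x. f1 (norm x)) (\<lambda>x::'a. norm (grad (\<lambda>y. f2 (norm y)) x) powr p) (\<kappa> * c1)"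
    by (rule comp[OF pq(1) w(3) w(1) wH(1) e(1) H0(1) w(4) cw2' w(2) wH(2) H0(2) f(1) fr0(1) f(2) lim(1) s1(1)])
  have d2: "neg_laplacian_dirac (ball 0 r0) (\<lambda>x. f2 (norm x)) (\<lambda>x::'a. norm (grad (\<lambda>y. f1 (norm y)) x) powr q) (\<kappa> * c2)"
    by (rule comp[OF pq(2) w(4) w(2) wH(2) e(2) H0(2) w(3) cw1' w(1) wH(1) H0(1) f(2) fr0(2) f(1) lim(2) s2(1)])
  have "radial_solution ?B p q f1 f2"
  proof (rule flux_imp_radial_solution[OF op n(1) pq(1,2)])
    show "flux_system (norm ` ?B) n p q w1 w2" using W nB(2) unfolding flux_system_def by blast
    show "flux_profile (norm ` ?B) n w1 f1" "flux_profile (norm ` ?B) n w2 f2"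
      using f flux_profile_subset nB(2) by blast+
    show "0 \<le> f1 r" "0 \<le> f2 r" if "r \<in> norm ` ?B" for r
      using f0[OF f(1) fr0(1) w(1)] f0[OF f(2) fr0(2) w(2)] nB(1) that by blast+
  qed
  then have "local_dirac_solution TYPE('a) r0 p q (\<kappa> * c1) (\<kappa> * c2) f1 f2"
    unfolding local_dirac_solution_def using d1 d2 by blast
  then show ?thesis by (rule that) (use c \<kappa> in \<open>auto split: if_splits\<close>)
qed

section \<open>The orbit connecting the saddle with the origin\<close>

lemma powr_le_affine:
  fixes v k :: real
  assumes "0 < v" "0 \<le> k" "k \<le> 1"
  shows "v powr k \<le> 1 - k * (1 - v)"
  using Youngs_inequality_0[of k "1 - k" v 1] assms by (simp add: algebra_simps)

text \<open>
  The number \<open>la\<close> is the unstable eigenvalue of \<open>x' = al (y\<^bsup>p\<^esup> - x)\<close>, \<open>y' = ga (x\<^bsup>q\<^esup> - y)\<close> at \<open>(1, 1)\<close>, and \<open>(m, m')\<close> is an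
  eigenvector. It is normalised by \<open>m la = al\<close>, the largest value for which the barrier below is still a
  supersolution. For the second component this needs \<open>m' la \<le> ga\<close>, that is \<open>la \<le> - A\<close>; so the characteristic polynomial
  is compared at \<open>- A\<close>, and \<open>A \<le> B\<close>, which for the flux system means \<open>q \<le> p\<close>, gives the right sign.
\<close>
lemma heteroclinic_rate:
  fixes al ga p q A B :: real
  assumes pos: "al > 0" "ga > 0" "p > 0" "q > 0" "p * q > 1"
    and A: "al - p * ga = A" and B: "ga - q * al = B" and AB: "A \<le> B"
  obtains la m m' where "la > 0" "m = al / la" "m' > 0" "(la + al) * m = al * p * m'" "(la + ga) * m' = ga * q * m" "m' * la \<le> ga"
proof -
  let ?f = "\<lambda>x. (x + al) * (x + ga)"
  \<comment> \<open>otherwise \<open>al \<ge> p ga \<ge> p q al\<close>\<close>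
  have A0: "A < 0"
  proof (rule ccontr)
    assume "\<not> A < 0"
    then have "p * ga \<le> al" "q * al \<le> ga" using A B AB by linarith+
    then have "p * (q * al) \<le> al" using pos by (meson mult_left_mono order_trans less_imp_le)
    then show False using pos by (simp add: mult.assoc[symmetric])
  qed
  have f0: "?f 0 < al * ga * (p * q)" using pos by simp
  have "?f (- A) = (p * ga) * (ga - A)" using A by (simp add: algebra_simps)
  moreover have "(p * ga) * (q * al) \<le> (p * ga) * (ga - A)"
    using B AB pos by (intro mult_left_mono) auto
  ultimately have fA: "al * ga * (p * q) \<le> ?f (- A)" by (simp add: algebra_simps)
  obtain la where la: "0 \<le> la" "la \<le> - A" "?f la = al * ga * (p * q)"
  proof -
    have "continuous_on {0..- A} ?f" by (intro continuous_intros)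
    with IVT'[of ?f 0 "al * ga * (p * q)" "- A"] f0 fA A0 have "\<exists>x\<ge>0. x \<le> - A \<and> ?f x = al * ga * (p * q)"
      by simp
    then show ?thesis using that by blast
  qed
  have la0: "la > 0" using la(1,3) f0 by (cases "la = 0") auto
  define m' where "m' = (la + al) / (la * p)"
  have m': "m' > 0" using pos la0 by (simp add: m'_def)
  show ?thesis
  proof (rule that[OF la0 refl m'])
    show "(la + al) * (al / la) = al * p * m'" using pos la0 by (simp add: m'_def field_simps)
    have "(la + ga) * m' = ?f la / (la * p)" by (simp add: m'_def mult.commute)
    also have "\<dots> = ga * q * (al / la)" using la(3) pos la0 by (simp add: field_simps)
    finally show "(la + ga) * m' = ga * q * (al / la)" .
    have "m' * la = (la + al) / p" using la0 by (simp add: m'_def)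
    also have "\<dots> \<le> ga" using la(2) A pos by (simp add: field_simps)
    finally show "m' * la \<le> ga" .
  qed
qed

lemma integral_sub_super:
  fixes F :: "real \<Rightarrow> real"
  assumes r: "r > 0" and F: "continuous_on {0..r} F" "F 0 = 0" "\<And>s. 0 < s \<Longrightarrow> s \<le> r \<Longrightarrow> (F has_real_derivative F' s) (at s)"
    and \<phi>: "continuous_on {0<..r} \<phi>" "\<And>s. 0 < s \<Longrightarrow> s \<le> r \<Longrightarrow> 0 \<le> \<phi> s"
  shows "(\<And>s. 0 < s \<Longrightarrow> s \<le> r \<Longrightarrow> \<phi> s \<le> F' s) \<Longrightarrow> \<phi> integrable_on {0<..r} \<and> integral {0<..r} \<phi> \<le> F r"
    and "(\<And>s. 0 < s \<Longrightarrow> s \<le> r \<Longrightarrow> F' s \<le> \<phi> s) \<Longrightarrow> \<phi> integrable_on {0<..r} \<Longrightarrow> F r \<le> integral {0<..r} \<phi>"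
proof -
  have "(F' has_integral (F r - F 0)) {0..r}"
    by (rule fundamental_theorem_of_calculus_interior)
       (use r F in \<open>auto simp: has_real_derivative_iff_has_vector_derivative[symmetric]\<close>)
  then have F': "F' integrable_on {0<..r}" "integral {0<..r} F' = F r"
    unfolding integrable_on_half_open_iff using F(2) by (auto simp: integral_unique)
  show "\<phi> integrable_on {0<..r} \<and> integral {0<..r} \<phi> \<le> F r" if le: "\<And>s. 0 < s \<Longrightarrow> s \<le> r \<Longrightarrow> \<phi> s \<le> F' s"
  proof
    show i: "\<phi> integrable_on {0<..r}"
      by (rule integrable_on_dominated[OF \<phi>(1) F'(1)]) (use le \<phi>(2) in auto)
    show "integral {0<..r} \<phi> \<le> F r"
      unfolding F'(2)[symmetric] by (rule integral_le[OF i F'(1)]) (use le in auto)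
  qed
  show "F r \<le> integral {0<..r} \<phi>" if "\<And>s. 0 < s \<Longrightarrow> s \<le> r \<Longrightarrow> F' s \<le> \<phi> s" "\<phi> integrable_on {0<..r}"
    unfolding F'(2)[symmetric] by (rule integral_le[OF F'(1) that(2)]) (use that(1) in auto)
qed

lemma exp_le_one_plus_powr:
  fixes s z :: real
  assumes "z > 0" "s \<ge> 0"
  shows "exp (- z * s) \<le> (1 + s) powr (- z)"
proof -
  have "ln (1 + s) \<le> s" by (rule ln_add_one_self_le_self[OF assms(2)])
  then have "- z * s \<le> - z * ln (1 + s)" using assms(1) by simp
  then show ?thesis using assms(2) by (simp add: powr_def)
qed

text \<open>
  One half of the barrier property; the other half follows by exchanging the roles. Put \<open>k = m la / al\<close> and
  \<open>s = r\<^bsup>la\<^esup>\<close>, so \<open>p m' = m + k\<close>. Being a subsolution amounts to \<open>1 - k s \<le> exp (- k s)\<close>. Being a supersolution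
  amounts to \<open>v\<^bsup>k\<^esup> \<le> 1 - k (1 - v)\<close> for \<open>v = 1/(1 + s)\<close>, which is Bernoulli's inequality for exponents
  \<open>k \<le> 1\<close>.
\<close>
lemma heteroclinic_barriers:
  fixes al la m m' p a b ga c :: real
  assumes pos: "al > 0" "la > 0" "m > 0" "m' > 0" "p > 0" "a > 0" "b > 0"
    and mla: "m * la \<le> al" and rel: "(la + al) * m = al * p * m'"
    and ab: "al * a = b powr p" and c: "c + p * ga = al - 1"
  defines "l \<equiv> \<lambda>r. a * r powr al * exp (- m * r powr la)"
    and "h \<equiv> \<lambda>r. a * r powr al * (1 + r powr la) powr (- m)"
    and "l' \<equiv> \<lambda>r. b * r powr ga * exp (- m' * r powr la)"
    and "h' \<equiv> \<lambda>r. b * r powr ga * (1 + r powr la) powr (- m')"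
  assumes r: "r > 0"
  shows "(\<lambda>s. s powr c * h' s powr p) integrable_on {0<..r}"
    and "integral {0<..r} (\<lambda>s. s powr c * h' s powr p) \<le> h r"
    and "l r \<le> integral {0<..r} (\<lambda>s. s powr c * l' s powr p)"
proof -
  define k where "k = m * la / al"
  have k: "0 \<le> k" "k \<le> 1" using pos mla by (auto simp: k_def)
  have pm: "p * m' = m + k" using rel pos by (simp add: k_def field_simps)
  have dl: "(l has_real_derivative a * s powr (al - 1) * exp (- m * s powr la) * (al - m * la * s powr la)) (at s)" if "s > 0" for s
    unfolding l_def using that
    by (auto intro!: derivative_eq_intros simp: powr_diff field_simps)
  have dh: "(h has_real_derivative a * s powr (al - 1) * (1 + s powr la) powr (- m) * (al - m * la * (s powr la / (1 + s powr la)))) (at s)" if "s > 0" for s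
  proof -
    have v: "1 + s powr la > 0" by (simp add: add_pos_nonneg)
    have D: "(h has_real_derivative (a * (al * s powr (al - 1))) * (1 + s powr la) powr (- m)
        + (- m * (1 + s powr la) powr (- m - 1) * (la * s powr (la - 1))) * (a * s powr al)) (at s)"
      unfolding h_def using that v by (auto intro!: derivative_eq_intros)
    have e1: "s powr (la - 1) * s powr al = s powr la * s powr (al - 1)" by (simp add: powr_add[symmetric] algebra_simps)
    have e2: "(1 + s powr la) powr (- m - 1) = (1 + s powr la) powr (- m) / (1 + s powr la)"
      using v by (simp add: powr_diff)
    have "(a * (al * s powr (al - 1))) * (1 + s powr la) powr (- m)
        + (- m * (1 + s powr la) powr (- m - 1) * (la * s powr (la - 1))) * (a * s powr al)
      = a * al * s powr (al - 1) * (1 + s powr la) powr (- m)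
        - m * la * a * (s powr (la - 1) * s powr al) * (1 + s powr la) powr (- m - 1)"
      by (simp add: algebra_simps)
    also have "\<dots> = a * al * s powr (al - 1) * (1 + s powr la) powr (- m)
        - m * la * a * (s powr la * s powr (al - 1)) * ((1 + s powr la) powr (- m) / (1 + s powr la))"
      unfolding e1 e2 ..
    also have "\<dots> = a * s powr (al - 1) * (1 + s powr la) powr (- m) * (al - m * la * (s powr la / (1 + s powr la)))"
      by (simp add: algebra_simps)
    finally show ?thesis using D by simp
  qed
  have base: "s powr c * (b * s powr ga * z) powr p = al * a * s powr (al - 1) * z powr p" if "s > 0" "z > 0" for s z
  proof -
    have "s powr c * (b * s powr ga * z) powr p = b powr p * (s powr c * s powr (p * ga)) * z powr p"
      using pos that by (simp add: powr_mult powr_powr mult_ac)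
    also have "s powr c * s powr (p * ga) = s powr (al - 1)" by (simp add: powr_add[symmetric] c)
    finally show ?thesis by (simp add: ab)
  qed
  have cont: "continuous_on {0..r} l" "continuous_on {0..r} h" "l 0 = 0" "h 0 = 0"
  proof -
    have n: "1 + s powr la \<noteq> 0" for s :: real using powr_ge_zero[of s la] by linarith
    show "continuous_on {0..r} l" unfolding l_def
      by (intro continuous_intros continuous_on_powr_nonneg) (use pos in auto)
    show "continuous_on {0..r} h" unfolding h_def
      by (intro continuous_intros continuous_on_powr_nonneg) (use pos n in auto)
    show "l 0 = 0" "h 0 = 0" by (auto simp: l_def h_def)
  qed
  have v: "1 + s powr la > 0" for s :: real using powr_ge_zero[of s la] by linarith
  have c\<phi>: "continuous_on {0<..r} (\<lambda>s. s powr c * h' s powr p)" "continuous_on {0<..r} (\<lambda>s. s powr c * l' s powr p)"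
    unfolding h'_def l'_def
    by (intro continuous_intros continuous_on_powr_nonneg; use pos v in \<open>auto simp: less_imp_neq[OF v, symmetric]\<close>)+
  have leh: "s powr c * h' s powr p \<le> a * s powr (al - 1) * (1 + s powr la) powr (- m) * (al - m * la * (s powr la / (1 + s powr la)))"
    if s: "s > 0" for s
  proof -
    let ?v = "1 / (1 + s powr la)"
    have v0: "?v > 0" using v[of s] by simp
    have "s powr c * h' s powr p = al * a * s powr (al - 1) * ((1 + s powr la) powr (- m')) powr p"
      unfolding h'_def by (rule base[OF s]) (use v[of s] in simp)
    also have "((1 + s powr la) powr (- m')) powr p = (1 + s powr la) powr (- m) * ?v powr k"
    proof -
      have "((1 + s powr la) powr (- m')) powr p = (1 + s powr la) powr (- m + - k)"
      proof -
        have "- m' * p = - m + - k" using pm by (simp add: mult.commute)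
        then show ?thesis unfolding powr_powr by (rule arg_cong)
      qed
      also have "\<dots> = (1 + s powr la) powr (- m) * (1 + s powr la) powr (- k)" by (rule powr_add)
      also have "(1 + s powr la) powr (- k) = ?v powr k" using v[of s] by (simp add: powr_minus powr_divide inverse_eq_divide)
      finally show ?thesis .
    qed
    also have "al * a * s powr (al - 1) * ((1 + s powr la) powr (- m) * ?v powr k)
        \<le> al * a * s powr (al - 1) * ((1 + s powr la) powr (- m) * (1 - k * (1 - ?v)))"
      using powr_le_affine[OF v0 k] pos by (intro mult_left_mono) auto
    also have "\<dots> = a * s powr (al - 1) * (1 + s powr la) powr (- m) * (al - m * la * (s powr la / (1 + s powr la)))"
    proof -
      have "1 - ?v = s powr la / (1 + s powr la)" using v[of s] by (simp add: field_simps)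
      moreover have "k * al = m * la" using pos by (simp add: k_def)
      moreover have "al * (1 - k * (1 - ?v)) = al - (k * al) * (1 - ?v)" by algebra
      ultimately have E: "al * (1 - k * (1 - ?v)) = al - m * la * (s powr la / (1 + s powr la))" by simp
      show ?thesis unfolding E[symmetric] by (simp only: mult_ac)
    qed
    finally show ?thesis .
  qed
  have lel: "a * s powr (al - 1) * exp (- m * s powr la) * (al - m * la * s powr la) \<le> s powr c * l' s powr p" if s: "s > 0" for s
  proof -
    have "al * (1 - k * s powr la) \<le> al * exp (- k * s powr la)"
      using exp_ge_add_one_self[of "- k * s powr la"] pos by (intro mult_left_mono) auto
    moreover have "al * (1 - k * s powr la) = al - m * la * s powr la" using pos by (simp add: k_def field_simps)
    ultimately have "a * s powr (al - 1) * exp (- m * s powr la) * (al - m * la * s powr la)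
        \<le> a * s powr (al - 1) * exp (- m * s powr la) * (al * exp (- k * s powr la))"
      using pos by (intro mult_left_mono) auto
    also have "\<dots> = al * a * s powr (al - 1) * exp (- m' * s powr la) powr p"
    proof -
      have "exp (- m' * s powr la) powr p = exp (- (p * m') * s powr la)" by (simp add: exp_powr_real mult_ac)
      also have "\<dots> = exp (- m * s powr la) * exp (- k * s powr la)" unfolding pm by (simp add: exp_add[symmetric] algebra_simps)
      finally show ?thesis by (simp add: mult_ac)
    qed
    also have "\<dots> = s powr c * l' s powr p"
      unfolding l'_def by (rule base[OF s, symmetric]) simp
    finally show ?thesis .
  qed
  have upper: "(\<lambda>s. s powr c * h' s powr p) integrable_on {0<..r} \<and> integral {0<..r} (\<lambda>s. s powr c * h' s powr p) \<le> h r"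
    by (rule integral_sub_super(1)[OF r cont(2,4) dh c\<phi>(1) _ leh]) auto
  then show "(\<lambda>s. s powr c * h' s powr p) integrable_on {0<..r}" "integral {0<..r} (\<lambda>s. s powr c * h' s powr p) \<le> h r"
    by auto
  have lh': "l' s \<le> h' s" if "s > 0" for s
  proof -
    have "exp (- m' * s powr la) \<le> (1 + s powr la) powr (- m')"
      using pos by (intro exp_le_one_plus_powr) auto
    then show ?thesis unfolding l'_def h'_def using pos by (intro mult_left_mono) auto
  qed
  have "(\<lambda>s. s powr c * l' s powr p) integrable_on {0<..r}"
  proof (rule integrable_on_dominated[OF c\<phi>(2) conjunct1[OF upper]])
    fix s assume "s \<in> {0<..r}"
    then have s: "s > 0" by simp
    have "l' s powr p \<le> h' s powr p" using lh'[OF s] pos by (intro powr_mono2) (auto simp: l'_def)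
    then show "\<bar>s powr c * l' s powr p\<bar> \<le> s powr c * h' s powr p" by (simp add: abs_mult mult_left_mono)
  qed
  then show "l r \<le> integral {0<..r} (\<lambda>s. s powr c * l' s powr p)"
    by (intro integral_sub_super(2)[OF r cont(1,3) dl c\<phi>(2) _ lel]) auto
qed

text \<open>
  Both barriers divided by the power solution tend to \<open>1\<close> at \<open>0\<close>, and \<open>a r\<^bsup>al\<^esup> (1 + r\<^bsup>la\<^esup>)\<^bsup>-al/la\<^esup> \<le> a\<close> bounds the first
  flux.
\<close>
lemma heteroclinic_flux_exists:
  fixes n p q al ga a b :: real
  assumes pos: "al > 0" "ga > 0" "p > 0" "q > 0" "p * q > 1" "q \<le> p" "a > 0" "b > 0" "n > 1"
    and A: "al - p * ga = n - (n - 1) * p" and B: "ga - q * al = n - (n - 1) * q"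
    and ab: "al * a = b powr p" "ga * b = a powr q"
  obtains w1 w2 where "flux_system {0<..} n p q w1 w2"
    "\<And>r. r > 0 \<Longrightarrow> 0 < w1 r \<and> w1 r \<le> a" "\<And>r. r > 0 \<Longrightarrow> 0 < w2 r"
    "((\<lambda>r. w1 r / (a * r powr al)) \<longlongrightarrow> 1) (at_right 0)"
    "((\<lambda>r. w2 r / (b * r powr ga)) \<longlongrightarrow> 1) (at_right 0)"
proof -
  have AB: "n - (n - 1) * p \<le> n - (n - 1) * q" using pos by simp
  obtain la m m' where la: "la > 0" "m = al / la" "m' > 0" and rel: "(la + al) * m = al * p * m'" "(la + ga) * m' = ga * q * m"
    and m'la: "m' * la \<le> ga"
    by (rule heteroclinic_rate[OF pos(1-5) A B AB]) blast
  have m: "m > 0" "m * la \<le> al" using la pos by auto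
  have c: "(n - 1) * (1 - p) + p * ga = al - 1" "(n - 1) * (1 - q) + q * al = ga - 1"
    using A B by (auto simp: algebra_simps)
  define l1 where "l1 r = a * r powr al * exp (- m * r powr la)" for r
  define h1 where "h1 r = a * r powr al * (1 + r powr la) powr (- m)" for r
  define l2 where "l2 r = b * r powr ga * exp (- m' * r powr la)" for r
  define h2 where "h2 r = b * r powr ga * (1 + r powr la) powr (- m')" for r
  note b1 = heteroclinic_barriers[OF pos(1) la(1) m(1) la(3) pos(3,7,8) m(2) rel(1) ab(1) c(1), folded l1_def h1_def l2_def h2_def]
  note b2 = heteroclinic_barriers[OF pos(2) la(1,3) m(1) pos(4,8,7) m'la rel(2) ab(2) c(2), folded l1_def h1_def l2_def h2_def]
  have v: "1 + s powr la > 0" for s :: real using powr_ge_zero[of s la] by linarith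
  have expv: "exp (- z * s powr la) \<le> (1 + s powr la) powr (- z)" if "z > 0" for s z :: real
    using that by (intro exp_le_one_plus_powr) auto
  have "\<exists>w1 w2. \<forall>r\<in>{0<..}. l1 r \<le> w1 r \<and> w1 r \<le> h1 r \<and> l2 r \<le> w2 r \<and> w2 r \<le> h2 r \<and>
     (w1 has_real_derivative r powr ((n - 1) * (1 - p)) * w2 r powr p) (at r) \<and>
     (w2 has_real_derivative r powr ((n - 1) * (1 - q)) * w1 r powr q) (at r) \<and>
     0 \<le> w1 r \<and> 0 \<le> w2 r \<and>
     w1 r \<le> 0 + integral {0<..r} (\<lambda>s. s powr ((n - 1) * (1 - p)) * h2 s powr p) \<and>
     w2 r \<le> 0 + integral {0<..r} (\<lambda>s. s powr ((n - 1) * (1 - q)) * h1 s powr q)"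
  proof (rule monotone_iteration[where I = "{0<..}"])
    show "continuous_on {0<..} (\<lambda>s::real. s powr ((n - 1) * (1 - p)))" "continuous_on {0<..} (\<lambda>s::real. s powr ((n - 1) * (1 - q)))"
      by (auto intro!: continuous_intros)
    show "continuous_on {0<..} l1" "continuous_on {0<..} l2"
      unfolding l1_def[abs_def] l2_def[abs_def] by (auto intro!: continuous_intros)
    show "l1 r \<le> h1 r" "l2 r \<le> h2 r" for r
      unfolding l1_def h1_def l2_def h2_def using pos expv m(1) la(3) by (auto intro!: mult_left_mono)
    show "0 \<le> l1 r" "0 \<le> l2 r" for r using pos by (auto simp: l1_def l2_def)
  qed (use pos b1 b2 in auto)
  then obtain w1 w2 where w: "\<And>r. r > 0 \<Longrightarrow> l1 r \<le> w1 r \<and> w1 r \<le> h1 r \<and> l2 r \<le> w2 r \<and> w2 r \<le> h2 r"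
    "\<And>r. r > 0 \<Longrightarrow> (w1 has_real_derivative r powr ((n - 1) * (1 - p)) * w2 r powr p) (at r)"
    "\<And>r. r > 0 \<Longrightarrow> (w2 has_real_derivative r powr ((n - 1) * (1 - q)) * w1 r powr q) (at r)"
    by (simp add: Ball_def) blast
  have lpos: "l1 r > 0" "l2 r > 0" if "r > 0" for r using pos that by (auto simp: l1_def l2_def)
  have wpos: "w1 r > 0" "w2 r > 0" if "r > 0" for r
    using lpos[OF that] w(1)[OF that] by linarith+
  note la0 = powr_tendsto_0_at_right_0[OF la(1)]
  have lim: "((\<lambda>r. w r / (x * r powr y)) \<longlongrightarrow> 1) (at_right 0)"
    if x: "x > 0" and b: "\<And>r. r > 0 \<Longrightarrow> x * r powr y * exp (- z * r powr la) \<le> w r \<and> w r \<le> x * r powr y * (1 + r powr la) powr (- z)"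
    for w x y z
  proof (rule tendsto_sandwich[of "\<lambda>r. exp (- z * r powr la)" _ _ "\<lambda>r. (1 + r powr la) powr (- z)"])
    have ev: "eventually (\<lambda>r::real. r > 0) (at_right 0)" by (rule eventually_at_right_less)
    have "exp (- z * r powr la) \<le> w r / (x * r powr y)" "w r / (x * r powr y) \<le> (1 + r powr la) powr (- z)" if "r > 0" for r
      using b[OF that] x that by (auto simp: field_simps)
    then show "eventually (\<lambda>r. exp (- z * r powr la) \<le> w r / (x * r powr y)) (at_right 0)"
      "eventually (\<lambda>r. w r / (x * r powr y) \<le> (1 + r powr la) powr (- z)) (at_right 0)"
      using ev by (auto elim!: eventually_mono)
    have "((\<lambda>r. exp (- z * r powr la)) \<longlongrightarrow> exp (- z * 0)) (at_right 0)" by (intro tendsto_intros la0)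
    then show "((\<lambda>r. exp (- z * r powr la)) \<longlongrightarrow> 1) (at_right 0)" by simp
    have "((\<lambda>r. (1 + r powr la) powr (- z)) \<longlongrightarrow> (1 + 0) powr (- z)) (at_right 0)" by (intro tendsto_intros la0) simp
    then show "((\<lambda>r. (1 + r powr la) powr (- z)) \<longlongrightarrow> 1) (at_right 0)" by simp
  qed
  show ?thesis
  proof (rule that[of w1 w2])
    show "flux_system {0<..} n p q w1 w2"
      unfolding flux_system_def using w(2,3) wpos by (auto intro: less_imp_le)
    show "0 < w1 r \<and> w1 r \<le> a" if r: "r > 0" for r
    proof -
      have "r powr al * (1 + r powr la) powr (- m) = (r powr la / (1 + r powr la)) powr m"
        using r la v[of r] by (simp add: powr_divide powr_powr powr_minus field_simps)
      also have "\<dots> \<le> 1 powr m" using m(1) v[of r] by (intro powr_mono2) auto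
      finally have "r powr al * (1 + r powr la) powr (- m) \<le> 1" by simp
      then have "h1 r \<le> a" using pos unfolding h1_def by (simp add: mult.assoc mult_left_le)
      then show ?thesis using wpos[OF r] w(1)[OF r] by linarith
    qed
    show "0 < w2 r" if "r > 0" for r by (rule wpos(2)[OF that])
    show "((\<lambda>r. w1 r / (a * r powr al)) \<longlongrightarrow> 1) (at_right 0)"
      by (rule lim[where z = m]) (use pos w(1) in \<open>auto simp: l1_def h1_def\<close>)
    show "((\<lambda>r. w2 r / (b * r powr ga)) \<longlongrightarrow> 1) (at_right 0)"
      by (rule lim[where z = m']) (use pos w(1) in \<open>auto simp: l2_def h2_def\<close>)
  qed
qed

section \<open>Profiles with given flux and their asymptotics\<close>

lemma antimono_bounded_tendsto_at_top:
  fixes F :: "real \<Rightarrow> real"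
  assumes mono: "\<And>s t. T \<le> s \<Longrightarrow> s \<le> t \<Longrightarrow> F t \<le> F s" and bd: "\<And>t. T \<le> t \<Longrightarrow> m \<le> F t"
  obtains L where "(F \<longlongrightarrow> L) at_top" "\<And>t. T \<le> t \<Longrightarrow> L \<le> F t"
proof -
  define L where "L = Inf (F ` {T..})"
  have bb: "bdd_below (F ` {T..})" using bd by (intro bdd_belowI[of _ m]) auto
  have L: "L \<le> F t" if "T \<le> t" for t
    unfolding L_def by (rule cInf_lower[OF _ bb]) (use that in auto)
  have "(F \<longlongrightarrow> L) at_top"
  proof (rule order_tendstoI)
    fix a assume "a < L"
    then show "eventually (\<lambda>t. a < F t) at_top"
      using L by (intro eventually_mono[OF eventually_ge_at_top[of T]]) (auto intro: less_le_trans)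
  next
    fix a assume "L < a"
    then obtain s where s: "T \<le> s" "F s < a" unfolding L_def
      using cInf_lessD[of "F ` {T..}" a] by auto
    then show "eventually (\<lambda>t. F t < a) at_top"
      using mono by (intro eventually_mono[OF eventually_ge_at_top[of s]]) (auto intro: le_less_trans)
  qed
  then show ?thesis using that L by blast
qed

lemma mono_bounded_tendsto_at_top:
  fixes F :: "real \<Rightarrow> real"
  assumes mono: "\<And>s t. T \<le> s \<Longrightarrow> s \<le> t \<Longrightarrow> F s \<le> F t" and bd: "\<And>t. T \<le> t \<Longrightarrow> F t \<le> m"
  obtains L where "(F \<longlongrightarrow> L) at_top" "\<And>t. T \<le> t \<Longrightarrow> F t \<le> L"
proof -
  obtain L where L: "((\<lambda>t. - F t) \<longlongrightarrow> L) at_top" "\<And>t. T \<le> t \<Longrightarrow> L \<le> - F t"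
    using antimono_bounded_tendsto_at_top[of T "\<lambda>t. - F t" "- m"] mono bd by auto
  show ?thesis
  proof (rule that[of "- L"])
    show "(F \<longlongrightarrow> - L) at_top" using tendsto_minus[OF L(1)] by simp
    show "F t \<le> - L" if "T \<le> t" for t using L(2)[OF that] by simp
  qed
qed

lemma flux_profile_shift:
  "flux_profile I n w F \<Longrightarrow> flux_profile I n w (\<lambda>r. F r + c)"
  unfolding flux_profile_def by (auto intro!: derivative_eq_intros)

text \<open>
  The profile that vanishes at infinity. It exists because \<open>F - (K/d) r\<^bsup>-d\<^esup>\<close> is nondecreasing for \<open>r \<ge> 1\<close>, which bounds the
  nonincreasing function \<open>F\<close> from below.
\<close>
lemma flux_profile_tail_exists:
  fixes w :: "real \<Rightarrow> real"
  assumes w: "continuous_on {0<..} w" "\<And>r. r > 0 \<Longrightarrow> 0 \<le> w r" "\<And>r. r \<ge> 1 \<Longrightarrow> w r \<le> K * r powr s" and s: "s < n - 2"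
  obtains f where "flux_profile {0<..} n w f" "(f \<longlongrightarrow> 0) at_top" "\<And>r. r > 0 \<Longrightarrow> 0 \<le> f r"
proof -
  have set: "{r. 0 < r \<and> ereal r < \<infinity>} = {0<..}" by auto
  obtain F where F: "flux_profile {0<..} n w F"
    using flux_profile_exists[of \<infinity> w n] w(1) unfolding set by auto
  define d where "d = n - 2 - s"
  have d: "d > 0" using s by (simp add: d_def)
  have anti: "F t \<le> F r" if "0 < r" "r \<le> t" for r t
    by (rule flux_profile_antimono[OF F _ _ that(2)]) (use that w in auto)
  have K: "K \<ge> 0" using w(2,3)[of 1] by simp
  have lower: "F 1 - K / d \<le> F t" if "1 \<le> t" for t
  proof -
    have "F 1 - K / d * 1 powr (- d) \<le> F t - K / d * t powr (- d)"
    proof (rule DERIV_nonneg_imp_nondecreasing[OF that])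
      fix r :: real assume r: "1 \<le> r" "r \<le> t"
      have "((\<lambda>r. F r - K / d * r powr (- d)) has_real_derivative
         - (r powr (1 - n) * w r) - K / d * (- d * r powr (- d - 1))) (at r)"
        using F r unfolding flux_profile_def by (auto intro!: derivative_eq_intros)
      moreover have "- (r powr (1 - n) * w r) - K / d * (- d * r powr (- d - 1)) \<ge> 0"
      proof -
        have "r powr (1 - n) * w r \<le> r powr (1 - n) * (K * r powr s)"
          using w(3)[OF r(1)] by (intro mult_left_mono) auto
        also have "\<dots> = K * r powr (- d - 1)" by (simp add: powr_add[symmetric] d_def algebra_simps)
        finally show ?thesis using d by simp
      qed
      ultimately show "\<exists>y. ((\<lambda>r. F r - K / d * r powr (- d)) has_real_derivative y) (at r) \<and> 0 \<le> y" by blast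
    qed
    moreover have "K / d * t powr (- d) \<ge> 0" using K d by simp
    ultimately show ?thesis by simp
  qed
  obtain L where L: "(F \<longlongrightarrow> L) at_top" "\<And>t. 1 \<le> t \<Longrightarrow> L \<le> F t"
    using antimono_bounded_tendsto_at_top[of 1 F "F 1 - K / d"] anti lower by auto
  have L': "L \<le> F t" if "t > 0" for t
    using L(2)[of "max 1 t"] anti[OF that, of "max 1 t"] by simp
  show ?thesis
  proof (rule that[of "\<lambda>r. F r + (- L)"])
    show "flux_profile {0<..} n w (\<lambda>r. F r + (- L))" using F by (rule flux_profile_shift)
    show "((\<lambda>r. F r + (- L)) \<longlongrightarrow> 0) at_top" using tendsto_add[OF L(1) tendsto_const[of "- L"]] by simp
  qed (use L' in auto)
qed

text \<open>
  The substitution \<open>y = 1/r\<close> moves infinity to \<open>0\<close>, where l'Hospital's rule for \<open>0/0\<close> applies.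
\<close>
lemma flux_profile_tail_asymptotics:
  assumes f: "flux_profile {0<..} n w f" "(f \<longlongrightarrow> 0) at_top" and s: "s < n - 2"
    and w: "((\<lambda>r. w r / r powr s) \<longlongrightarrow> L) at_top"
  shows "((\<lambda>r. r powr (n - 2 - s) * f r) \<longlongrightarrow> L / (n - 2 - s)) at_top"
proof -
  define d where "d = n - 2 - s"
  have d: "d > 0" using s by (simp add: d_def)
  have pos: "eventually (\<lambda>y::real. y > 0) (at_right 0)" by (rule eventually_at_right_less)
  have "((\<lambda>y. f (inverse y) / y powr d) \<longlongrightarrow> L / d) (at_right 0)"
  proof (rule lhopital_right_0[where f' = "\<lambda>y. inverse y powr (1 - n) * w (inverse y) / y\<^sup>2" and g' = "\<lambda>y. d * y powr (d - 1)"])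
    show "((\<lambda>y. f (inverse y)) \<longlongrightarrow> 0) (at_right 0)"
      using f(2) by (simp add: filterlim_at_right_to_top)
    show "((\<lambda>y::real. y powr d) \<longlongrightarrow> 0) (at_right 0)" using d by (rule powr_tendsto_0_at_right_0)
    show "eventually (\<lambda>y. y powr d \<noteq> 0) (at_right 0)" "eventually (\<lambda>y. d * y powr (d - 1) \<noteq> 0) (at_right 0)"
      using pos d by (auto elim!: eventually_mono)
    show "eventually (\<lambda>y. ((\<lambda>y. f (inverse y)) has_real_derivative inverse y powr (1 - n) * w (inverse y) / y\<^sup>2) (at y)) (at_right 0)"
      using pos
    proof eventually_elim
      case (elim y)
      have "(f has_real_derivative - (inverse y powr (1 - n) * w (inverse y))) (at (inverse y))"
        using f(1) elim unfolding flux_profile_def by auto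
      from DERIV_chain2[OF this DERIV_inverse] elim
      show ?case by (simp add: power2_eq_square divide_inverse power_inverse)
    qed
    show "eventually (\<lambda>y. ((\<lambda>y. y powr d) has_real_derivative d * y powr (d - 1)) (at y)) (at_right 0)"
      using pos by eventually_elim (auto intro!: derivative_eq_intros)
    have "((\<lambda>y. w (inverse y) / inverse y powr s / d) \<longlongrightarrow> L / d) (at_right 0)"
      using w d by (intro tendsto_divide tendsto_const) (auto simp: filterlim_at_right_to_top)
    then show "((\<lambda>y. inverse y powr (1 - n) * w (inverse y) / y\<^sup>2 / (d * y powr (d - 1))) \<longlongrightarrow> L / d) (at_right 0)"
    proof (rule Lim_transform_eventually)
      show "eventually (\<lambda>y. w (inverse y) / inverse y powr s / d = inverse y powr (1 - n) * w (inverse y) / y\<^sup>2 / (d * y powr (d - 1))) (at_right 0)"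
        using pos
      proof eventually_elim
        case (elim y)
        have i: "inverse y powr z = y powr (- z)" for z
          using elim by (simp add: powr_minus inverse_powr)
        have Y2: "y\<^sup>2 = y powr 2" using elim by (simp add: powr_numeral)
        have "inverse y powr (1 - n) / y\<^sup>2 / y powr (d - 1) = y powr (n - 1 - 2 - (d - 1))"
          unfolding i Y2 by (simp only: powr_diff[symmetric] minus_diff_eq)
        also have "n - 1 - 2 - (d - 1) = s" by (simp add: d_def)
        also have "y powr s = 1 / inverse y powr s" using elim unfolding i by (simp add: powr_minus field_simps)
        finally have E: "inverse y powr (1 - n) / y\<^sup>2 / y powr (d - 1) = 1 / inverse y powr s" .
        have "inverse y powr (1 - n) * w (inverse y) / y\<^sup>2 / (d * y powr (d - 1))
            = (inverse y powr (1 - n) / y\<^sup>2 / y powr (d - 1)) * w (inverse y) / d" by simp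
        then show ?case unfolding E by simp
      qed
    qed
  qed
  then have "((\<lambda>r. f r / inverse r powr d) \<longlongrightarrow> L / d) at_top"
    by (simp add: filterlim_at_right_to_top)
  then show ?thesis unfolding d_def[symmetric]
  proof (rule Lim_transform_eventually)
    show "eventually (\<lambda>r. f r / inverse r powr d = r powr d * f r) at_top"
      using eventually_gt_at_top[of "0::real"]
      by eventually_elim (simp add: inverse_powr[symmetric] powr_minus divide_inverse mult.commute)
  qed
qed

lemma flux_profile_singular_asymptotics:
  assumes f: "flux_profile {0<..} n w f" and a: "a > 0" and e: "e < 0"
    and w: "((\<lambda>r. w r / (a * r powr (n - 2 + e))) \<longlongrightarrow> 1) (at_right 0)"
  shows "((\<lambda>r. f r / (a / \<bar>e\<bar> * r powr e)) \<longlongrightarrow> 1) (at_right 0)"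
proof (rule lhopital_right_0_at_top[where f' = "\<lambda>r. - (r powr (1 - n) * w r)" and g' = "\<lambda>r. - a * r powr (e - 1)"])
  have pos: "eventually (\<lambda>y::real. y > 0) (at_right 0)" by (rule eventually_at_right_less)
  show "filterlim (\<lambda>r. a / \<bar>e\<bar> * r powr e) at_top (at_right 0)"
  proof (rule filterlim_tendsto_pos_mult_at_top[OF tendsto_const _ powr_neg_at_right_0[OF e]])
    show "a / \<bar>e\<bar> > 0" using a e by (intro divide_pos_pos) auto
  qed
  show "eventually (\<lambda>r. - a * r powr (e - 1) \<noteq> 0) (at_right 0)"
    using pos a by (auto elim!: eventually_mono)
  show "eventually (\<lambda>r. (f has_real_derivative - (r powr (1 - n) * w r)) (at r)) (at_right 0)"
    using pos f unfolding flux_profile_def by (auto elim!: eventually_mono)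
  show "eventually (\<lambda>r. ((\<lambda>r. a / \<bar>e\<bar> * r powr e) has_real_derivative - a * r powr (e - 1)) (at r)) (at_right 0)"
    using pos
  proof eventually_elim
    case (elim r)
    have "((\<lambda>r. a / \<bar>e\<bar> * r powr e) has_real_derivative a / \<bar>e\<bar> * (e * r powr (e - 1))) (at r)"
      by (rule DERIV_cmult[OF has_real_derivative_powr[OF elim]])
    then show ?case using e by simp
  qed
  show "((\<lambda>r. - (r powr (1 - n) * w r) / (- a * r powr (e - 1))) \<longlongrightarrow> 1) (at_right 0)"
    using w
  proof (rule Lim_transform_eventually)
    show "eventually (\<lambda>r. w r / (a * r powr (n - 2 + e)) = - (r powr (1 - n) * w r) / (- a * r powr (e - 1))) (at_right 0)"
      using pos
    proof eventually_elim
      case (elim r)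
      have "r powr (e - 1) = r powr (1 - n) * r powr (n - 2 + e)" by (simp add: powr_add[symmetric])
      then show ?case using elim by simp
    qed
  qed
qed

text \<open>
  The bound \<open>w \<le> 2 a r\<^bsup>n-2+e\<^esup>\<close> near \<open>0\<close> makes \<open>f + (2 a/e) r\<^bsup>e\<^esup>\<close> nondecreasing there, so \<open>f\<close> is bounded and, being
  monotone, has a limit.
\<close>
lemma flux_profile_cusp_asymptotics:
  assumes f: "flux_profile {0<..} n w f" and a: "a > 0" and e: "e > 0"
    and w: "((\<lambda>r. w r / (a * r powr (n - 2 + e))) \<longlongrightarrow> 1) (at_right 0)" "\<And>r. r > 0 \<Longrightarrow> 0 \<le> w r"
  obtains k where "(f \<longlongrightarrow> k) (at_right 0)" "((\<lambda>r. (k - f r) / (a / \<bar>e\<bar> * r powr e)) \<longlongrightarrow> 1) (at_right 0)"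
proof -
  have pos: "eventually (\<lambda>y::real. y > 0) (at_right 0)" by (rule eventually_at_right_less)
  have anti: "f t \<le> f r" if "0 < r" "r \<le> t" for r t
    by (rule flux_profile_antimono[OF f _ _ that(2)]) (use that w in auto)
  have "eventually (\<lambda>r. w r / (a * r powr (n - 2 + e)) < 2) (at_right 0)"
    using w(1) by (rule order_tendstoD) simp
  then obtain r0 where r0: "r0 > 0" "\<And>r. 0 < r \<Longrightarrow> r < r0 \<Longrightarrow> w r / (a * r powr (n - 2 + e)) < 2"
    unfolding eventually_at_right_field by auto
  define r1 where "r1 = r0 / 2"
  have r1: "r1 > 0" "r1 < r0" using r0(1) by (auto simp: r1_def)
  define M where "M = f r1 + 2 * a / e * r1 powr e"
  have fM: "f r \<le> M" if r: "0 < r" "r \<le> r1" for r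
  proof -
    have "f r + 2 * a / e * r powr e \<le> f r1 + 2 * a / e * r1 powr e"
    proof (rule DERIV_nonneg_imp_nondecreasing[OF r(2)])
      fix t assume t: "r \<le> t" "t \<le> r1"
      then have t0: "t > 0" "t < r0" using r r1 by auto
      have "((\<lambda>r. f r + 2 * a / e * r powr e) has_real_derivative - (t powr (1 - n) * w t) + 2 * a / e * (e * t powr (e - 1))) (at t)"
        using f t0 unfolding flux_profile_def by (auto intro!: derivative_eq_intros)
      moreover have "- (t powr (1 - n) * w t) + 2 * a / e * (e * t powr (e - 1)) \<ge> 0"
      proof -
        have "w t \<le> 2 * (a * t powr (n - 2 + e))" using r0(2)[OF t0] a t0 by (simp add: divide_less_eq)
        then have "t powr (1 - n) * w t \<le> t powr (1 - n) * (2 * (a * t powr (n - 2 + e)))" by (intro mult_left_mono) auto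
        also have "\<dots> = 2 * a * (t powr (1 - n) * t powr (n - 2 + e))" by simp
        also have "t powr (1 - n) * t powr (n - 2 + e) = t powr (e - 1)" by (simp add: powr_add[symmetric])
        finally show ?thesis using e by simp
      qed
      ultimately show "\<exists>y. ((\<lambda>r. f r + 2 * a / e * r powr e) has_real_derivative y) (at t) \<and> 0 \<le> y" by blast
    qed
    moreover have "2 * a / e * r powr e \<ge> 0" using a e by simp
    ultimately show ?thesis by (simp add: M_def)
  qed
  have fM': "f r \<le> M" if "0 < r" for r
  proof (cases "r \<le> r1")
    case True
    then show ?thesis using fM that by simp
  next
    case False
    then show ?thesis using fM[of r1] anti[of r1 r] r1 by simp
  qed
  obtain k where "((\<lambda>y. f (inverse y)) \<longlongrightarrow> k) at_top"
  proof (rule mono_bounded_tendsto_at_top[of 1 "\<lambda>y. f (inverse y)" M])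
    show "f (inverse s) \<le> f (inverse t)" if "1 \<le> s" "s \<le> t" for s t
      by (rule anti) (use that in auto)
    show "f (inverse t) \<le> M" if "1 \<le> t" for t by (rule fM') (use that in auto)
  qed blast
  then have k: "(f \<longlongrightarrow> k) (at_right 0)" by (simp add: filterlim_at_right_to_top)
  have "((\<lambda>r. (k - f r) / (a / \<bar>e\<bar> * r powr e)) \<longlongrightarrow> 1) (at_right 0)"
  proof (rule lhopital_right_0[where f' = "\<lambda>r. r powr (1 - n) * w r" and g' = "\<lambda>r. a * r powr (e - 1)"])
    show "((\<lambda>r. k - f r) \<longlongrightarrow> 0) (at_right 0)" using tendsto_diff[OF tendsto_const k, of k] by simp
    from tendsto_mult[OF tendsto_const powr_tendsto_0_at_right_0[OF e], of "a / \<bar>e\<bar>"]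
    show "((\<lambda>r. a / \<bar>e\<bar> * r powr e) \<longlongrightarrow> 0) (at_right 0)" by simp
    show "eventually (\<lambda>r. a / \<bar>e\<bar> * r powr e \<noteq> 0) (at_right 0)" "eventually (\<lambda>r. a * r powr (e - 1) \<noteq> 0) (at_right 0)"
      using pos a e by (auto elim!: eventually_mono)
    show "eventually (\<lambda>r. ((\<lambda>r. k - f r) has_real_derivative r powr (1 - n) * w r) (at r)) (at_right 0)"
      using pos
    proof eventually_elim
      case (elim r)
      have "(f has_real_derivative - (r powr (1 - n) * w r)) (at r)"
        using f elim unfolding flux_profile_def by auto
      from DERIV_diff[OF DERIV_const[of k] this] show ?case by simp
    qed
    show "eventually (\<lambda>r. ((\<lambda>r. a / \<bar>e\<bar> * r powr e) has_real_derivative a * r powr (e - 1)) (at r)) (at_right 0)"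
      using pos
    proof eventually_elim
      case (elim r)
      have "((\<lambda>r. a / \<bar>e\<bar> * r powr e) has_real_derivative a / \<bar>e\<bar> * (e * r powr (e - 1))) (at r)"
        by (rule DERIV_cmult[OF has_real_derivative_powr[OF elim]])
      then show ?case using e by simp
    qed
    show "((\<lambda>r. r powr (1 - n) * w r / (a * r powr (e - 1))) \<longlongrightarrow> 1) (at_right 0)"
      using w(1)
    proof (rule Lim_transform_eventually)
      show "eventually (\<lambda>r. w r / (a * r powr (n - 2 + e)) = r powr (1 - n) * w r / (a * r powr (e - 1))) (at_right 0)"
        using pos
      proof eventually_elim
        case (elim r)
        have "r powr (e - 1) = r powr (1 - n) * r powr (n - 2 + e)" by (simp add: powr_add[symmetric])
        then show ?case using elim by simp
      qed
    qed
  qed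
  with k show ?thesis by (rule that)
qed

lemma flux_profile_derivative_blowup:
  assumes f: "flux_profile {0<..} n w f" and a: "a > 0" and e: "e < 1"
    and w: "((\<lambda>r. w r / (a * r powr (n - 2 + e))) \<longlongrightarrow> 1) (at_right 0)"
  shows "filterlim (\<lambda>r. \<bar>deriv f r\<bar>) at_top (at_right 0)"
proof -
  have pos: "eventually (\<lambda>y::real. y > 0) (at_right 0)" by (rule eventually_at_right_less)
  have "((\<lambda>r. \<bar>w r / (a * r powr (n - 2 + e))\<bar> * a) \<longlongrightarrow> \<bar>1\<bar> * a) (at_right 0)"
    by (intro tendsto_intros w)
  then have "filterlim (\<lambda>r. \<bar>w r / (a * r powr (n - 2 + e))\<bar> * a * r powr (e - 1)) at_top (at_right 0)"
    by (rule filterlim_tendsto_pos_mult_at_top) (use a e in \<open>auto intro!: powr_neg_at_right_0\<close>)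
  then show ?thesis
  proof (rule filterlim_cong[THEN iffD1, OF refl refl, rotated])
    show "eventually (\<lambda>r. \<bar>w r / (a * r powr (n - 2 + e))\<bar> * a * r powr (e - 1) = \<bar>deriv f r\<bar>) (at_right 0)"
      using pos
    proof eventually_elim
      case (elim r)
      have "deriv f r = - (r powr (1 - n) * w r)"
        by (rule DERIV_imp_deriv) (use f elim in \<open>auto simp: flux_profile_def\<close>)
      moreover have "r powr (e - 1) = r powr (1 - n) * r powr (n - 2 + e)" by (simp add: powr_add[symmetric])
      ultimately show ?case using elim a by (simp add: abs_mult)
    qed
  qed
qed

section \<open>Bounded orbits of the planar system\<close>

lemma constant_sign_of_nonvanishing:
  fixes f :: "real \<Rightarrow> real"
  assumes "continuous_on UNIV f" "\<And>t. t \<le> T \<Longrightarrow> f t \<noteq> 0"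
  shows "(\<forall>t\<le>T. 0 \<le> f t) \<or> (\<forall>t\<le>T. f t \<le> 0)"
proof (rule ccontr)
  assume "\<not> ?thesis"
  then obtain s t where st: "s \<le> T" "f s < 0" "t \<le> T" "f t > 0" by (auto simp: not_le)
  have "connected (f ` {..T})"
    by (intro connected_continuous_image continuous_on_subset[OF assms(1)]) auto
  then have "0 \<in> f ` {..T}"
    using connected_contains_Icc[of "f ` {..T}" "f s" "f t"] st by fastforce
  then show False using assms(2) by auto
qed

text \<open>
  The product \<open>X Y\<close> is nondecreasing, since its derivative is \<open>c\<^sub>1 Y\<^sup>2 + c\<^sub>2 X\<^sup>2\<close>. If it is ever negative, it was negative
  before, so neither factor vanished before. If it is always nonnegative, then \<open>X\<^sup>2\<close> and \<open>Y\<^sup>2\<close> are nondecreasing, so a zero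
  of a factor persists backwards.
\<close>
lemma cooperative_eventual_sign:
  fixes X Y c1 c2 :: "real \<Rightarrow> real"
  assumes X: "\<And>t. (X has_real_derivative c1 t * Y t) (at t)" and Y: "\<And>t. (Y has_real_derivative c2 t * X t) (at t)"
    and c: "\<And>t. 0 \<le> c1 t" "\<And>t. 0 \<le> c2 t"
  obtains T where "(\<forall>t\<le>T. 0 \<le> X t) \<or> (\<forall>t\<le>T. X t \<le> 0)" "(\<forall>t\<le>T. 0 \<le> Y t) \<or> (\<forall>t\<le>T. Y t \<le> 0)"
proof -
  have cX: "continuous_on UNIV X" and cY: "continuous_on UNIV Y"
    by (auto intro!: continuous_at_imp_continuous_on DERIV_isCont X Y)
  have mZ: "X s * Y s \<le> X t * Y t" if "s \<le> t" for s t
  proof (rule DERIV_nonneg_imp_nondecreasing[OF that])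
    fix u
    have "((\<lambda>t. X t * Y t) has_real_derivative c1 u * Y u * Y u + c2 u * X u * X u) (at u)"
      using DERIV_mult[OF X Y] by simp
    moreover have "0 \<le> c1 u * Y u * Y u + c2 u * X u * X u" using c by (simp add: mult.assoc)
    ultimately show "\<exists>y. ((\<lambda>t. X t * Y t) has_real_derivative y) (at u) \<and> 0 \<le> y" by blast
  qed
  show ?thesis
  proof (cases "\<exists>T. X T * Y T < 0")
    case True
    then obtain T where T: "X T * Y T < 0" by blast
    have "X t \<noteq> 0" "Y t \<noteq> 0" if "t \<le> T" for t using mZ[OF that] T by auto
    then show ?thesis
      using constant_sign_of_nonvanishing[OF cX, of T] constant_sign_of_nonvanishing[OF cY, of T] that by blast
  next
    case False
    then have Z: "0 \<le> X t * Y t" for t by (simp add: not_less)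
    have sq: "\<exists>T. (\<forall>t\<le>T. 0 \<le> f t) \<or> (\<forall>t\<le>T. f t \<le> 0)"
      if f: "\<And>t. (f has_real_derivative c t * g t) (at t)" "\<And>t. 0 \<le> c t" "\<And>t. 0 \<le> f t * g t"
        and cf: "continuous_on UNIV f" for f g c :: "real \<Rightarrow> real"
    proof (cases "\<exists>T. f T = 0")
      case True
      then obtain T where T: "f T = 0" by blast
      have "f s * f s \<le> f t * f t" if "s \<le> t" for s t
      proof (rule DERIV_nonneg_imp_nondecreasing[OF that])
        fix u
        have "((\<lambda>t. f t * f t) has_real_derivative c u * g u * f u + c u * g u * f u) (at u)"
          using DERIV_mult[OF f(1) f(1)] by simp
        moreover have "c u * g u * f u = c u * (f u * g u)" by simp
        ultimately show "\<exists>y. ((\<lambda>t. f t * f t) has_real_derivative y) (at u) \<and> 0 \<le> y"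
          using f(2,3)[of u] by (metis add_nonneg_nonneg mult_nonneg_nonneg)
      qed
      from this[of _ T] have "f t = 0" if "t \<le> T" for t using T that by (metis mult_eq_0_iff mult_zero_left not_real_square_gt_zero not_less)
      then show ?thesis by (intro exI[of _ T]) auto
    next
      case False
      then show ?thesis using constant_sign_of_nonvanishing[OF cf, of 0] by blast
    qed
    obtain T1 where T1: "(\<forall>t\<le>T1. 0 \<le> X t) \<or> (\<forall>t\<le>T1. X t \<le> 0)" using sq[OF X c(1) Z cX] by blast
    have "0 \<le> Y t * X t" for t using Z[of t] by (simp add: mult.commute)
    then obtain T2 where T2: "(\<forall>t\<le>T2. 0 \<le> Y t) \<or> (\<forall>t\<le>T2. Y t \<le> 0)" using sq[OF Y c(2) _ cY] by blast
    show ?thesis by (rule that[of "min T1 T2"]) (use T1 T2 in auto)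
  qed
qed

lemma derivative_limit_at_bot_eq_0:
  fixes f f' :: "real \<Rightarrow> real"
  assumes f: "\<And>t. (f has_real_derivative f' t) (at t)" and L: "(f \<longlongrightarrow> L) at_bot" and c: "(f' \<longlongrightarrow> c) at_bot"
  shows "c = 0"
proof -
  have s: "filterlim (\<lambda>t::real. t - 1) at_bot at_bot"
    using filterlim_tendsto_add_at_bot_iff[of "\<lambda>_. -1" "-1::real" at_bot "\<lambda>t. t"] by (simp add: filterlim_ident)
  have "((\<lambda>t. f t - f (t - 1)) \<longlongrightarrow> L - L) at_bot"
    by (intro tendsto_diff L filterlim_compose[OF L s])
  then have 0: "((\<lambda>t. f t - f (t - 1)) \<longlongrightarrow> 0) at_bot" by simp
  have "\<exists>z. t - 1 < z \<and> z < t \<and> f t - f (t - 1) = f' z" for t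
    using MVT2[of "t - 1" t f f'] f by auto
  then obtain z where z: "\<And>t. t - 1 < z t \<and> z t < t \<and> f t - f (t - 1) = f' (z t)" by metis
  have "filterlim z at_bot at_bot"
    unfolding filterlim_at_bot
  proof
    fix Z :: real
    show "eventually (\<lambda>t. z t \<le> Z) at_bot"
      by (rule eventually_mono[OF eventually_le_at_bot[of Z]]) (use z in \<open>meson less_imp_le order_trans\<close>)
  qed
  then have "((\<lambda>t. f' (z t)) \<longlongrightarrow> c) at_bot" by (rule filterlim_compose[OF c])
  then have "((\<lambda>t. f t - f (t - 1)) \<longlongrightarrow> c) at_bot" using z by simp
  then show "c = 0" using 0 tendsto_unique[OF trivial_limit_at_bot_linorder] by blast
qed

lemma monotone_bounded_tendsto_at_bot:
  fixes f f' :: "real \<Rightarrow> real"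
  assumes f: "\<And>t. (f has_real_derivative f' t) (at t)" and s: "(\<forall>t\<le>T. 0 \<le> f' t) \<or> (\<forall>t\<le>T. f' t \<le> 0)"
    and b: "\<And>t. m \<le> f t" "\<And>t. f t \<le> M"
  obtains L where "(f \<longlongrightarrow> L) at_bot"
  using s
proof
  assume s: "\<forall>t\<le>T. 0 \<le> f' t"
  have mono: "f u \<le> f t" if "u \<le> t" "t \<le> T" for u t
    by (rule DERIV_nonneg_imp_nondecreasing[OF that(1)]) (use f s that in \<open>meson order_trans\<close>)
  obtain L where "((\<lambda>t. f (- t)) \<longlongrightarrow> L) at_top"
    by (rule antimono_bounded_tendsto_at_top[of "- T" "\<lambda>t. f (- t)" m]) (use mono b in auto)
  then show ?thesis using that by (simp add: filterlim_at_bot_mirror)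
next
  assume s: "\<forall>t\<le>T. f' t \<le> 0"
  have mono: "f t \<le> f u" if "u \<le> t" "t \<le> T" for u t
    by (rule DERIV_nonpos_imp_nonincreasing[OF that(1)]) (use f s that in \<open>meson order_trans\<close>)
  obtain L where "((\<lambda>t. f (- t)) \<longlongrightarrow> L) at_top"
    by (rule mono_bounded_tendsto_at_top[of "- T" "\<lambda>t. f (- t)" M]) (use mono b in auto)
  then show ?thesis using that by (simp add: filterlim_at_bot_mirror)
qed

text \<open>
  Backwards in time the zero persists because \<open>x e\<^bsup>al t\<^esup>\<close> is nondecreasing, and then \<open>x' = 0\<close> forces \<open>y = 0\<close>. Forwards it
  persists by a Gronwall estimate, for which \<open>p, q \<ge> 1\<close> and the bound \<open>M\<close> bound the nonlinearities linearly.
\<close>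
lemma planar_positive:
  fixes x y :: "real \<Rightarrow> real" and al ga p q M :: real
  assumes pos: "al > 0" "ga > 0" "p \<ge> 1" "q \<ge> 1"
    and x: "\<And>t. (x has_real_derivative al * (y t powr p - x t)) (at t)" "\<And>t. 0 \<le> x t" "\<And>t. x t \<le> M"
    and y: "\<And>t. (y has_real_derivative ga * (x t powr q - y t)) (at t)" "\<And>t. 0 \<le> y t" "\<And>t. y t \<le> M"
    and z: "x t1 = 0"
  shows "x t = 0 \<and> y t = 0"
proof -
  have M: "M \<ge> 0" using x(2,3)[of 0] by linarith
  have mono: "x s * exp (al * s) \<le> x t * exp (al * t)" if "s \<le> t" for s t
  proof (rule DERIV_nonneg_imp_nondecreasing[OF that])
    fix u
    have "((\<lambda>t. x t * exp (al * t)) has_real_derivative al * (y u powr p - x u) * exp (al * u) + exp (al * u) * al * x u) (at u)"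
      by (auto intro!: derivative_eq_intros x(1))
    moreover have "al * (y u powr p - x u) * exp (al * u) + exp (al * u) * al * x u = al * y u powr p * exp (al * u)"
      by (simp add: algebra_simps)
    ultimately show "\<exists>d. ((\<lambda>t. x t * exp (al * t)) has_real_derivative d) (at u) \<and> 0 \<le> d" using pos by auto
  qed
  have x0: "x s = 0" if "s \<le> t1" for s
    using mono[OF that] z x(2)[of s] by (simp add: mult_le_0_iff)
  have y0: "y s = 0" if "s < t1" for s
  proof -
    have "((\<lambda>_. 0) has_real_derivative al * (y s powr p - x s)) (at s)"
      by (rule has_field_derivative_transform_within_open[OF x(1), where S = "{..<t1}"]) (use that x0 in auto)
    then have "al * (y s powr p - x s) = 0" by (metis DERIV_const DERIV_unique)
    then show ?thesis using x0[of s] that pos by simp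
  qed
  define K where "K = al * M powr (p - 1) + ga * M powr (q - 1)"
  have lin: "v powr r \<le> M powr (r - 1) * v" if "0 \<le> v" "v \<le> M" "r \<ge> 1" for v r :: real
  proof (cases "v = 0")
    case False
    then have "v powr r = v powr (r - 1) * v" using that by (simp add: powr_diff)
    also have "\<dots> \<le> M powr (r - 1) * v" using that by (intro mult_right_mono powr_mono2) auto
    finally show ?thesis .
  qed simp
  have grow: "(x t + y t) * exp (- K * t) \<le> (x s + y s) * exp (- K * s)" if "s \<le> t" for s t
  proof (rule DERIV_nonpos_imp_nonincreasing[OF that])
    fix u
    have D: "((\<lambda>t. (x t + y t) * exp (- K * t)) has_real_derivative
       (al * (y u powr p - x u) + ga * (x u powr q - y u)) * exp (- K * u) + exp (- K * u) * (- K) * (x u + y u)) (at u)"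
      by (auto intro!: derivative_eq_intros x(1) y(1))
    have "al * (y u powr p - x u) \<le> al * M powr (p - 1) * (x u + y u)"
    proof -
      have "y u powr p - x u \<le> M powr (p - 1) * y u" using lin[OF y(2,3) pos(3), of u] x(2)[of u] by linarith
      also have "\<dots> \<le> M powr (p - 1) * (x u + y u)" using x(2)[of u] by (intro mult_left_mono) auto
      finally show ?thesis using pos by (simp add: mult.assoc mult_left_mono)
    qed
    moreover have "ga * (x u powr q - y u) \<le> ga * M powr (q - 1) * (x u + y u)"
    proof -
      have "x u powr q - y u \<le> M powr (q - 1) * x u" using lin[OF x(2,3) pos(4), of u] y(2)[of u] by linarith
      also have "\<dots> \<le> M powr (q - 1) * (x u + y u)" using y(2)[of u] by (intro mult_left_mono) auto
      finally show ?thesis using pos by (simp add: mult.assoc mult_left_mono)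
    qed
    ultimately have "al * (y u powr p - x u) + ga * (x u powr q - y u) \<le> K * (x u + y u)"
      by (simp add: K_def distrib_right)
    then have "(al * (y u powr p - x u) + ga * (x u powr q - y u) - K * (x u + y u)) * exp (- K * u) \<le> 0"
      by (intro mult_nonpos_nonneg) auto
    then have "(al * (y u powr p - x u) + ga * (x u powr q - y u)) * exp (- K * u) + exp (- K * u) * (- K) * (x u + y u) \<le> 0"
      by (simp add: algebra_simps)
    with D show "\<exists>d. ((\<lambda>t. (x t + y t) * exp (- K * t)) has_real_derivative d) (at u) \<and> d \<le> 0" by blast
  qed
  show ?thesis
  proof (cases "t < t1")
    case True
    then show ?thesis using x0 y0 by simp
  next
    case False
    have "(x t + y t) * exp (- K * t) \<le> 0"
      using grow[of "t1 - 1" t] False x0[of "t1 - 1"] y0[of "t1 - 1"] by simp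
    then show ?thesis using x(2)[of t] y(2)[of t] by (simp add: mult_le_0_iff) 
  qed
qed

text \<open>
  The weighted derivatives \<open>e\<^bsup>al t\<^esup> (y\<^bsup>p\<^esup> - x)\<close> and \<open>e\<^bsup>ga t\<^esup> (x\<^bsup>q\<^esup> - y)\<close> solve a linear cooperative system, so \<open>x\<close> and \<open>y\<close> are
  monotone near \<open>-\<infinity>\<close> and converge to an equilibrium. If the limit were \<open>(0, 0)\<close>, both would be nondecreasing, hence
  \<open>x \<le> y\<^bsup>p\<^esup> \<le> x\<^bsup>pq\<^esup>\<close>, which is impossible for \<open>0 < x < 1\<close>.
\<close>
lemma planar_classification:
  fixes x y :: "real \<Rightarrow> real" and al ga p q M :: real
  assumes pos: "al > 0" "ga > 0" "p > 0" "q > 0" "p * q > 1"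
    and x: "\<And>t. (x has_real_derivative al * (y t powr p - x t)) (at t)" "\<And>t. 0 < x t" "\<And>t. x t \<le> M"
    and y: "\<And>t. (y has_real_derivative ga * (x t powr q - y t)) (at t)" "\<And>t. 0 < y t" "\<And>t. y t \<le> M"
  shows "(x \<longlongrightarrow> 1) at_bot" "(y \<longlongrightarrow> 1) at_bot"
proof -
  let ?X = "\<lambda>t. exp (al * t) * (y t powr p - x t)"
  let ?Y = "\<lambda>t. exp (ga * t) * (x t powr q - y t)"
  let ?c1 = "\<lambda>t. ga * p * y t powr (p - 1) * exp ((al - ga) * t)"
  let ?c2 = "\<lambda>t. al * q * x t powr (q - 1) * exp ((ga - al) * t)"
  have gen: "((\<lambda>t. exp (al * t) * (y t powr p - x t)) has_real_derivative
       (ga * p * y t powr (p - 1) * exp ((al - ga) * t)) * (exp (ga * t) * (x t powr q - y t))) (at t)"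
    if "(x has_real_derivative al * (y t powr p - x t)) (at t)" "(y has_real_derivative ga * (x t powr q - y t)) (at t)" "0 < y t"
    for x y :: "real \<Rightarrow> real" and al ga p q t :: real
  proof -
    have e: "exp (al * t) = exp ((al - ga) * t) * exp (ga * t)" by (simp add: exp_add[symmetric] algebra_simps)
    have "((\<lambda>t. exp (al * t) * (y t powr p - x t)) has_real_derivative
       (exp (al * t) * al) * (y t powr p - x t) + (p * y t powr (p - 1) * (ga * (x t powr q - y t)) - al * (y t powr p - x t)) * exp (al * t)) (at t)"
      using that by (auto intro!: derivative_eq_intros)
    moreover have "(exp (al * t) * al) * (y t powr p - x t) + (p * y t powr (p - 1) * (ga * (x t powr q - y t)) - al * (y t powr p - x t)) * exp (al * t)
      = p * y t powr (p - 1) * (ga * (x t powr q - y t)) * exp (al * t)" by (simp add: algebra_simps)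
    ultimately show ?thesis unfolding e by (simp add: mult_ac)
  qed
  \<comment> \<open>from here on \<open>x\<close> and \<open>y\<close> are monotone on \<open>(-\<infinity>, T]\<close>\<close>
  obtain T where T: "(\<forall>t\<le>T. 0 \<le> ?X t) \<or> (\<forall>t\<le>T. ?X t \<le> 0)" "(\<forall>t\<le>T. 0 \<le> ?Y t) \<or> (\<forall>t\<le>T. ?Y t \<le> 0)"
  proof (rule cooperative_eventual_sign[of ?X ?c1 ?Y ?c2])
    show "(?X has_real_derivative ?c1 t * ?Y t) (at t)" for t by (rule gen[OF x(1) y(1) y(2)])
    show "(?Y has_real_derivative ?c2 t * ?X t) (at t)" for t by (rule gen[OF y(1) x(1) x(2)])
  qed (use pos in auto)
  have sx: "(\<forall>t\<le>T. 0 \<le> al * (y t powr p - x t)) \<or> (\<forall>t\<le>T. al * (y t powr p - x t) \<le> 0)"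
    using T(1) pos by (auto simp: zero_le_mult_iff mult_le_0_iff not_le)
  have sy: "(\<forall>t\<le>T. 0 \<le> ga * (x t powr q - y t)) \<or> (\<forall>t\<le>T. ga * (x t powr q - y t) \<le> 0)"
    using T(2) pos by (auto simp: zero_le_mult_iff mult_le_0_iff not_le)
  have x0: "0 \<le> x t" and y0: "0 \<le> y t" for t using x(2) y(2) less_imp_le by blast+
  obtain a where a: "(x \<longlongrightarrow> a) at_bot" using monotone_bounded_tendsto_at_bot[OF x(1) sx x0 x(3)] by blast
  obtain b where b: "(y \<longlongrightarrow> b) at_bot" using monotone_bounded_tendsto_at_bot[OF y(1) sy y0 y(3)] by blast
  have ab0: "a \<ge> 0" "b \<ge> 0"
    using tendsto_lowerbound[OF a _ trivial_limit_at_bot_linorder, of 0] tendsto_lowerbound[OF b _ trivial_limit_at_bot_linorder, of 0] x0 y0 by auto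
  have yp: "((\<lambda>t. y t powr p) \<longlongrightarrow> b powr p) at_bot" using b pos y0 by (intro tendsto_powr' tendsto_const) auto
  have xq: "((\<lambda>t. x t powr q) \<longlongrightarrow> a powr q) at_bot" using a pos x0 by (intro tendsto_powr' tendsto_const) auto
  have "al * (b powr p - a) = 0"
    by (rule derivative_limit_at_bot_eq_0[OF x(1) a]) (intro tendsto_intros yp a)
  then have 1: "b powr p = a" using pos by simp
  have "ga * (a powr q - b) = 0"
    by (rule derivative_limit_at_bot_eq_0[OF y(1) b]) (intro tendsto_intros xq b)
  then have 2: "a powr q = b" using pos by simp
  have a_ne: "a \<noteq> 0"
  proof
    assume a0: "a = 0"
    then have b0: "b = 0" using 2 by simp
    have inc: "\<forall>t\<le>T. 0 \<le> f' t" if f: "\<And>t. (f has_real_derivative f' t) (at t)" "(f \<longlongrightarrow> 0) at_bot" "\<And>t. 0 < f t"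
      "(\<forall>t\<le>T. 0 \<le> f' t) \<or> (\<forall>t\<le>T. f' t \<le> 0)" for f f' :: "real \<Rightarrow> real"
    proof (rule ccontr)
      assume "\<not> ?thesis"
      then have s: "\<forall>t\<le>T. f' t \<le> 0" using f(4) by blast
      have "f T \<le> f t" if "t \<le> T" for t
        by (rule DERIV_nonpos_imp_nonincreasing[OF that]) (use f(1) s that in blast)
      then have "eventually (\<lambda>t. f T \<le> f t) at_bot" using eventually_le_at_bot[of T] by (rule eventually_mono[rotated])
      then have "f T \<le> 0" using tendsto_lowerbound[OF f(2) _ trivial_limit_at_bot_linorder] by blast
      then show False using f(3)[of T] by simp
    qed
    have ix: "\<forall>t\<le>T. 0 \<le> al * (y t powr p - x t)" by (rule inc[OF x(1) a[unfolded a0] x(2) sx])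
    have iy: "\<forall>t\<le>T. 0 \<le> ga * (x t powr q - y t)" by (rule inc[OF y(1) b[unfolded b0] y(2) sy])
    have "1 \<le> x t" if t: "t \<le> T" for t
    proof (rule ccontr)
      assume "\<not> 1 \<le> x t"
      then have x1: "x t < 1" by simp
      have "x t \<le> y t powr p" "y t \<le> x t powr q" using ix iy t pos by (auto simp: zero_le_mult_iff)
      then have "x t \<le> (x t powr q) powr p" using y0[of t] pos by (meson order_trans powr_mono2 less_imp_le)
      also have "\<dots> = x t powr (p * q)" by (simp add: powr_powr mult.commute)
      also have "\<dots> < x t powr 1" using x(2)[of t] x1 pos by (intro powr_less_mono') auto
      finally show False using x(2)[of t] by simp
    qed
    then have "eventually (\<lambda>t. 1 \<le> x t) at_bot" using eventually_le_at_bot[of T] by (rule eventually_mono[rotated])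
    then have "1 \<le> a" using tendsto_lowerbound[OF a _ trivial_limit_at_bot_linorder] by blast
    then show False using a0 by simp
  qed
  have "a powr (p * q) = a" using 1 2 by (simp add: powr_powr[symmetric] mult.commute[of p])
  then have "a powr (p * q - 1) = 1" using a_ne ab0 by (simp add: powr_diff)
  then have "(p * q - 1) * ln a = 0" using ln_powr[of a "p * q - 1"] a_ne ab0 by simp
  then have "a = 1" using a_ne ab0 pos by simp
  then have "b = 1" using 2 by simp
  show "(x \<longlongrightarrow> 1) at_bot" "(y \<longlongrightarrow> 1) at_bot" using a b \<open>a = 1\<close> \<open>b = 1\<close> by auto
qed

section \<open>Behaviour at the origin of global solutions\<close>

text \<open>
  From radius \<open>r\<close> on, the flux is at least \<open>w r\<close>, so \<open>f\<close> drops by at least \<open>w r * r\<^bsup>2-n\<^esup> / (n - 2)\<close> on \<open>[r, \<infinity>)\<close>, and \<open>f\<close>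
  cannot become negative.
\<close>
lemma flux_growth_bound:
  assumes n: "n > 2" and f: "flux_profile {0<..} n w f" "\<And>r. r > 0 \<Longrightarrow> 0 \<le> f r"
    and w: "\<And>r s. 0 < r \<Longrightarrow> r \<le> s \<Longrightarrow> w r \<le> w s" "w r \<ge> 0" and r: "r > 0"
  shows "w r \<le> (n - 2) * r powr (n - 2) * f r"
proof -
  define c where "c = w r / (n - 2)"
  have c: "c \<ge> 0" using n w(2) by (simp add: c_def)
  have le: "- c * s powr (2 - n) \<le> f r - c * r powr (2 - n)" if s: "r \<le> s" for s
  proof -
    have "f s - c * s powr (2 - n) \<le> f r - c * r powr (2 - n)"
    proof (rule DERIV_nonpos_imp_nonincreasing[OF s])
      fix t assume t: "r \<le> t" "t \<le> s"
      then have t0: "t > 0" using r by simp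
      have "((\<lambda>t. f t - c * t powr (2 - n)) has_real_derivative - (t powr (1 - n) * w t) - c * ((2 - n) * t powr (1 - n))) (at t)"
        using f(1) t0 n unfolding flux_profile_def by (auto intro!: derivative_eq_intros)
      moreover have "- (t powr (1 - n) * w t) - c * ((2 - n) * t powr (1 - n)) = t powr (1 - n) * (w r - w t)"
        using n by (simp add: c_def field_simps)
      moreover have "t powr (1 - n) * (w r - w t) \<le> 0" using w(1)[OF r t(1)] by (intro mult_nonneg_nonpos) auto
      ultimately show "\<exists>y. ((\<lambda>t. f t - c * t powr (2 - n)) has_real_derivative y) (at t) \<and> y \<le> 0" by metis
    qed
    then show ?thesis using f(2)[of s] s r by simp
  qed
  have "((\<lambda>s. - c * s powr (2 - n)) \<longlongrightarrow> - c * 0) at_top"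
    using n by (intro tendsto_mult tendsto_const tendsto_neg_powr filterlim_ident) auto
  then have "- c * 0 \<le> f r - c * r powr (2 - n)"
    by (rule tendsto_upperbound) (use le in \<open>auto intro: eventually_mono[OF eventually_ge_at_top[of r]]\<close>)
  then have "c * r powr (2 - n) \<le> f r" by simp
  then have "r powr (n - 2) * (c * r powr (2 - n)) \<le> r powr (n - 2) * f r" by (intro mult_left_mono) auto
  moreover have "r powr (n - 2) * r powr (2 - n) = 1" using r by (simp add: powr_add[symmetric])
  ultimately have "c \<le> r powr (n - 2) * f r" by (simp add: mult.left_commute[of _ c])
  then show ?thesis using n by (simp add: c_def field_simps)
qed

text \<open>
  Mean value theorem on \<open>[r, 2 r]\<close>; the minimum covers both signs of the exponent \<open>c\<close>.
\<close>
lemma flux_doubling: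
  fixes w v :: "real \<Rightarrow> real"
  assumes w: "\<And>r. r > 0 \<Longrightarrow> (w has_real_derivative r powr c * v r powr p) (at r)" "\<And>r. r > 0 \<Longrightarrow> 0 \<le> w r"
    and v: "\<And>r. r > 0 \<Longrightarrow> 0 \<le> v r" "\<And>r s. 0 < r \<Longrightarrow> r \<le> s \<Longrightarrow> v r \<le> v s" and p: "p > 0" and r: "r > 0"
  shows "min 1 (2 powr c) * r powr (c + 1) * v r powr p \<le> w (2 * r)"
proof -
  obtain z where z: "r < z" "z < 2 * r" "w (2 * r) - w r = (2 * r - r) * (z powr c * v z powr p)"
    using MVT2[of r "2 * r" w "\<lambda>r. r powr c * v r powr p"] w(1) r by auto
  have 1: "min 1 (2 powr c) * r powr c \<le> z powr c"
  proof (cases "c \<ge> 0")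
    case True
    have "min 1 (2 powr c) * r powr c \<le> 1 * r powr c" by (intro mult_right_mono) auto
    also have "\<dots> \<le> z powr c" using True z r by (auto intro: powr_mono2)
    finally show ?thesis by simp
  next
    case False
    have "min 1 (2 powr c) * r powr c \<le> 2 powr c * r powr c" by (intro mult_right_mono) auto
    also have "\<dots> = (2 * r) powr c" using r by (simp add: powr_mult)
    also have "\<dots> \<le> z powr c" using False z r by (intro powr_mono2') auto
    finally show ?thesis .
  qed
  have "min 1 (2 powr c) * r powr (c + 1) * v r powr p = r * ((min 1 (2 powr c) * r powr c) * v r powr p)"
    using r by (simp add: powr_add)
  also have "\<dots> \<le> r * (z powr c * v z powr p)"
    using 1 v(1)[OF r] v(2)[OF r, of z] z p r by (intro mult_left_mono mult_mono powr_mono2) auto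
  also have "\<dots> \<le> w (2 * r)" using z(3) w(2)[OF r] by simp
  finally show ?thesis .
qed

lemma flux_system_mono:
  assumes "flux_system {0<..} n p q w1 w2" "0 < r" "r \<le> s"
  shows "w1 r \<le> w1 s" "w2 r \<le> w2 s"
  by (rule DERIV_nonneg_imp_nondecreasing[OF assms(3)], use assms in \<open>force simp: flux_system_def\<close>)+

text \<open>
  Above the threshold one has \<open>k x\<^bsup>P\<^esup> \<ge> x\<close>, so the values \<open>x(t + j h)\<close> could never return below it.
\<close>
lemma superlinear_iteration_bound:
  fixes x :: "real \<Rightarrow> real"
  assumes k: "k > 0" and P: "P > 1" and h: "h > 0"
    and it: "\<And>t. k * x t powr P \<le> x (t + h)" and lim: "(x \<longlongrightarrow> 0) at_top"
  shows "x t < (1 / k) powr (1 / (P - 1))"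
proof (rule ccontr)
  define m where "m = (1 / k) powr (1 / (P - 1))"
  have m: "m > 0" using k by (simp add: m_def)
  have mk: "k * m powr (P - 1) = 1" using k P by (simp add: m_def powr_powr)
  have step: "m \<le> x (t + h)" if "m \<le> x t" for t
  proof -
    have "m = k * m powr P" using mk m by (simp add: powr_diff field_simps)
    also have "\<dots> \<le> k * x t powr P" using that m k P by (intro mult_left_mono powr_mono2) auto
    also have "\<dots> \<le> x (t + h)" by (rule it)
    finally show ?thesis .
  qed
  assume "\<not> x t < (1 / k) powr (1 / (P - 1))"
  then have t: "m \<le> x t" by (simp add: m_def)
  have all: "m \<le> x (t + real j * h)" for j
  proof (induction j)
    case (Suc j)
    from step[OF this] show ?case by (simp add: algebra_simps)
  qed (use t in simp)
  have "eventually (\<lambda>s. x s < m) at_top" using lim m by (rule order_tendstoD)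
  then obtain S where S: "\<And>s. s \<ge> S \<Longrightarrow> x s < m" by (auto simp: eventually_at_top_linorder)
  obtain j :: nat where "(S - t) / h < real j" using reals_Archimedean2 by blast
  then have "S \<le> t + real j * h" using h by (simp add: field_simps)
  from S[OF this] all[of j] show False by simp
qed

text \<open>
  The condition \<open>al > n - 2\<close> is what distinguishes the cusp range: there nonnegativity of the profile gives \<open>x \<rightarrow> 0\<close> at
  infinity, and this starts the bounds needed for the planar classification.
\<close>
lemma global_flux_asymptotics:
  fixes n p q al ga a b :: real
  assumes pos: "al > 0" "ga > 0" "p \<ge> 1" "q \<ge> 1" "p * q > 1" "a > 0" "b > 0" "n > 2"
    and A: "al - p * ga = n - (n - 1) * p" and B: "ga - q * al = n - (n - 1) * q"
    and ab: "al * a = b powr p" "ga * b = a powr q" and e: "al > n - 2"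
    and w: "flux_system {0<..} n p q w1 w2"
    and f: "flux_profile {0<..} n w1 f1" "\<And>r. r > 0 \<Longrightarrow> 0 \<le> f1 r"
    and nz: "\<exists>r>0. w1 r \<noteq> 0 \<or> w2 r \<noteq> 0"
  shows "((\<lambda>r. w1 r / (a * r powr al)) \<longlongrightarrow> 1) (at_right 0)"
    and "((\<lambda>r. w2 r / (b * r powr ga)) \<longlongrightarrow> 1) (at_right 0)"
proof -
  let ?c1 = "(n - 1) * (1 - p)" and ?c2 = "(n - 1) * (1 - q)"
  have ww: "\<And>r. r > 0 \<Longrightarrow> (w1 has_real_derivative r powr ?c1 * w2 r powr p) (at r)"
    "\<And>r. r > 0 \<Longrightarrow> (w2 has_real_derivative r powr ?c2 * w1 r powr q) (at r)"
    "\<And>r. r > 0 \<Longrightarrow> 0 \<le> w1 r" "\<And>r. r > 0 \<Longrightarrow> 0 \<le> w2 r"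
    using w unfolding flux_system_def by auto
  note mono = flux_system_mono[OF w]
  have c: "?c1 + 1 - al + p * ga = 0" "?c2 + 1 - ga + q * al = 0" using A B by (auto simp: algebra_simps)
  define x where "x t = w1 (exp t) * exp (- al * t) / a" for t
  define y where "y t = w2 (exp t) * exp (- ga * t) / b" for t
  have wx: "w1 (exp t) = a * exp (al * t) * x t" for t using pos by (simp add: x_def exp_minus field_simps)
  have wy: "w2 (exp t) = b * exp (ga * t) * y t" for t using pos by (simp add: y_def exp_minus field_simps)
  have x0: "0 \<le> x t" and y0: "0 \<le> y t" for t using ww pos by (auto simp: x_def y_def)
  have key: "exp t powr (cc + 1) * (bb * exp (gg * t) * z) powr pp * exp (- aa * t) = bb powr pp * z powr pp"
    if "cc + 1 - aa + pp * gg = 0" "bb > 0" "z \<ge> 0" for cc aa pp gg bb z t :: real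
  proof -
    have "exp t powr (cc + 1) * (bb * exp (gg * t) * z) powr pp * exp (- aa * t)
        = (exp ((cc + 1) * t) * exp (pp * gg * t) * exp (- aa * t)) * (bb powr pp * z powr pp)"
      using that by (simp add: powr_mult exp_powr_real mult_ac)
    also have "exp ((cc + 1) * t) * exp (pp * gg * t) * exp (- aa * t) = exp ((cc + 1 - aa + pp * gg) * t)"
      by (simp add: exp_add[symmetric] algebra_simps)
    finally show ?thesis using that by simp
  qed
  have ode: "((\<lambda>t. w (exp t) * exp (- aa * t) / d) has_real_derivative aa * (z t powr pp - w (exp t) * exp (- aa * t) / d)) (at t)"
    if D: "\<And>r. r > 0 \<Longrightarrow> (w has_real_derivative r powr cc * v r powr pp) (at r)"
      and c: "cc + 1 - aa + pp * gg = 0" and d: "d > 0" "bb > 0" "aa * d = bb powr pp"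
      and v: "\<And>t. v (exp t) = bb * exp (gg * t) * z t" "\<And>t. z t \<ge> 0" for w v z :: "real \<Rightarrow> real" and cc pp aa bb gg d t :: real
  proof -
    have "((\<lambda>t. w (exp t)) has_real_derivative (exp t powr cc * v (exp t) powr pp) * exp t) (at t)"
      by (rule DERIV_chain2[OF D]) (auto intro!: derivative_eq_intros)
    then have 1: "((\<lambda>t. w (exp t) * exp (- aa * t) / d) has_real_derivative
       ((exp t powr cc * v (exp t) powr pp) * exp t * exp (- aa * t) + exp (- aa * t) * (- aa) * w (exp t)) / d) (at t)"
      using d by (auto intro!: derivative_eq_intros)
    have "(exp t powr cc * v (exp t) powr pp) * exp t * exp (- aa * t) = exp t powr (cc + 1) * (bb * exp (gg * t) * z t) powr pp * exp (- aa * t)"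
      by (simp add: v powr_add)
    also have "\<dots> = bb powr pp * z t powr pp" by (rule key[OF c d(2) v(2)])
    also have "\<dots> = aa * d * z t powr pp" by (simp add: d(3))
    finally have "((exp t powr cc * v (exp t) powr pp) * exp t * exp (- aa * t) + exp (- aa * t) * (- aa) * w (exp t)) / d
       = aa * (z t powr pp - w (exp t) * exp (- aa * t) / d)"
      using d(1) by (simp add: field_simps)
    with 1 show ?thesis by simp
  qed
  have dx: "(x has_real_derivative al * (y t powr p - x t)) (at t)" for t
    unfolding x_def[abs_def] by (rule ode[OF ww(1) c(1) pos(6,7) ab(1) wy y0])
  have dy: "(y has_real_derivative ga * (x t powr q - y t)) (at t)" for t
    unfolding y_def[abs_def] by (rule ode[OF ww(2) c(2) pos(7,6) ab(2) wx x0])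
  have dbl: "\<exists>k>0. \<forall>t. k * z t powr pp \<le> w (exp (t + ln 2)) * exp (- aa * (t + ln 2)) / d"
    if D: "\<And>r. r > 0 \<Longrightarrow> (w has_real_derivative r powr cc * v r powr pp) (at r)" "\<And>r. r > 0 \<Longrightarrow> 0 \<le> w r"
      and v0: "\<And>r. r > 0 \<Longrightarrow> 0 \<le> v r" "\<And>r s. 0 < r \<Longrightarrow> r \<le> s \<Longrightarrow> v r \<le> v s" and pp: "pp > 0"
      and c: "cc + 1 - aa + pp * gg = 0" and d: "d > 0" "bb > 0"
      and v: "\<And>t. v (exp t) = bb * exp (gg * t) * z t" "\<And>t. z t \<ge> 0" for w v z :: "real \<Rightarrow> real" and cc pp aa bb gg d :: real
  proof -
    define k where "k = min 1 (2 powr cc) * bb powr pp * exp (- aa * ln 2) / d"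
    have "k * z t powr pp \<le> w (exp (t + ln 2)) * exp (- aa * (t + ln 2)) / d" for t
    proof -
      have "k * z t powr pp = min 1 (2 powr cc) * (bb powr pp * z t powr pp) * exp (- aa * ln 2) / d"
        by (simp add: k_def mult_ac)
      also have "\<dots> = (min 1 (2 powr cc) * exp t powr (cc + 1) * v (exp t) powr pp) * exp (- aa * t) * exp (- aa * ln 2) / d"
      proof -
        have K: "exp t powr (cc + 1) * v (exp t) powr pp * exp (- aa * t) = bb powr pp * z t powr pp"
          unfolding v(1) by (rule key[OF c d(2) v(2)])
        show ?thesis unfolding K[symmetric] by (simp only: mult_ac)
      qed
      also have "\<dots> \<le> w (2 * exp t) * exp (- aa * t) * exp (- aa * ln 2) / d"
        using flux_doubling[OF D v0 pp, of "exp t"] d by (intro divide_right_mono mult_right_mono) auto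
      also have "\<dots> = w (exp (t + ln 2)) * exp (- aa * (t + ln 2)) / d"
      proof -
        have "exp (t + ln 2) = 2 * exp t" by (simp add: exp_add)
        moreover have "exp (- aa * (t + ln 2)) = exp (- aa * t) * exp (- aa * ln 2)" by (simp add: exp_add[symmetric] algebra_simps)
        ultimately show ?thesis by simp
      qed
      finally show ?thesis .
    qed
    moreover have "k > 0" using d by (simp add: k_def min_def)
    ultimately show ?thesis by blast
  qed
  have p0: "p > 0" "q > 0" using pos by auto
  obtain k1 where k1: "k1 > 0" "\<And>t. k1 * y t powr p \<le> x (t + ln 2)"
    using dbl[OF ww(1,3,4) mono(2) p0(1) c(1) pos(6,7) wy y0] unfolding x_def by blast
  obtain k2 where k2: "k2 > 0" "\<And>t. k2 * x t powr q \<le> y (t + ln 2)"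
    using dbl[OF ww(2,4,3) mono(1) p0(2) c(2) pos(7,6) wx x0] unfolding y_def by blast
  have it: "k1 * k2 powr p * x t powr (p * q) \<le> x (t + 2 * ln 2)" for t
  proof -
    have "k1 * k2 powr p * x t powr (p * q) = k1 * (k2 * x t powr q) powr p"
      using k2(1) by (simp add: powr_mult powr_powr mult.commute)
    also have "\<dots> \<le> k1 * y (t + ln 2) powr p"
      using k1(1) k2 p0 by (intro mult_left_mono powr_mono2) auto
    also have "\<dots> \<le> x (t + ln 2 + ln 2)" by (rule k1(2))
    finally show ?thesis by (simp add: algebra_simps)
  qed
  have xlim: "(x \<longlongrightarrow> 0) at_top"
  proof (rule tendsto_sandwich[of "\<lambda>_. 0" _ _ "\<lambda>t. (n - 2) * f1 1 / a * exp (- (al - (n - 2)) * t)"])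
    have "x t \<le> (n - 2) * f1 1 / a * exp (- (al - (n - 2)) * t)" if t: "t \<ge> 0" for t
    proof -
      have fa: "f1 (exp t) \<le> f1 1" by (rule flux_profile_antimono[OF f(1)]) (use t ww(3) in auto)
      have "w1 (exp t) \<le> (n - 2) * exp t powr (n - 2) * f1 (exp t)"
        by (rule flux_growth_bound[OF pos(8) f mono(1)]) (use ww(3) in auto)
      also have "\<dots> \<le> (n - 2) * exp t powr (n - 2) * f1 1" using fa pos by (intro mult_left_mono) auto
      finally have "w1 (exp t) \<le> (n - 2) * exp ((n - 2) * t) * f1 1" by (simp add: exp_powr_real mult.commute)
      then have "x t \<le> (n - 2) * exp ((n - 2) * t) * f1 1 * exp (- al * t) / a"
        unfolding x_def using pos by (intro divide_right_mono mult_right_mono) auto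
      also have "\<dots> = (n - 2) * f1 1 / a * (exp ((n - 2) * t) * exp (- al * t))" by simp
      also have "exp ((n - 2) * t) * exp (- al * t) = exp (- (al - (n - 2)) * t)" by (simp add: exp_add[symmetric] algebra_simps)
      finally show ?thesis .
    qed
    then show "eventually (\<lambda>t. x t \<le> (n - 2) * f1 1 / a * exp (- (al - (n - 2)) * t)) at_top"
      by (rule eventually_mono[OF eventually_ge_at_top[of 0]])
    have "filterlim (\<lambda>t. - (al - (n - 2)) * t) at_bot at_top"
      using e by (intro filterlim_tendsto_neg_mult_at_bot[OF tendsto_const]) (auto simp: filterlim_ident)
    then have "((\<lambda>t. exp (- (al - (n - 2)) * t)) \<longlongrightarrow> 0) at_top" by (rule filterlim_compose[OF exp_at_bot])
    from tendsto_mult[OF tendsto_const this, of "(n - 2) * f1 1 / a"]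
    show "((\<lambda>t. (n - 2) * f1 1 / a * exp (- (al - (n - 2)) * t)) \<longlongrightarrow> 0) at_top" by simp
  qed (use x0 in auto)
  \<comment> \<open>thresholds of the doubling inequality for \<open>x\<close> and, through \<open>k1 y\<^bsup>p\<^esup> \<le> x(t + ln 2)\<close>, for \<open>y\<close>\<close>
  define Mx where "Mx = (1 / (k1 * k2 powr p)) powr (1 / (p * q - 1))"
  have xM: "x t \<le> Mx" for t
    unfolding Mx_def by (rule less_imp_le[OF superlinear_iteration_bound[OF _ pos(5) _ it xlim]]) (use k1 k2 in auto)
  define My where "My = (Mx / k1) powr (1 / p)"
  have yM: "y t \<le> My" for t
  proof -
    have "k1 * y t powr p \<le> Mx" using k1(2)[of t] xM[of "t + ln 2"] by linarith
    then have "y t powr p \<le> Mx / k1" using k1(1) by (simp add: field_simps)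
    then have "(y t powr p) powr (1 / p) \<le> My" unfolding My_def using p0 by (intro powr_mono2) auto
    then show ?thesis using p0 y0[of t] by (simp add: powr_powr)
  qed
  define M where "M = max Mx My"
  have xM': "x t \<le> M" and yM': "y t \<le> M" for t using xM[of t] yM[of t] by (auto simp: M_def)
  have nz': "\<not> (\<forall>t. x t = 0 \<and> y t = 0)"
  proof
    assume z: "\<forall>t. x t = 0 \<and> y t = 0"
    have "w1 r = 0 \<and> w2 r = 0" if "r > 0" for r using wx[of "ln r"] wy[of "ln r"] z that by simp
    then show False using nz by blast
  qed
  have xpos: "0 < x t" for t
  proof (rule ccontr)
    assume "\<not> 0 < x t"
    then have "x t = 0" using x0[of t] by linarith
    then have "x s = 0 \<and> y s = 0" for s
      by (rule planar_positive[OF pos(1-4) dx x0 xM' dy y0 yM'])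
    then show False using nz' by blast
  qed
  have ypos: "0 < y t" for t
  proof (rule ccontr)
    assume "\<not> 0 < y t"
    then have "y t = 0" using y0[of t] by linarith
    then have "y s = 0 \<and> x s = 0" for s
      by (rule planar_positive[OF pos(2,1,4,3) dy y0 yM' dx x0 xM'])
    then show False using nz' by blast
  qed
  note L = planar_classification[OF pos(1,2) p0 pos(5) dx xpos xM' dy ypos yM']
  have tr: "((\<lambda>r. w r / (d * r powr aa)) \<longlongrightarrow> 1) (at_right 0)"
    if "((\<lambda>t. w (exp t) * exp (- aa * t) / d) \<longlongrightarrow> 1) at_bot" for w :: "real \<Rightarrow> real" and aa d
    using filterlim_compose[OF that ln_at_0]
  proof (rule Lim_transform_eventually)
    show "eventually (\<lambda>r. w (exp (ln r)) * exp (- aa * ln r) / d = w r / (d * r powr aa)) (at_right 0)"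
      using eventually_at_right_less[of 0]
    proof eventually_elim
      case (elim r)
      have "exp (- aa * ln r) = 1 / r powr aa" using elim by (simp add: powr_def exp_minus inverse_eq_divide)
      then show ?case using elim by simp
    qed
  qed
  show "((\<lambda>r. w1 r / (a * r powr al)) \<longlongrightarrow> 1) (at_right 0)"
    by (rule tr) (use L(1) in \<open>simp add: x_def[abs_def]\<close>)
  show "((\<lambda>r. w2 r / (b * r powr ga)) \<longlongrightarrow> 1) (at_right 0)"
    by (rule tr) (use L(2) in \<open>simp add: y_def[abs_def]\<close>)
qed

section \<open>Global solutions\<close>

lemma global_solution_of_flux:
  assumes n: "n = real DIM('a::euclidean_space)" and pq: "p > 0" "q > 0"
    and w: "flux_system {0<..} n p q w1 w2"
    and f: "flux_profile {0<..} n w1 f1" "flux_profile {0<..} n w2 f2"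
    and f0: "\<And>r. r > 0 \<Longrightarrow> 0 \<le> f1 r" "\<And>r. r > 0 \<Longrightarrow> 0 \<le> f2 r"
    and nz: "\<exists>r>0. w1 r \<noteq> 0 \<or> w2 r \<noteq> 0"
  shows "global_solution TYPE('a) p q f1 f2"
proof -
  have "radial_solution (UNIV - {0::'a}) p q f1 f2"
    by (rule flux_imp_radial_solution[OF _ _ n pq]) (use w f f0 in \<open>auto simp: norm_image_punctured\<close>)
  moreover have "\<not> (\<exists>k1 k2. \<forall>r>0. f1 r = k1 \<and> f2 r = k2)"
  proof
    assume "\<exists>k1 k2. \<forall>r>0. f1 r = k1 \<and> f2 r = k2"
    then obtain k1 k2 where k: "\<And>r. r > 0 \<Longrightarrow> f1 r = k1" "\<And>r. r > 0 \<Longrightarrow> f2 r = k2" by blast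
    have zero: "w r = 0" if f: "flux_profile {0<..} n w f" and k: "\<And>r. r > 0 \<Longrightarrow> f r = k" and r: "r > 0" for w f k r
    proof -
      have "((\<lambda>_. k) has_real_derivative - (r powr (1 - n) * w r)) (at r)"
        by (rule has_field_derivative_transform_within_open[where S = "{0<..}" and f = f])
           (use f r k in \<open>auto simp: flux_profile_def\<close>)
      then have "- (r powr (1 - n) * w r) = 0" by (metis DERIV_const DERIV_unique)
      then show ?thesis using r by simp
    qed
    show False using nz zero[OF f(1) k(1)] zero[OF f(2) k(2)] by blast
  qed
  ultimately show ?thesis unfolding global_solution_def by blast
qed

lemma flux_of_global_solution:
  assumes n: "n = real DIM('a::euclidean_space)" "n > 2" and G: "global_solution TYPE('a) p q f1 f2"
  obtains w1 w2 where "flux_system {0<..} n p q w1 w2" "flux_profile {0<..} n w1 f1" "flux_profile {0<..} n w2 f2"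
    "\<And>r. r > 0 \<Longrightarrow> 0 \<le> f1 r" "\<And>r. r > 0 \<Longrightarrow> 0 \<le> f2 r" "\<exists>r>0. w1 r \<noteq> 0 \<or> w2 r \<noteq> 0"
proof -
  have S: "radial_solution (UNIV - {0::'a}) p q f1 f2" using G unfolding global_solution_def by blast
  obtain w1 w2 where prof: "flux_profile {0<..} n w1 f1" "flux_profile {0<..} n w2 f2"
    and d: "\<And>r. r > 0 \<Longrightarrow> (w1 has_real_derivative r powr ((n - 1) * (1 - p)) * \<bar>w2 r\<bar> powr p) (at r)"
    "\<And>r. r > 0 \<Longrightarrow> (w2 has_real_derivative r powr ((n - 1) * (1 - q)) * \<bar>w1 r\<bar> powr q) (at r)"
    by (rule radial_solution_flux[OF S n(1)]) blast
  have f0: "0 \<le> f1 r" "0 \<le> f2 r" if "r > 0" for r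
  proof -
    have "r \<in> norm ` (UNIV - {0::'a})" using that by (simp add: norm_image_punctured)
    then obtain x :: 'a where "x \<noteq> 0" "norm x = r" by auto
    then show "0 \<le> f1 r" "0 \<le> f2 r" using S unfolding radial_solution_def solves_S_def by auto
  qed
  have m1: "w1 r \<le> w1 s" if "0 < r" "r \<le> s" for r s
  proof (rule DERIV_nonneg_imp_nondecreasing[OF that(2)])
    fix x assume "r \<le> x"
    then show "\<exists>y. (w1 has_real_derivative y) (at x) \<and> 0 \<le> y"
      using d(1)[of x] that by (intro exI[of _ "x powr ((n - 1) * (1 - p)) * \<bar>w2 x\<bar> powr p"]) auto
  qed
  have m2: "w2 r \<le> w2 s" if "0 < r" "r \<le> s" for r s
  proof (rule DERIV_nonneg_imp_nondecreasing[OF that(2)])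
    fix x assume "r \<le> x"
    then show "\<exists>y. (w2 has_real_derivative y) (at x) \<and> 0 \<le> y"
      using d(2)[of x] that by (intro exI[of _ "x powr ((n - 1) * (1 - q)) * \<bar>w1 x\<bar> powr q"]) auto
  qed
  have w0: "0 \<le> w1 r" "0 \<le> w2 r" if "r > 0" for r
    using flux_nonneg[OF n(2) prof(1) f0(1) m1 that] flux_nonneg[OF n(2) prof(2) f0(2) m2 that] by auto
  have "flux_system {0<..} n p q w1 w2" unfolding flux_system_def using d w0 by auto
  moreover have "\<exists>r>0. w1 r \<noteq> 0 \<or> w2 r \<noteq> 0"
  proof (rule ccontr)
    assume "\<not> ?thesis"
    then have z: "w1 r = 0" "w2 r = 0" if "r > 0" for r using that by auto
    have const: "f r = f 1" if f: "flux_profile {0<..} n w f" and z: "\<And>r. r > 0 \<Longrightarrow> w r = 0" and r: "r > 0" for f w r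
    proof -
      have "f (max r 1) \<le> f (min r 1)" by (rule flux_profile_antimono[OF f]) (use z r in auto)
      moreover have "f (min r 1) \<le> f (max r 1)"
        by (rule DERIV_nonneg_imp_nondecreasing) (use f z r in \<open>auto simp: flux_profile_def min_def max_def split: if_splits\<close>)
      ultimately show ?thesis by (auto simp: min_def max_def split: if_splits)
    qed
    show False using G const[OF prof(1) z(1)] const[OF prof(2) z(2)] unfolding global_solution_def by blast
  qed
  ultimately show ?thesis using prof f0 that by blast
qed

text \<open>
  All the algebra of the exponents in one place. In terms of \<open>al = - \<beta>\<^sub>1\<close>, \<open>ga = - \<beta>\<^sub>2\<close> the constants \<open>a\<^sub>i\<close> are the
  coefficients of the power solution of the flux system, and \<open>e\<^sub>i\<close> are the exponents of the explicit profiles.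
\<close>
lemma critical_exponents:
  fixes p q :: real and N :: nat
  assumes N: "N \<ge> 3" and pq: "p \<ge> q" "q > 0" "p * q > 1" and q2: "q2 N p < q"
  defines "n \<equiv> real N" and "al \<equiv> - beta1 N p q" and "ga \<equiv> - beta2 N p q"
    and "e1 \<equiv> (p * (q - 1) - 2) / (p * q - 1)" and "e2 \<equiv> (q * (p - 1) - 2) / (p * q - 1)"
  shows "al > 0" "ga > 0" "a1 N p q > 0" "a2 N p q > 0"
    "al - p * ga = n - (n - 1) * p" "ga - q * al = n - (n - 1) * q"
    "al * a1 N p q = a2 N p q powr p" "ga * a2 N p q = a1 N p q powr q"
    "al = n - 2 + e1" "ga = n - 2 + e2" "A1abs N p q = a1 N p q / \<bar>e1\<bar>" "A2abs N p q = a2 N p q / \<bar>e2\<bar>"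
proof -
  define d where "d = p * q - 1"
  have d: "d > 0" using pq by (simp add: d_def)
  have n: "n \<ge> 3" using N by (simp add: n_def)
  have p: "p > 0" using pq by linarith
  have al: "al = ((n - 1) * p * q - n - p) / d" "ga = ((n - 1) * p * q - n - q) / d"
    by (simp_all add: al_def ga_def beta1_def beta2_def n_def d_def field_simps minus_divide_left)
  have "(n + p) / ((n - 1) * p) < q" using q2 by (simp add: q2_def n_def)
  then have "n + p < (n - 1) * p * q" using n p by (simp add: divide_less_eq mult_ac)
  then show al0: "al > 0" and ga0: "ga > 0" unfolding al using d pq by auto
  have b: "\<bar>beta1 N p q\<bar> = al" "\<bar>beta2 N p q\<bar> = ga" using al0 ga0 by (auto simp: al_def ga_def)
  have a: "a1 N p q = (al * ga powr p) powr (1 / d)" "a2 N p q = (ga * al powr q) powr (1 / d)"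
    by (auto simp: a1_def a2_def b d_def)
  show "a1 N p q > 0" "a2 N p q > 0" unfolding a using al0 ga0 by auto
  have pd: "1 + 1 / d = p * q / d" using d by (simp add: d_def field_simps)
  show "al * a1 N p q = a2 N p q powr p"
  proof -
    have "al * a1 N p q = (al powr 1 * al powr (1 / d)) * ga powr (p / d)"
      unfolding a using al0 ga0 by (simp add: powr_mult powr_powr)
    also have "al powr 1 * al powr (1 / d) = al powr (p * q / d)" by (simp only: powr_add[symmetric] pd)
    also have "al powr (p * q / d) * ga powr (p / d) = a2 N p q powr p"
      unfolding a using al0 ga0 by (simp add: powr_mult powr_powr mult_ac)
    finally show ?thesis .
  qed
  show "ga * a2 N p q = a1 N p q powr q"
  proof -
    have "ga * a2 N p q = (ga powr 1 * ga powr (1 / d)) * al powr (q / d)"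
      unfolding a using al0 ga0 by (simp add: powr_mult powr_powr)
    also have "ga powr 1 * ga powr (1 / d) = ga powr (p * q / d)" by (simp only: powr_add[symmetric] pd)
    also have "ga powr (p * q / d) * al powr (q / d) = a1 N p q powr q"
      unfolding a using al0 ga0 by (simp add: powr_mult powr_powr mult_ac)
    finally show ?thesis .
  qed
  have dd: "al * d = (n - 1) * p * q - n - p" "ga * d = (n - 1) * p * q - n - q" unfolding al using d by auto
  have "(al - p * ga) * d = (n - (n - 1) * p) * d"
    using dd by (simp add: left_diff_distrib mult.assoc) (simp add: d_def algebra_simps)
  then show "al - p * ga = n - (n - 1) * p" using d by simp
  have "(ga - q * al) * d = (n - (n - 1) * q) * d"
    using dd by (simp add: left_diff_distrib mult.assoc) (simp add: d_def algebra_simps)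
  then show "ga - q * al = n - (n - 1) * q" using d by simp
  have ee: "e1 * d = p * (q - 1) - 2" "e2 * d = q * (p - 1) - 2" using d by (auto simp: e1_def e2_def d_def)
  have "al * d = (n - 2 + e1) * d" unfolding dd(1) distrib_right ee by (simp add: d_def algebra_simps)
  then show "al = n - 2 + e1" using d by simp
  have "ga * d = (n - 2 + e2) * d" unfolding dd(2) distrib_right ee by (simp add: d_def algebra_simps)
  then show "ga = n - 2 + e2" using d by simp
  show "A1abs N p q = a1 N p q / \<bar>e1\<bar>" "A2abs N p q = a2 N p q / \<bar>e2\<bar>"
    using d \<open>a1 N p q > 0\<close> \<open>a2 N p q > 0\<close>
    by (auto simp: A1abs_def A2abs_def e1_def e2_def abs_mult d_def abs_divide)
qed

lemma flux_scaling:
  fixes w1 w2 :: "real \<Rightarrow> real"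
  assumes w: "flux_system {0<..} n p q w1 w2" and t: "t > 0"
    and A: "al - p * ga = n - (n - 1) * p" and B: "ga - q * al = n - (n - 1) * q"
  shows "flux_system {0<..} n p q (\<lambda>r. t powr (- al) * w1 (t * r)) (\<lambda>r. t powr (- ga) * w2 (t * r))"
proof -
  have key: "((\<lambda>r. t powr (- aa) * w (t * r)) has_real_derivative r powr c * (t powr (- gg) * v (t * r)) powr pp) (at r)"
    if r: "r > 0" and D: "\<And>r. r > 0 \<Longrightarrow> (w has_real_derivative r powr c * v r powr pp) (at r)"
      and c: "c + 1 - aa + pp * gg = 0" and v: "v (t * r) \<ge> 0" for w v :: "real \<Rightarrow> real" and aa gg c pp r
  proof -
    have "((\<lambda>r. w (t * r)) has_real_derivative ((t * r) powr c * v (t * r) powr pp) * t) (at r)"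
      by (rule DERIV_chain2[OF D]) (use r t in \<open>auto intro!: derivative_eq_intros\<close>)
    from DERIV_cmult[OF this, of "t powr (- aa)"]
    have 1: "((\<lambda>r. t powr (- aa) * w (t * r)) has_real_derivative t powr (- aa) * (((t * r) powr c * v (t * r) powr pp) * t)) (at r)" .
    have "t powr (- aa) * (((t * r) powr c * v (t * r) powr pp) * t)
       = (t powr (- aa) * t powr c * t powr 1) * (r powr c * v (t * r) powr pp)"
      using r t by (simp add: powr_mult)
    also have "t powr (- aa) * t powr c * t powr 1 = t powr (c + 1 - aa)" by (simp only: powr_add[symmetric]) (simp add: algebra_simps)
    also have "c + 1 - aa = - gg * pp" using c by (simp add: algebra_simps)
    also have "t powr (- gg * pp) * (r powr c * v (t * r) powr pp) = r powr c * (t powr (- gg) * v (t * r)) powr pp"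
      using v by (simp add: powr_mult powr_powr)
    finally show ?thesis using 1 by simp
  qed
  have c: "(n - 1) * (1 - p) + 1 - al + p * ga = 0" "(n - 1) * (1 - q) + 1 - ga + q * al = 0"
    using A B by (auto simp: algebra_simps)
  show ?thesis unfolding flux_system_def
  proof (intro ballI conjI)
    fix r :: real assume "r \<in> {0<..}"
    then have r: "r > 0" "t * r > 0" using t by auto
    show "((\<lambda>r. t powr (- al) * w1 (t * r)) has_real_derivative r powr ((n - 1) * (1 - p)) * (t powr (- ga) * w2 (t * r)) powr p) (at r)"
      by (rule key[OF r(1) _ c(1)]) (use w r in \<open>auto simp: flux_system_def\<close>)
    show "((\<lambda>r. t powr (- ga) * w2 (t * r)) has_real_derivative r powr ((n - 1) * (1 - q)) * (t powr (- al) * w1 (t * r)) powr q) (at r)"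
      by (rule key[OF r(1) _ c(2)]) (use w r in \<open>auto simp: flux_system_def\<close>)
  qed (use w t in \<open>auto simp: flux_system_def\<close>)
qed

text \<open>
  The system is invariant under the scaling \<open>(t\<^bsup>-al\<^esup> w\<^sub>1(t r), t\<^bsup>-ga\<^esup> w\<^sub>2(t r))\<close>, which fixes the power solution; so the limit
  of the first flux at infinity can be prescribed.
\<close>
lemma heteroclinic_flux_family:
  fixes n p q al ga a b W :: real
  assumes pos: "al > 0" "ga > 0" "p > 0" "q > 0" "p * q > 1" "q \<le> p" "a > 0" "b > 0" "n > 1"
    and A: "al - p * ga = n - (n - 1) * p" and B: "ga - q * al = n - (n - 1) * q"
    and ab: "al * a = b powr p" "ga * b = a powr q" and W: "W > 0"
  obtains w1 w2 where "flux_system {0<..} n p q w1 w2"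
    "\<And>r. r > 0 \<Longrightarrow> 0 < w1 r \<and> w1 r \<le> W" "\<And>r. r > 0 \<Longrightarrow> 0 < w2 r" "(w1 \<longlongrightarrow> W) at_top"
    "((\<lambda>r. w1 r / (a * r powr al)) \<longlongrightarrow> 1) (at_right 0)"
    "((\<lambda>r. w2 r / (b * r powr ga)) \<longlongrightarrow> 1) (at_right 0)"
proof -
  obtain w1 w2 where w: "flux_system {0<..} n p q w1 w2"
    and w1: "\<And>r. r > 0 \<Longrightarrow> 0 < w1 r \<and> w1 r \<le> a" and w2: "\<And>r. r > 0 \<Longrightarrow> 0 < w2 r"
    and l: "((\<lambda>r. w1 r / (a * r powr al)) \<longlongrightarrow> 1) (at_right 0)" "((\<lambda>r. w2 r / (b * r powr ga)) \<longlongrightarrow> 1) (at_right 0)"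
    by (rule heteroclinic_flux_exists[OF pos A B ab]) blast
  note mono = flux_system_mono[OF w]
  obtain L where L: "(w1 \<longlongrightarrow> L) at_top" "\<And>t. 1 \<le> t \<Longrightarrow> w1 t \<le> L"
    by (rule mono_bounded_tendsto_at_top[of 1 w1 a]) (use mono w1 in auto)
  have L0: "L > 0" using L(2)[of 1] w1[of 1] by simp
  have wL: "w1 r \<le> L" if "r > 0" for r
    using mono(1)[OF that, of "max r 1"] L(2)[of "max r 1"] by simp
  \<comment> \<open>the scaling factor that turns the limit \<open>L\<close> into \<open>W\<close>\<close>
  define t where "t = (L / W) powr (1 / al)"
  have t: "t > 0" using L0 W by (simp add: t_def)
  have tL: "t powr (- al) * L = W"
    using L0 W pos by (simp add: t_def powr_powr powr_minus field_simps)
  have shift: "filterlim (\<lambda>r. t * r) (at_right 0) (at_right 0)"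
  proof -
    have "((\<lambda>r. t * r) \<longlongrightarrow> t * 0) (at_right 0)" by (intro tendsto_intros)
    then show ?thesis using t by (auto simp: filterlim_at eventually_at_filter intro!: always_eventually)
  qed
  have tr: "((\<lambda>r. t powr (- z) * w (t * r) / (c * r powr z)) \<longlongrightarrow> 1) (at_right 0)"
    if "((\<lambda>r. w r / (c * r powr z)) \<longlongrightarrow> 1) (at_right 0)" for w :: "real \<Rightarrow> real" and c z
    using filterlim_compose[OF that shift]
  proof (rule Lim_transform_eventually)
    show "eventually (\<lambda>r. w (t * r) / (c * (t * r) powr z) = t powr (- z) * w (t * r) / (c * r powr z)) (at_right 0)"
      using eventually_at_right_less[of 0]
      by eventually_elim (use t in \<open>simp add: powr_mult powr_minus field_simps\<close>)
  qed
  show ?thesis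
  proof (rule that[of "\<lambda>r. t powr (- al) * w1 (t * r)" "\<lambda>r. t powr (- ga) * w2 (t * r)"])
    show "flux_system {0<..} n p q (\<lambda>r. t powr (- al) * w1 (t * r)) (\<lambda>r. t powr (- ga) * w2 (t * r))"
      by (rule flux_scaling[OF w t A B])
    show "0 < t powr (- al) * w1 (t * r) \<and> t powr (- al) * w1 (t * r) \<le> W" if "r > 0" for r
      unfolding tL[symmetric] using w1[of "t * r"] wL[of "t * r"] t that by (auto intro!: mult_left_mono)
    show "0 < t powr (- ga) * w2 (t * r)" if "r > 0" for r using w2[of "t * r"] t that by simp
    have "filterlim (\<lambda>r. t * r) at_top at_top"
      using t by (intro filterlim_tendsto_pos_mult_at_top[OF tendsto_const]) (auto simp: filterlim_ident)
    then have "((\<lambda>r. t powr (- al) * w1 (t * r)) \<longlongrightarrow> t powr (- al) * L) at_top"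
      by (intro tendsto_intros filterlim_compose[OF L(1)])
    then show "((\<lambda>r. t powr (- al) * w1 (t * r)) \<longlongrightarrow> W) at_top" unfolding tL .
    show "((\<lambda>r. t powr (- al) * w1 (t * r) / (a * r powr al)) \<longlongrightarrow> 1) (at_right 0)" by (rule tr[OF l(1)])
    show "((\<lambda>r. t powr (- ga) * w2 (t * r) / (b * r powr ga)) \<longlongrightarrow> 1) (at_right 0)" by (rule tr[OF l(2)])
  qed
qed

text \<open>
  With a negative \<open>s\<close> this bounds \<open>w\<^sub>2\<close>; with a positive one it gives growth at most like \<open>r\<^bsup>s\<^esup>\<close>, and \<open>s\<close> may be taken larger
  than the natural exponent in order to avoid \<open>s = 0\<close>.
\<close>
lemma second_flux_growth:
  fixes w1 w2 :: "real \<Rightarrow> real"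
  assumes w: "flux_system {0<..} n p q w1 w2" and W: "\<And>r. r > 0 \<Longrightarrow> w1 r \<le> W" and q: "q > 0"
    and s: "s \<noteq> 0" "n - (n - 1) * q \<le> s" and r: "r \<ge> 1"
  shows "w2 r \<le> w2 1 + W powr q / s * (r powr s - 1)"
proof -
  have "w2 r - W powr q / s * r powr s \<le> w2 1 - W powr q / s * 1 powr s"
  proof (rule DERIV_nonpos_imp_nonincreasing[OF r])
    fix t :: real assume t: "1 \<le> t" "t \<le> r"
    then have D: "(w2 has_real_derivative t powr ((n - 1) * (1 - q)) * w1 t powr q) (at t)" "0 \<le> w1 t"
      using w unfolding flux_system_def by auto
    have "((\<lambda>r. w2 r - W powr q / s * r powr s) has_real_derivative
        t powr ((n - 1) * (1 - q)) * w1 t powr q - W powr q / s * (s * t powr (s - 1))) (at t)"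
      using D(1) t by (auto intro!: derivative_eq_intros)
    moreover have "t powr ((n - 1) * (1 - q)) * w1 t powr q - W powr q / s * (s * t powr (s - 1)) \<le> 0"
    proof -
      have "t powr ((n - 1) * (1 - q)) * w1 t powr q \<le> t powr (s - 1) * W powr q"
        using t D(2) W[of t] q s by (intro mult_mono powr_mono powr_mono2) (auto simp: algebra_simps)
      then show ?thesis using s(1) by (simp add: mult.commute)
    qed
    ultimately show "\<exists>y. ((\<lambda>r. w2 r - W powr q / s * r powr s) has_real_derivative y) (at t) \<and> y \<le> 0" by blast
  qed
  then show ?thesis by (simp add: algebra_simps diff_divide_distrib)
qed

lemma second_flux_asymptotics:
  fixes w1 w2 :: "real \<Rightarrow> real"
  assumes w: "flux_system {0<..} n p q w1 w2" and W: "(w1 \<longlongrightarrow> W) at_top" "W > 0" and q: "q > 0"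
    and B: "n - (n - 1) * q > 0"
  shows "((\<lambda>r. w2 r / r powr (n - (n - 1) * q)) \<longlongrightarrow> W powr q / (n - (n - 1) * q)) at_top"
proof -
  define B where "B = n - (n - 1) * q"
  have B0: "B > 0" using B by (simp add: B_def)
  have c: "(n - 1) * (1 - q) = B - 1" by (simp add: B_def algebra_simps)
  have pos: "eventually (\<lambda>y::real. y > 0) (at_right 0)" by (rule eventually_at_right_less)
  have "((\<lambda>y. w2 (inverse y) / y powr (- B)) \<longlongrightarrow> W powr q / B) (at_right 0)"
  proof (rule lhopital_right_0_at_top[where f' = "\<lambda>y. - (inverse y powr (B - 1) * w1 (inverse y) powr q / y\<^sup>2)" and g' = "\<lambda>y. - B * y powr (- B - 1)"])
    show "filterlim (\<lambda>y::real. y powr (- B)) at_top (at_right 0)" using B0 by (intro powr_neg_at_right_0) simp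
    show "eventually (\<lambda>y. - B * y powr (- B - 1) \<noteq> 0) (at_right 0)" using pos B0 by (auto elim!: eventually_mono)
    show "eventually (\<lambda>y. ((\<lambda>y. w2 (inverse y)) has_real_derivative - (inverse y powr (B - 1) * w1 (inverse y) powr q / y\<^sup>2)) (at y)) (at_right 0)"
      using pos
    proof eventually_elim
      case (elim y)
      have "(w2 has_real_derivative inverse y powr (B - 1) * w1 (inverse y) powr q) (at (inverse y))"
        using w elim unfolding flux_system_def c by auto
      from DERIV_chain2[OF this DERIV_inverse] elim
      show ?case by (simp add: power2_eq_square divide_inverse power_inverse)
    qed
    show "eventually (\<lambda>y. ((\<lambda>y. y powr (- B)) has_real_derivative - B * y powr (- B - 1)) (at y)) (at_right 0)"
      using pos by eventually_elim (rule has_real_derivative_powr)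
    have "((\<lambda>y. w1 (inverse y) powr q / B) \<longlongrightarrow> W powr q / B) (at_right 0)"
      using W B0 by (intro tendsto_divide tendsto_const tendsto_powr) (auto simp: filterlim_at_right_to_top)
    then show "((\<lambda>y. - (inverse y powr (B - 1) * w1 (inverse y) powr q / y\<^sup>2) / (- B * y powr (- B - 1))) \<longlongrightarrow> W powr q / B) (at_right 0)"
    proof (rule Lim_transform_eventually)
      show "eventually (\<lambda>y. w1 (inverse y) powr q / B = - (inverse y powr (B - 1) * w1 (inverse y) powr q / y\<^sup>2) / (- B * y powr (- B - 1))) (at_right 0)"
        using pos
      proof eventually_elim
        case (elim y)
        have i: "inverse y powr z = y powr (- z)" for z
          using elim by (simp add: powr_minus inverse_powr)
        have y2: "y\<^sup>2 = y powr 2" using elim by (simp add: powr_numeral)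
        have "inverse y powr (B - 1) / y\<^sup>2 = y powr (- (B - 1) - 2)"
          unfolding i y2 by (simp only: powr_diff[symmetric])
        also have "- (B - 1) - 2 = - B - 1" by simp
        finally have E: "inverse y powr (B - 1) / y\<^sup>2 = y powr (- B - 1)" .
        have "- (inverse y powr (B - 1) * w1 (inverse y) powr q / y\<^sup>2) / (- B * y powr (- B - 1))
            = (inverse y powr (B - 1) / y\<^sup>2) * w1 (inverse y) powr q / (B * y powr (- B - 1))" by simp
        then show ?case unfolding E using elim by simp
      qed
    qed
  qed
  then have "((\<lambda>r. w2 r / inverse r powr (- B)) \<longlongrightarrow> W powr q / B) at_top"
    by (simp add: filterlim_at_right_to_top)
  then show ?thesis unfolding B_def[symmetric]
  proof (rule Lim_transform_eventually)
    show "eventually (\<lambda>r. w2 r / inverse r powr (- B) = w2 r / r powr B) at_top"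
      using eventually_gt_at_top[of "0::real"]
      by eventually_elim (simp add: powr_minus inverse_powr)
  qed
qed

lemma powr_flux_system:
  fixes a b al ga :: real
  assumes "a > 0" "b > 0"
    and A: "al - p * ga = n - (n - 1) * p" and B: "ga - q * al = n - (n - 1) * q"
    and ab: "al * a = b powr p" "ga * b = a powr q"
  shows "flux_system {0<..} n p q (\<lambda>r. a * r powr al) (\<lambda>r. b * r powr ga)"
proof -
  have key: "((\<lambda>r. c * r powr x) has_real_derivative r powr ((n - 1) * (1 - z)) * (d * r powr y) powr z) (at r)"
    if "r > 0" "d > 0" "x - z * y = n - (n - 1) * z" "x * c = d powr z" for c d x y z r :: real
  proof -
    have "(n - 1) * (1 - z) + y * z = x - 1" using that(3) by (simp add: algebra_simps)
    then have "r powr ((n - 1) * (1 - z)) * (d * r powr y) powr z = d powr z * r powr (x - 1)"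
      using that by (simp add: powr_mult powr_powr powr_add[symmetric] mult.left_commute)
    also have "\<dots> = c * (x * r powr (x - 1))" by (simp add: that(4)[symmetric] mult_ac)
    finally show ?thesis using DERIV_cmult[OF has_real_derivative_powr[OF that(1)], of c x] by simp
  qed
  show ?thesis unfolding flux_system_def
    using key[OF _ assms(2) A ab(1)] key[OF _ assms(1) B ab(2)] assms(1,2) by auto
qed

lemma powr_flux_profile:
  assumes "e < 0"
  shows "flux_profile {0<..} n (\<lambda>r. a * r powr (n - 2 + e)) (\<lambda>r. a / \<bar>e\<bar> * r powr e)"
  unfolding flux_profile_def
proof
  fix r :: real assume "r \<in> {0<..}"
  then have r: "r > 0" by simp
  have "r powr (1 - n) * (a * r powr (n - 2 + e)) = a * (r powr (1 - n) * r powr (n - 2 + e))" by simp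
  also have "r powr (1 - n) * r powr (n - 2 + e) = r powr (e - 1)" by (simp add: powr_add[symmetric])
  finally have "- (r powr (1 - n) * (a * r powr (n - 2 + e))) = a / \<bar>e\<bar> * (e * r powr (e - 1))" using assms by simp
  then show "((\<lambda>r. a / \<bar>e\<bar> * r powr e) has_real_derivative - (r powr (1 - n) * (a * r powr (n - 2 + e)))) (at r)"
    using DERIV_cmult[OF has_real_derivative_powr[OF r], of "a / \<bar>e\<bar>" e] by simp
qed

lemma larger_exponent_gt_1:
  fixes p q :: real
  assumes "p \<ge> q" "q > 0" "p * q > 1"
  shows "p > 1"
proof (rule ccontr)
  assume "\<not> p > 1"
  then have "p * q \<le> 1 * 1" using assms by (intro mult_mono) auto
  then show False using assms by simp
qed

text \<open>
  The three cases correspond to the initial exponents \<open>(0, 0)\<close>, \<open>(N - (N-1)p, 0)\<close> and \<open>(0, N - (N-1)q)\<close> of the fluxes.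
\<close>
lemma local_solutions:
  fixes p q r0 :: real
  assumes N: "N = DIM('a::euclidean_space)" "N \<ge> 3" and pq: "p \<ge> q" "q > 0" "p * q > 1" and r0: "r0 > 0"
  shows "p < real N / (real N - 1) \<Longrightarrow>
           \<exists>C1>0. \<exists>C2>0. \<exists>f1 f2. local_dirac_solution TYPE('a) r0 p q C1 C2 f1 f2"
    and "q < q1 N p \<Longrightarrow> p < real N / (real N - 1) \<Longrightarrow>
           \<exists>C2>0. \<exists>f1 f2. local_dirac_solution TYPE('a) r0 p q 0 C2 f1 f2"
    and "q < q2 N p \<Longrightarrow> \<exists>C1>0. \<exists>f1 f2. local_dirac_solution TYPE('a) r0 p q C1 0 f1 f2"
proof -
  define n where "n = real N"
  have n: "n = real DIM('a)" "n > 2" "n \<ge> 3" using N by (auto simp: n_def)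
  have p1: "p > 1" by (rule larger_exponent_gt_1[OF pq])
  then have p0: "p > 0" by simp
  have A: "(n - 1) * (1 - p) + 1 > 0" if "p < real N / (real N - 1)"
    using that n by (simp add: n_def[symmetric] less_divide_eq algebra_simps)
  have AB: "(n - 1) * (1 - p) + 1 \<le> (n - 1) * (1 - q) + 1" using pq n by simp
  show "\<exists>C1>0. \<exists>C2>0. \<exists>f1 f2. local_dirac_solution TYPE('a) r0 p q C1 C2 f1 f2" if "p < real N / (real N - 1)"
    by (rule local_dirac_exists[OF n(1,2) r0 p0 pq(2,3), of 0 0]) (use A[OF that] AB in auto)
  show "\<exists>C2>0. \<exists>f1 f2. local_dirac_solution TYPE('a) r0 p q 0 C2 f1 f2"
    if q: "q < q1 N p" and p: "p < real N / (real N - 1)"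
  proof -
    let ?e = "(n - 1) * (1 - p) + 1"
    have "(n - 1) * p > 1"
    proof -
      have "1 * 1 < (n - 1) * p" using n p1 by (intro mult_strict_mono) auto
      then show ?thesis by simp
    qed
    then have "q * ((n - 1) * p - 1) < n" using q by (simp add: q1_def n_def[symmetric] less_divide_eq)
    then have s2: "(n - 1) * (1 - q) + q * ?e + 1 > 0" by (simp add: algebra_simps)
    show ?thesis
      by (rule local_dirac_exists[OF n(1,2) r0 p0 pq(2,3), of ?e 0]) (use A[OF p] s2 in auto)
  qed
  show "\<exists>C1>0. \<exists>f1 f2. local_dirac_solution TYPE('a) r0 p q C1 0 f1 f2" if q: "q < q2 N p"
  proof -
    let ?e = "(n - 1) * (1 - q) + 1"
    have q2: "q * ((n - 1) * p) < n + p" using q n p0 by (simp add: q2_def n_def[symmetric] less_divide_eq)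
    have B: "?e > 0"
    proof (rule ccontr)
      assume "\<not> ?e > 0"
      then have 1: "n \<le> (n - 1) * q" by (simp add: algebra_simps)
      have "(n - 1) * q \<le> (n - 1) * p" using pq(1) n(2) by (intro mult_left_mono) auto
      then have 2: "n \<le> (n - 1) * p" using 1 by linarith
      have "n * p \<le> (n - 1) * q * p" using 1 p0 by (intro mult_right_mono) auto
      also have "\<dots> < n + p" using q2 by (simp add: algebra_simps)
      finally show False using 2 by (simp add: algebra_simps)
    qed
    have s1: "(n - 1) * (1 - p) + p * ?e + 1 > 0" using q2 by (simp add: algebra_simps)
    show ?thesis
      by (rule local_dirac_exists[OF n(1,2) r0 p0 pq(2,3), of 0 ?e]) (use B s1 in auto)
  qed
qed

text \<open>
  The second profile depends on how fast \<open>w\<^sub>2\<close> grows, which differs from case to case; it is therefore produced from any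
  growth bound slower than \<open>r\<^bsup>n-2\<^esup>\<close>.
\<close>
lemma heteroclinic_global_solutions:
  fixes n p q al ga a b e1 e2 W :: real
  assumes n: "n = real DIM('a::euclidean_space)" "n > 2" and pos: "al > 0" "ga > 0" "p > 0" "q > 0" "p * q > 1" "q \<le> p" "a > 0" "b > 0"
    and A: "al - p * ga = n - (n - 1) * p" and B: "ga - q * al = n - (n - 1) * q"
    and ab: "al * a = b powr p" "ga * b = a powr q" and e: "al = n - 2 + e1" "ga = n - 2 + e2" "e1 < 0" "e2 < 0" and W: "W > 0"
  obtains w1 w2 f1 where "flux_system {0<..} n p q w1 w2"
    "\<And>r. r > 0 \<Longrightarrow> 0 < w1 r \<and> w1 r \<le> W" "\<And>r. r > 0 \<Longrightarrow> 0 < w2 r" "(w1 \<longlongrightarrow> W) at_top"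
    "f1 \<sim>[at_right 0] (\<lambda>r. a / \<bar>e1\<bar> * r powr e1)" "((\<lambda>r. r powr (n - 2) * f1 r) \<longlongrightarrow> W / (n - 2)) at_top"
    "\<And>K s. (\<And>r. r \<ge> 1 \<Longrightarrow> w2 r \<le> K * r powr s) \<Longrightarrow> s < n - 2 \<Longrightarrow>
       \<exists>f2. global_solution TYPE('a) p q f1 f2 \<and> f2 \<sim>[at_right 0] (\<lambda>r. b / \<bar>e2\<bar> * r powr e2) \<and>
         flux_profile {0<..} n w2 f2 \<and> (f2 \<longlongrightarrow> 0) at_top"
proof -
  have n1: "n > 1" using n by simp
  obtain w1 w2 where w: "flux_system {0<..} n p q w1 w2"
    and w1: "\<And>r. r > 0 \<Longrightarrow> 0 < w1 r \<and> w1 r \<le> W" and w2: "\<And>r. r > 0 \<Longrightarrow> 0 < w2 r" and lW: "(w1 \<longlongrightarrow> W) at_top"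
    and l: "((\<lambda>r. w1 r / (a * r powr al)) \<longlongrightarrow> 1) (at_right 0)" "((\<lambda>r. w2 r / (b * r powr ga)) \<longlongrightarrow> 1) (at_right 0)"
    by (rule heteroclinic_flux_family[OF pos n1 A B ab W]) blast
  note cw = flux_system_continuous[OF w]
  obtain f1 where f1: "flux_profile {0<..} n w1 f1" "(f1 \<longlongrightarrow> 0) at_top" "\<And>r. r > 0 \<Longrightarrow> 0 \<le> f1 r"
    by (rule flux_profile_tail_exists[OF cw(1), where K = W and s = 0]) (use w1 n in \<open>auto intro: less_imp_le\<close>)
  have "((\<lambda>r. w1 r / r powr 0) \<longlongrightarrow> W) at_top"
    using lW by (rule Lim_transform_eventually, intro eventually_mono[OF eventually_gt_at_top[of 0]]) simp
  from flux_profile_tail_asymptotics[OF f1(1,2) _ this]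
  have t1: "((\<lambda>r. r powr (n - 2) * f1 r) \<longlongrightarrow> W / (n - 2)) at_top" using n by simp
  have s1: "f1 \<sim>[at_right 0] (\<lambda>r. a / \<bar>e1\<bar> * r powr e1)"
    by (rule asymp_equivI', rule flux_profile_singular_asymptotics[OF f1(1) pos(7) e(3) l(1)[unfolded e(1)]])
  have "\<exists>f2. global_solution TYPE('a) p q f1 f2 \<and> f2 \<sim>[at_right 0] (\<lambda>r. b / \<bar>e2\<bar> * r powr e2) \<and>
       flux_profile {0<..} n w2 f2 \<and> (f2 \<longlongrightarrow> 0) at_top" if K: "\<And>r. r \<ge> 1 \<Longrightarrow> w2 r \<le> K * r powr s" "s < n - 2" for K s
  proof -
    obtain f2 where f2: "flux_profile {0<..} n w2 f2" "(f2 \<longlongrightarrow> 0) at_top" "\<And>r. r > 0 \<Longrightarrow> 0 \<le> f2 r"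
      by (rule flux_profile_tail_exists[OF cw(2), where K = K and s = s]) (use w2 K in \<open>auto intro: less_imp_le\<close>)
    have s2: "f2 \<sim>[at_right 0] (\<lambda>r. b / \<bar>e2\<bar> * r powr e2)"
      by (rule asymp_equivI', rule flux_profile_singular_asymptotics[OF f2(1) pos(8) e(4) l(2)[unfolded e(2)]])
    have "global_solution TYPE('a) p q f1 f2"
    proof (rule global_solution_of_flux[OF n(1) pos(3,4) w f1(1) f2(1) f1(3) f2(3)])
      show "\<exists>r>0. w1 r \<noteq> 0 \<or> w2 r \<noteq> 0" using w1[of 1] by (intro exI[of _ 1]) auto
    qed
    then show ?thesis using f2 s2 by blast
  qed
  then show ?thesis using that[OF w w1 w2 lW s1 t1] by blast
qed

text \<open>
  Below \<open>N/(N-1)\<close> the second flux grows like \<open>r\<^bsup>N-(N-1)q\<^esup>\<close>; above, it converges.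
\<close>
lemma singular_global_solutions:
  fixes p q :: real
  assumes N: "N = DIM('a::euclidean_space)" "N \<ge> 3" and pq: "p \<ge> q" "q > 0" "p * q > 1"
    and q2: "q2 N p < q" and q3: "q < q3 p"
  shows "A1abs N p q > 0" "A2abs N p q > 0" "global_solution TYPE('a) p q (v1 N p q) (v2 N p q)"
    "infinity_singular (v1 N p q)" "infinity_singular (v2 N p q)"
    and "q < real N / (real N - 1) \<Longrightarrow>
      \<exists>c :: real \<Rightarrow> real. \<forall>c1>0. c c1 > 0 \<and> (\<exists>f1 f2. global_solution TYPE('a) p q f1 f2 \<and>
         f1 \<sim>[at_right 0] v1 N p q \<and> f2 \<sim>[at_right 0] v2 N p q \<and>
         ((\<lambda>r. r powr (real N - 2) * f1 r) \<longlongrightarrow> c1) at_top \<and>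
         ((\<lambda>r. r powr ((real N - 1) * q - 2) * f2 r) \<longlongrightarrow> c c1) at_top)"
    and "q > real N / (real N - 1) \<Longrightarrow>
      \<exists>c1>0. \<exists>c2>0. \<exists>f1 f2. global_solution TYPE('a) p q f1 f2 \<and>
         f1 \<sim>[at_right 0] v1 N p q \<and> f2 \<sim>[at_right 0] v2 N p q \<and>
         ((\<lambda>r. r powr (real N - 2) * f1 r) \<longlongrightarrow> c1) at_top \<and>
         ((\<lambda>r. r powr (real N - 2) * f2 r) \<longlongrightarrow> c2) at_top"
proof -
  define n where "n = real N"
  have n: "n = real DIM('a)" "n > 2" "n \<ge> 3" "n > 1" using N by (auto simp: n_def)
  define al where "al = - beta1 N p q"
  define ga where "ga = - beta2 N p q"
  define e1 where "e1 = (p * (q - 1) - 2) / (p * q - 1)"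
  define e2 where "e2 = (q * (p - 1) - 2) / (p * q - 1)"
  define a where "a = a1 N p q"
  define b where "b = a2 N p q"
  have p1: "p > 1" by (rule larger_exponent_gt_1[OF pq])
  have p0: "p > 0" using p1 by simp
  note ce = critical_exponents[OF N(2) pq q2, folded al_def ga_def e1_def e2_def a_def b_def n_def]
  have e: "e1 < 0" "e2 < 0"
  proof -
    have "q * (p - 1) < 2" using q3 p1 by (simp add: q3_def less_divide_eq)
    then show "e2 < 0" using pq by (simp add: e2_def divide_less_0_iff)
    have "p * (q - 1) \<le> q * (p - 1)" using pq by (simp add: algebra_simps)
    then have "p * (q - 1) < 2" using \<open>q * (p - 1) < 2\<close> by linarith
    then show "e1 < 0" using pq by (simp add: e1_def divide_less_0_iff)
  qed
  have pN: "p < n"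
  proof (rule ccontr)
    assume "\<not> p < n"
    have "n + p < q * ((n - 1) * p)" using q2 n p0 by (simp add: q2_def n_def[symmetric] divide_less_eq)
    moreover have "q * (p - 1) < 2" using q3 p1 by (simp add: q3_def less_divide_eq)
    ultimately have "(n + p) * (p - 1) < 2 * ((n - 1) * p)"
    proof -
      assume 1: "n + p < q * ((n - 1) * p)" and 2: "q * (p - 1) < 2"
      have "(n + p) * (p - 1) < q * ((n - 1) * p) * (p - 1)" using 1 p1 by (intro mult_strict_right_mono) auto
      also have "\<dots> = (q * (p - 1)) * ((n - 1) * p)" by simp
      also have "\<dots> < 2 * ((n - 1) * p)" using 2 n p0 by (intro mult_strict_right_mono) auto
      finally show ?thesis .
    qed
    \<comment> \<open>\<open>q\<^sub>2 < q < q\<^sub>3\<close> is a nonempty range only for \<open>p < N\<close>: the quadratic inequality factors\<close>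
    then have "(p - n) * (p + 1) < 0" by (simp add: algebra_simps)
    moreover have "(p - n) * (p + 1) \<ge> 0" using \<open>\<not> p < n\<close> p0 by (intro mult_nonneg_nonneg) auto
    ultimately show False by simp
  qed
  have qN: "(n - 1) * q > 2"
  proof -
    have "n + p < q * ((n - 1) * p)" using q2 n p0 by (simp add: q2_def n_def[symmetric] divide_less_eq)
    then have "2 * p < ((n - 1) * q) * p" using pN by (simp add: algebra_simps)
    then show ?thesis using p0 by simp
  qed
  have v: "v1 N p q = (\<lambda>r. a / \<bar>e1\<bar> * r powr e1)" "v2 N p q = (\<lambda>r. b / \<bar>e2\<bar> * r powr e2)"
    by (auto simp: v1_def v2_def ce(11,12) e1_def[symmetric] e2_def[symmetric])
  have ab: "a / \<bar>e1\<bar> > 0" "b / \<bar>e2\<bar> > 0"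
    by (rule divide_pos_pos[OF ce(3)], use e in simp) (rule divide_pos_pos[OF ce(4)], use e in simp)
  show "A1abs N p q > 0" "A2abs N p q > 0" using ab ce(11,12) by auto
  show "infinity_singular (v1 N p q)" "infinity_singular (v2 N p q)"
  proof -
    have inf: "infinity_singular (\<lambda>r. c * r powr s)" if "c > 0" "s < 0" for c s
    proof -
      have "filterlim (\<lambda>r. c * r powr s) at_top (at_right 0)"
        by (rule filterlim_tendsto_pos_mult_at_top[OF tendsto_const that(1) powr_neg_at_right_0[OF that(2)]])
      then show ?thesis unfolding infinity_singular_def using that(1) by (simp add: abs_mult)
    qed
    show "infinity_singular (v1 N p q)" "infinity_singular (v2 N p q)"
      unfolding v by (rule inf[OF ab(1) e(1)], rule inf[OF ab(2) e(2)])
  qed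
  show "global_solution TYPE('a) p q (v1 N p q) (v2 N p q)"
  proof (rule global_solution_of_flux[OF n(1) p0 pq(2) powr_flux_system[OF ce(3,4,5,6,7,8)]])
    show "flux_profile {0<..} n (\<lambda>r. a * r powr al) (v1 N p q)"
      unfolding v ce(9) by (rule powr_flux_profile[OF e(1)])
    show "flux_profile {0<..} n (\<lambda>r. b * r powr ga) (v2 N p q)"
      unfolding v ce(10) by (rule powr_flux_profile[OF e(2)])
    show "\<exists>r>0. a * r powr al \<noteq> 0 \<or> b * r powr ga \<noteq> 0" using ce(3) by (intro exI[of _ 1]) simp
    show "0 \<le> v1 N p q r" for r unfolding v by (intro mult_nonneg_nonneg less_imp_le[OF ab(1)]) simp
    show "0 \<le> v2 N p q r" for r unfolding v by (intro mult_nonneg_nonneg less_imp_le[OF ab(2)]) simp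
  qed
  note family = heteroclinic_global_solutions[OF n(1,2) ce(1,2) p0 pq(2,3,1) ce(3-10) e, folded v]
  show "\<exists>c :: real \<Rightarrow> real. \<forall>c1>0. c c1 > 0 \<and> (\<exists>f1 f2. global_solution TYPE('a) p q f1 f2 \<and>
         f1 \<sim>[at_right 0] v1 N p q \<and> f2 \<sim>[at_right 0] v2 N p q \<and>
         ((\<lambda>r. r powr (real N - 2) * f1 r) \<longlongrightarrow> c1) at_top \<and>
         ((\<lambda>r. r powr ((real N - 1) * q - 2) * f2 r) \<longlongrightarrow> c c1) at_top)" if q: "q < real N / (real N - 1)"
  proof -
    define B where "B = n - (n - 1) * q"
    have B: "B > 0" "B < n - 2" "n - 2 - B = (n - 1) * q - 2"
      using q n qN by (auto simp: B_def n_def[symmetric] less_divide_eq algebra_simps)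
    define c where "c c1 = ((n - 2) * c1) powr q / B / ((n - 1) * q - 2)" for c1
    have "c c1 > 0 \<and> (\<exists>f1 f2. global_solution TYPE('a) p q f1 f2 \<and>
         f1 \<sim>[at_right 0] v1 N p q \<and> f2 \<sim>[at_right 0] v2 N p q \<and>
         ((\<lambda>r. r powr (n - 2) * f1 r) \<longlongrightarrow> c1) at_top \<and>
         ((\<lambda>r. r powr ((n - 1) * q - 2) * f2 r) \<longlongrightarrow> c c1) at_top)" if c1: "c1 > 0" for c1
    proof -
      define W where "W = (n - 2) * c1"
      have W: "W > 0" "W / (n - 2) = c1" using c1 n by (auto simp: W_def)
      obtain w1 w2 f1 where w: "flux_system {0<..} n p q w1 w2" "\<And>r. r > 0 \<Longrightarrow> 0 < w1 r \<and> w1 r \<le> W" "\<And>r. r > 0 \<Longrightarrow> 0 < w2 r"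
        "(w1 \<longlongrightarrow> W) at_top" and f1: "f1 \<sim>[at_right 0] v1 N p q" "((\<lambda>r. r powr (n - 2) * f1 r) \<longlongrightarrow> W / (n - 2)) at_top"
        and f2ex: "\<And>K s. (\<And>r. r \<ge> 1 \<Longrightarrow> w2 r \<le> K * r powr s) \<Longrightarrow> s < n - 2 \<Longrightarrow>
          \<exists>f2. global_solution TYPE('a) p q f1 f2 \<and> f2 \<sim>[at_right 0] v2 N p q \<and>
            flux_profile {0<..} n w2 f2 \<and> (f2 \<longlongrightarrow> 0) at_top"
        by (rule family[OF W(1)]) blast
      have "w2 r \<le> (w2 1 + W powr q / B) * r powr B" if r: "r \<ge> 1" for r
      proof -
        have "w2 r \<le> w2 1 + W powr q / B * (r powr B - 1)"
          by (rule second_flux_growth[OF w(1) _ pq(2) _ _ r]) (use w(2) B in \<open>auto simp: B_def\<close>)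
        also have "\<dots> \<le> w2 1 * r powr B + W powr q / B * r powr B"
        proof (rule add_mono)
          have "1 \<le> r powr B" using r B by (simp add: ge_one_powr_ge_zero)
          then show "w2 1 \<le> w2 1 * r powr B" using w(3)[of 1] by simp
          show "W powr q / B * (r powr B - 1) \<le> W powr q / B * r powr B" using B by (intro mult_left_mono) auto
        qed
        finally show ?thesis by (simp add: algebra_simps)
      qed
      then obtain f2 where f2: "global_solution TYPE('a) p q f1 f2" "f2 \<sim>[at_right 0] v2 N p q"
         "flux_profile {0<..} n w2 f2" "(f2 \<longlongrightarrow> 0) at_top" using f2ex[OF _ B(2)] by blast
      have "((\<lambda>r. w2 r / r powr B) \<longlongrightarrow> W powr q / B) at_top"
        unfolding B_def by (rule second_flux_asymptotics[OF w(1,4) W(1) pq(2)]) (use B in \<open>simp add: B_def\<close>)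
      from flux_profile_tail_asymptotics[OF f2(3,4) B(2) this]
      have "((\<lambda>r. r powr ((n - 1) * q - 2) * f2 r) \<longlongrightarrow> c c1) at_top"
        unfolding B(3) c_def W_def .
      moreover have "c c1 > 0" using qN B c1 n by (simp add: c_def)
      ultimately show ?thesis using f2 f1 W(2) by auto
    qed
    then show ?thesis unfolding n_def by blast
  qed
  show "\<exists>c1>0. \<exists>c2>0. \<exists>f1 f2. global_solution TYPE('a) p q f1 f2 \<and>
         f1 \<sim>[at_right 0] v1 N p q \<and> f2 \<sim>[at_right 0] v2 N p q \<and>
         ((\<lambda>r. r powr (real N - 2) * f1 r) \<longlongrightarrow> c1) at_top \<and>
         ((\<lambda>r. r powr (real N - 2) * f2 r) \<longlongrightarrow> c2) at_top" if q: "q > real N / (real N - 1)"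
  proof -
    define B where "B = n - (n - 1) * q"
    have B: "B < 0" using q n by (simp add: B_def n_def[symmetric] divide_less_eq algebra_simps)
    obtain w1 w2 f1 where w: "flux_system {0<..} n p q w1 w2" "\<And>r. r > 0 \<Longrightarrow> 0 < w1 r \<and> w1 r \<le> 1" "\<And>r. r > 0 \<Longrightarrow> 0 < w2 r"
      and f1: "f1 \<sim>[at_right 0] v1 N p q" "((\<lambda>r. r powr (n - 2) * f1 r) \<longlongrightarrow> 1 / (n - 2)) at_top"
      and f2ex: "\<And>K s. (\<And>r. r \<ge> 1 \<Longrightarrow> w2 r \<le> K * r powr s) \<Longrightarrow> s < n - 2 \<Longrightarrow>
          \<exists>f2. global_solution TYPE('a) p q f1 f2 \<and> f2 \<sim>[at_right 0] v2 N p q \<and>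
            flux_profile {0<..} n w2 f2 \<and> (f2 \<longlongrightarrow> 0) at_top"
      by (rule family[OF zero_less_one]) blast
    have bd: "w2 r \<le> w2 1 - 1 / B" if r: "r \<ge> 1" for r
    proof -
      have "w2 r \<le> w2 1 + 1 powr q / B * (r powr B - 1)"
        by (rule second_flux_growth[OF w(1) _ pq(2) _ _ r]) (use w(2) B in \<open>auto simp: B_def\<close>)
      also have "\<dots> = w2 1 - 1 / B + r powr B / B" by (simp add: diff_divide_distrib)
      also have "r powr B / B \<le> 0" using B by (simp add: divide_nonneg_neg)
      finally show ?thesis by simp
    qed
    obtain W2 where W2: "(w2 \<longlongrightarrow> W2) at_top" "\<And>t. 1 \<le> t \<Longrightarrow> w2 t \<le> W2"
      by (rule mono_bounded_tendsto_at_top[of 1 w2 "w2 1 - 1 / B"]) (use flux_system_mono(2)[OF w(1)] bd in auto)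
    have W20: "W2 > 0" using W2(2)[of 1] w(3)[of 1] by simp
    obtain f2 where f2: "global_solution TYPE('a) p q f1 f2" "f2 \<sim>[at_right 0] v2 N p q"
         "flux_profile {0<..} n w2 f2" "(f2 \<longlongrightarrow> 0) at_top" using f2ex[of "w2 1 - 1 / B" 0] bd n by auto
    have "((\<lambda>r. w2 r / r powr 0) \<longlongrightarrow> W2) at_top"
      using W2(1) by (rule Lim_transform_eventually, intro eventually_mono[OF eventually_gt_at_top[of 0]]) simp
    from flux_profile_tail_asymptotics[OF f2(3,4) _ this]
    have "((\<lambda>r. r powr (n - 2) * f2 r) \<longlongrightarrow> W2 / (n - 2)) at_top" using n by simp
    then have "\<exists>c1>0. \<exists>c2>0. \<exists>f1 f2. global_solution TYPE('a) p q f1 f2 \<and>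
         f1 \<sim>[at_right 0] v1 N p q \<and> f2 \<sim>[at_right 0] v2 N p q \<and>
         ((\<lambda>r. r powr (n - 2) * f1 r) \<longlongrightarrow> c1) at_top \<and>
         ((\<lambda>r. r powr (n - 2) * f2 r) \<longlongrightarrow> c2) at_top"
      using f1 f2 n W20 by (intro exI[of _ "1 / (n - 2)"] conjI exI[of _ "W2 / (n - 2)"] exI[of _ f1] exI[of _ f2]) auto
    then show ?thesis unfolding n_def .
  qed
qed

text \<open>
  Adding the constant \<open>1\<close> makes the limits of both components at infinity positive.
\<close>
lemma cusp_global_solutions:
  fixes p q :: real
  assumes N: "N = DIM('a::euclidean_space)" "N \<ge> 3" and pq: "p \<ge> q" "q > 0" "p * q > 1" and q4: "q > q4 p"
  shows "global_solution TYPE('a) p q f1 f2 \<Longrightarrow>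
      \<exists>k1 k2. cusp_global_solution TYPE('a) p q (\<lambda>r. f1 r + k1) (\<lambda>r. f2 r + k2)"
    and "\<exists>f1 f2. global_solution TYPE('a) p q f1 f2"
proof -
  define n where "n = real N"
  have n: "n = real DIM('a)" "n > 2" "n \<ge> 3" "n > 1" using N by (auto simp: n_def)
  define al where "al = - beta1 N p q"
  define ga where "ga = - beta2 N p q"
  define e1 where "e1 = (p * (q - 1) - 2) / (p * q - 1)"
  define e2 where "e2 = (q * (p - 1) - 2) / (p * q - 1)"
  define a where "a = a1 N p q"
  define b where "b = a2 N p q"
  have p1: "p > 1" by (rule larger_exponent_gt_1[OF pq])
  have p0: "p > 0" using p1 by simp
  have q4': "p + 2 < p * q" using q4 p0 by (simp add: q4_def divide_less_eq mult.commute)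
  have qg1: "q > 1"
  proof (rule ccontr)
    assume "\<not> q > 1"
    then have "p * q \<le> p * 1" using p0 by (intro mult_left_mono) auto
    then show False using q4' by simp
  qed
  have q2: "q2 N p < q"
  proof -
    have "(n - 1) * (p + 2) \<le> (n - 1) * (p * q)" using q4' n by (intro mult_left_mono) auto
    moreover have "n + p < (n - 1) * (p + 2)"
    proof -
      have "3 * p \<le> n * p" using n(3) p0 by (intro mult_right_mono) auto
      moreover have "(n - 1) * (p + 2) = n * p + 2 * n - p - 2" by algebra
      ultimately show ?thesis using n(3) p0 by linarith
    qed
    ultimately show ?thesis using n p0 by (simp add: q2_def n_def[symmetric] divide_less_eq algebra_simps)
  qed
  note ce = critical_exponents[OF N(2) pq q2, folded al_def ga_def e1_def e2_def a_def b_def n_def]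
  have e: "0 < e1" "e1 < 1" "0 < e2" "e2 < 1"
  proof -
    have "p * (q - 1) \<le> q * (p - 1)" using pq by (simp add: algebra_simps)
    moreover have "p * (q - 1) > 2" using q4' by (simp add: algebra_simps)
    ultimately show "0 < e1" "0 < e2" using pq by (auto simp: e1_def e2_def)
    show "e1 < 1" "e2 < 1" using pq p0 by (auto simp: e1_def e2_def divide_less_eq algebra_simps)
  qed
  have v: "v1 N p q = (\<lambda>r. a / \<bar>e1\<bar> * r powr e1)" "v2 N p q = (\<lambda>r. b / \<bar>e2\<bar> * r powr e2)"
    by (auto simp: v1_def v2_def ce(11,12) e1_def[symmetric] e2_def[symmetric])
  show "\<exists>k1 k2. cusp_global_solution TYPE('a) p q (\<lambda>r. f1 r + k1) (\<lambda>r. f2 r + k2)"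
    if G: "global_solution TYPE('a) p q f1 f2" for f1 f2
  proof -
    obtain w1 w2 where w: "flux_system {0<..} n p q w1 w2" and f: "flux_profile {0<..} n w1 f1" "flux_profile {0<..} n w2 f2"
      and f0: "\<And>r. r > 0 \<Longrightarrow> 0 \<le> f1 r" "\<And>r. r > 0 \<Longrightarrow> 0 \<le> f2 r" and nz: "\<exists>r>0. w1 r \<noteq> 0 \<or> w2 r \<noteq> 0"
      by (rule flux_of_global_solution[OF n(1,2) G]) blast
    have w0: "\<And>r. r > 0 \<Longrightarrow> 0 \<le> w1 r" "\<And>r. r > 0 \<Longrightarrow> 0 \<le> w2 r" using w unfolding flux_system_def by auto
    have l: "((\<lambda>r. w1 r / (a * r powr al)) \<longlongrightarrow> 1) (at_right 0)" "((\<lambda>r. w2 r / (b * r powr ga)) \<longlongrightarrow> 1) (at_right 0)"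
      by (rule global_flux_asymptotics[OF ce(1,2) _ _ pq(3) ce(3,4) n(2) ce(5-8) _ w f(1) f0(1) nz];
          use p1 qg1 e ce(9,10) in simp)+
    have gs: "flux_profile {0<..} n w1 (\<lambda>r. f1 r + 1)" "flux_profile {0<..} n w2 (\<lambda>r. f2 r + 1)"
      using f by (auto intro: flux_profile_shift)
    have one: "cusp (\<lambda>r. f r + 1) \<and> (\<exists>k. (\<lambda>r. k - (f r + 1)) \<sim>[at_right 0] (\<lambda>r. d / \<bar>s\<bar> * r powr s)) \<and>
       (\<exists>c>0. ((\<lambda>r. f r + 1) \<longlongrightarrow> c) at_top)"
      if f: "flux_profile {0<..} n w f" "\<And>r. r > 0 \<Longrightarrow> 0 \<le> f r" and w0: "\<And>r. r > 0 \<Longrightarrow> 0 \<le> w r"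
        and l: "((\<lambda>r. w r / (d * r powr (n - 2 + s))) \<longlongrightarrow> 1) (at_right 0)" and s: "0 < s" "s < 1" "d > 0" for f w d s
    proof -
      have g: "flux_profile {0<..} n w (\<lambda>r. f r + 1)" using f(1) by (rule flux_profile_shift)
      obtain k where k: "((\<lambda>r. f r + 1) \<longlongrightarrow> k) (at_right 0)" "((\<lambda>r. (k - (f r + 1)) / (d / \<bar>s\<bar> * r powr s)) \<longlongrightarrow> 1) (at_right 0)"
        by (rule flux_profile_cusp_asymptotics[OF g s(3,1) l w0]) 
      have "cusp (\<lambda>r. f r + 1)"
        unfolding cusp_def using k(1) flux_profile_derivative_blowup[OF g s(3,2) l] by blast
      moreover have "(\<lambda>r. k - (f r + 1)) \<sim>[at_right 0] (\<lambda>r. d / \<bar>s\<bar> * r powr s)"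
        by (rule asymp_equivI'[OF k(2)])
      moreover have "\<exists>c>0. ((\<lambda>r. f r + 1) \<longlongrightarrow> c) at_top"
      proof -
        have anti: "f t \<le> f r" if "1 \<le> r" "r \<le> t" for r t
          by (rule flux_profile_antimono[OF f(1) _ _ that(2)]) (use that w0 in auto)
        obtain L where L: "(f \<longlongrightarrow> L) at_top"
          by (rule antimono_bounded_tendsto_at_top[of 1 f 0]) (use anti f(2) in auto)
        have "0 \<le> L"
          by (rule tendsto_lowerbound[OF L]) (use f(2) in \<open>auto intro: eventually_mono[OF eventually_gt_at_top[of 0]]\<close>)
        then show ?thesis using tendsto_add[OF L tendsto_const[of 1]] by (intro exI[of _ "L + 1"]) auto
      qed
      ultimately show ?thesis by blast
    qed
    have o1: "cusp (\<lambda>r. f1 r + 1) \<and> (\<exists>k. (\<lambda>r. k - (f1 r + 1)) \<sim>[at_right 0] v1 N p q) \<and> (\<exists>c>0. ((\<lambda>r. f1 r + 1) \<longlongrightarrow> c) at_top)"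
      unfolding v by (rule one[OF f(1) f0(1) w0(1) l(1)[unfolded ce(9)] e(1,2) ce(3)])
    have o2: "cusp (\<lambda>r. f2 r + 1) \<and> (\<exists>k. (\<lambda>r. k - (f2 r + 1)) \<sim>[at_right 0] v2 N p q) \<and> (\<exists>c>0. ((\<lambda>r. f2 r + 1) \<longlongrightarrow> c) at_top)"
      unfolding v by (rule one[OF f(2) f0(2) w0(2) l(2)[unfolded ce(10)] e(3,4) ce(4)])
    have "global_solution TYPE('a) p q (\<lambda>r. f1 r + 1) (\<lambda>r. f2 r + 1)"
      by (rule global_solution_of_flux[OF n(1) p0 pq(2) w gs _ _ nz]) (use f0 in \<open>auto intro: add_nonneg_nonneg\<close>)
    then have "cusp_global_solution TYPE('a) p q (\<lambda>r. f1 r + 1) (\<lambda>r. f2 r + 1)"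
      unfolding cusp_global_solution_def N(1)[symmetric] using o1 o2 by blast
    then show ?thesis by blast
  qed
  show "\<exists>f1 f2. global_solution TYPE('a) p q f1 f2"
  proof -
    obtain w1 w2 where w: "flux_system {0<..} n p q w1 w2"
      and w1: "\<And>r. r > 0 \<Longrightarrow> 0 < w1 r \<and> w1 r \<le> 1" and w2: "\<And>r. r > 0 \<Longrightarrow> 0 < w2 r"
      by (rule heteroclinic_flux_family[OF ce(1,2) p0 pq(2,3,1) ce(3,4) n(4) ce(5-8) zero_less_one]) blast
    note cw = flux_system_continuous[OF w]
    \<comment> \<open>a positive growth exponent for \<open>w\<^sub>2\<close> below \<open>n - 2\<close>, whatever the sign of the natural one\<close>
    define s where "s = max (n - (n - 1) * q) ((n - 2) / 2)"
    have "(n - 1) * 1 < (n - 1) * q" using qg1 n by (intro mult_strict_left_mono) auto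
    moreover have "2 \<le> (n - 1) * 1" using n(3) by simp
    ultimately have "2 < (n - 1) * q" by (rule le_less_trans[rotated])
    then have "n - (n - 1) * q < n - 2" by simp
    then have s: "s > 0" "n - (n - 1) * q \<le> s" "s < n - 2" using n(2) by (auto simp: s_def less_max_iff_disj)
    have "w2 r \<le> (w2 1 + 1 powr q / s) * r powr s" if r: "r \<ge> 1" for r
    proof -
      have "w2 r \<le> w2 1 + 1 powr q / s * (r powr s - 1)"
        by (rule second_flux_growth[OF w _ pq(2) _ _ r]) (use w1 s in auto)
      also have "\<dots> \<le> w2 1 * r powr s + 1 powr q / s * r powr s"
      proof (rule add_mono)
        have "1 \<le> r powr s" using r s by (simp add: ge_one_powr_ge_zero)
        then show "w2 1 \<le> w2 1 * r powr s" using w2[of 1] by simp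
        show "1 powr q / s * (r powr s - 1) \<le> 1 powr q / s * r powr s" using s by (intro mult_left_mono) auto
      qed
      finally show ?thesis by (simp add: algebra_simps)
    qed
    then obtain f2 where f2: "flux_profile {0<..} n w2 f2" "\<And>r. r > 0 \<Longrightarrow> 0 \<le> f2 r"
      using flux_profile_tail_exists[OF cw(2) _ _ s(3)] w2 by (metis less_imp_le)
    obtain f1 where f1: "flux_profile {0<..} n w1 f1" "(f1 \<longlongrightarrow> 0) at_top" "\<And>r. r > 0 \<Longrightarrow> 0 \<le> f1 r"
      by (rule flux_profile_tail_exists[OF cw(1), where K = 1 and s = 0]) (use w1 n in \<open>auto intro: less_imp_le\<close>)
    have "global_solution TYPE('a) p q f1 f2"
    proof (rule global_solution_of_flux[OF n(1) p0 pq(2) w f1(1) f2(1) f1(3) f2(2)])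
      show "\<exists>r>0. w1 r \<noteq> 0 \<or> w2 r \<noteq> 0" using w1[of 1] by (intro exI[of _ 1]) auto
    qed
    then show ?thesis by blast
  qed
qed

theorem theorem1p1:
  fixes p q :: real and N :: nat
  assumes N: "CARD('n::finite) = N" "N \<ge> 3"
    and pq: "p \<ge> q" "q > 0" "p * q > 1"
  shows
    "(\<forall>r0>0.
        (p < real N / (real N - 1) \<longrightarrow>
           (\<exists>C1>0. \<exists>C2>0. \<exists>f1 f2. local_dirac_solution TYPE(real^'n) r0 p q C1 C2 f1 f2)) \<and>
        (q < q1 N p \<and> p < real N / (real N - 1) \<longrightarrow>
           (\<exists>C2>0. \<exists>f1 f2. local_dirac_solution TYPE(real^'n) r0 p q 0 C2 f1 f2)) \<and>
        (q < q2 N p \<longrightarrow>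
           (\<exists>C1>0. \<exists>f1 f2. local_dirac_solution TYPE(real^'n) r0 p q C1 0 f1 f2)))
     \<and>
     (q2 N p < q \<and> q < q3 p \<longrightarrow>
        (A1abs N p q > 0 \<and> A2abs N p q > 0 \<and>
         global_solution TYPE(real^'n) p q (v1 N p q) (v2 N p q) \<and>
         infinity_singular (v1 N p q) \<and> infinity_singular (v2 N p q)) \<and>
        (q < real N / (real N - 1) \<longrightarrow>
           (\<exists>c :: real \<Rightarrow> real. \<forall>c1>0. c c1 > 0 \<and>
              (\<exists>f1 f2. global_solution TYPE(real^'n) p q f1 f2 \<and>
                 f1 \<sim>[at_right 0] v1 N p q \<and> f2 \<sim>[at_right 0] v2 N p q \<and>
                 ((\<lambda>r. r powr (real N - 2) * f1 r) \<longlongrightarrow> c1) at_top \<and>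
                 ((\<lambda>r. r powr ((real N - 1) * q - 2) * f2 r) \<longlongrightarrow> c c1) at_top))) \<and>
        (q > real N / (real N - 1) \<longrightarrow>
           (\<exists>c1>0. \<exists>c2>0. \<exists>f1 f2. global_solution TYPE(real^'n) p q f1 f2 \<and>
              f1 \<sim>[at_right 0] v1 N p q \<and> f2 \<sim>[at_right 0] v2 N p q \<and>
              ((\<lambda>r. r powr (real N - 2) * f1 r) \<longlongrightarrow> c1) at_top \<and>
              ((\<lambda>r. r powr (real N - 2) * f2 r) \<longlongrightarrow> c2) at_top)))
     \<and>
     (q > q4 p \<longrightarrow>
        (\<exists>f1 f2. cusp_global_solution TYPE(real^'n) p q f1 f2) \<and>
        (\<forall>f1 f2. global_solution TYPE(real^'n) p q f1 f2 \<longrightarrow>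
           (\<exists>k1 k2. cusp_global_solution TYPE(real^'n) p q (\<lambda>r. f1 r + k1) (\<lambda>r. f2 r + k2))))"
proof -
  have D: "N = DIM(real ^ 'n)" using N(1) by simp
  note loc = local_solutions[OF D N(2) pq] and sing = singular_global_solutions[OF D N(2) pq]
    and cusp = cusp_global_solutions[OF D N(2) pq]
  show ?thesis
  proof (intro conjI allI impI, goal_cases)
    case (1 r0)
    then show ?case by (rule loc(1))
  next
    case (2 r0)
    then show ?case using loc(2) by blast
  next
    case (3 r0)
    then show ?case by (rule loc(3))
  next
    case 4
    then show ?case using sing(1) by blast
  next
    case 5
    then show ?case using sing(2) by blast
  next
    case 6
    then show ?case using sing(3) by blast
  next
    case 7
    then show ?case using sing(4) by blast
  next
    case 8
    then show ?case using sing(5) by blast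
  next
    case 9
    then show ?case by (intro sing(6)) auto
  next
    case 10
    then show ?case by (intro sing(7)) auto
  next
    case 11
    from cusp(2)[OF this] obtain f1 f2 where "global_solution TYPE(real ^ 'n) p q f1 f2" by blast
    from cusp(1)[OF 11 this] show ?case by blast
  next
    case (12 f1 f2)
    then show ?case by (rule cusp(1))
  qed
qed

end
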